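(* Let $P$, $\{\widehat P_k\}_{k\ge1}$, $V$, $\pi$, $\widehat\pi_k$, $\phi_k$ be as in the context. Assume that $P$ is $V$-geometrically ergodic with some rate $\rho\in(0,1)$, that $\lim_k\|\widehat P_k-P\|_{0,1}=0$, and that there exist $\delta\in(0,1)$ and $L>0$ such that $PV\le\delta V+L\,1_{\mathbb X}$ and $\widehat P_kV\le\delta V+L\,1_{\mathbb X}$ for every $k\ge1$. Set $\hat\alpha:=\max(r_{ess}(P),\delta)$, $B:=\frac{L}{1-\hat\alpha}$, $A:=1+\frac{L}{1-\delta}$. Let $\vartheta$ be such that $$0<\vartheta<\min\left(\frac{1-\hat\alpha}{3},\frac{1-\rho}{3}\right)$$ and let $\mathcal I_\vartheta$ be the set of integers $k\ge1$ such that $\widehat P_k$ is $V$-geometrically ergodic with some rate $\rho_k<1-2\vartheta$. Let $k\in\mathcal I_\vartheta$, with such a rate $\rho_k$, and let $r_k$ be such that $$\max(\hat\alpha,\rho_k)+\vartheta<r_k<1-\vartheta .$$ Define $$H_k:=\sup_{z\in\mathcal V(r_k,\vartheta,\widehat P_k)^c}\|(zI-\widehat P_k)^{-1}\|_1,\quad n_1(k):=\left\lfloor\frac{\ln2}{\ln(r_k/\hat\alpha)}\right\rfloor+1,\quad n_2(k):=\left\lfloor\frac{\ln\big(8B(B+3)\,r_k^{-n_1(k)}H_k\big)}{\ln(r_k/\hat\alpha)}\right\rfloor+1,$$ $$\varepsilon_1(k):=\frac{r_k^{\,n_1(k)+n_2(k)}}{8B\big(H_kB+(1-r_k)^{-1}\big)},\qquad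 c_k:=\frac{4(B+1)}{r_k^{\,n_1(k)}(1-r_k)}+\frac1{2\varepsilon_1(k)}.$$ If $\|P-\widehat P_k\|_{0,1}\le\varepsilon_1(k)$, then: (a) for all $n\ge0$, $\ \|P^n-\pi(\cdot)1_{\mathbb X}\|_1\le c_k\,r_k^{\,n+1}$; (b) with $\Delta_n:=\|\widehat P_n-P\|_{0,1}$, for all $n\ge1$, $$\|\widehat\pi_n-\pi\|_{TV}\ \le\ |1-\widehat\pi_n(1_{\mathbb X})|+\frac{L}{1-\delta}\left(2c_k+\frac{A}{\ln r_k^{-1}}\,|\ln\Delta_n|\right)\Delta_n .$$
   Context: Setting. $(\mathbb X,\mathcal X)$ is a measurable space and $V:\mathbb X\to[1,+\infty)$ is measurable with $V(x_0)=1$ for some $x_0\in\mathbb X$. $\mathcal B_1$ is the Banach space of measurable $f:\mathbb X\to\mathbb C$ with $\|f\|_1:=\sup_{x}|f(x)|/V(x)<\infty$; $\mathcal B_0$ is the Banach space of bounded measurable $f:\mathbb X\to\mathbb C$ with $\|f\|_0:=\sup_x|f(x)|$. For a linear map $T:\mathcal B_0\to\mathcal B_1$, $\|T\|_{0,1}:=\sup\{\|Tf\|_1: f\in\mathcal B_0,\|f\|_0\le1\}$; $\|T\|_1$ also denotes the operator norm of a bounded linear operator $T$ on $\mathcal B_1$. For a positive measure $\mu$, $\mu(f):=\int f\,d\mu$. A kernel $K$ acts by $(Kf)(x)=\int f(y)K(x,dy)$. Standing assumptions. $P$ is a Markov kernel and $\{\widehat P_k\}_{k\ge1}$ is a sequence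 of nonnegative sub-Markov kernels on $(\mathbb X,\mathcal X)$; $PV/V$ and each $\widehat P_kV/V$ are bounded on $\mathbb X$. $P$ has an invariant probability measure $\pi$ with $\pi(V)<\infty$; each $\widehat P_k$ has an invariant bounded positive measure $\widehat\pi_k$ with $\widehat\pi_k(V)<\infty$, and there is a bounded measurable $\phi_k:\mathbb X\to[0,+\infty)$ with $\widehat P_k\phi_k=\phi_k$ and $\widehat\pi_k(\phi_k)=1$. Each $\widehat P_k$ has finite rank on $\mathcal B_1$; $\lim_k\pi(\phi_k)=1$ and $\lim_k\widehat\pi_k(1_{\mathbb X})=1$. $P$ is $V$-geometrically ergodic with rate $\rho\in(0,1)$ if there is $C>0$ with $\sup_{\|f\|_1\le1}\|P^nf-\pi(f)1_{\mathbb X}\|_1\le C\rho^n$ for all $n\ge0$. $\widehat P_k$ is $V$-geometrically ergodic with rate $\rho_k\in(0,1)$ if there is $C_k>0$ with $\sup_{\|f\|_1\le1}\|\widehat P_k^{\,n}f-\widehat\pi_k(f)\phi_k\|_1\le C_k\rho_k^n$ for all $n\ge0$. $r_{ess}(P)$ is the essential spectral radius of $P$ acting on $\mathcal B_1$, i.e. $\lim_n(\inf_K\|P^n-K\|_1)^{1/n}$, infimum over compact operators $K$ on $\mathcal B_1$. For a bounded operator $T$ on $\mathcal B_1$ with spectrum $\sigma(T)$, $\mathcal V(r,\vartheta,T):=\{z\in\mathbb C:\ |z|\le r\text{ or }d(z,\sigma(T))\le\vartheta\}$ and $\mathcal V(r,\vartheta,T)^c$ is its complement in $\mathbb C$. $\lfloor\cdot\rfloor$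 is the integer part. $\pi(\cdot)1_{\mathbb X}$ is the operator $f\mapsto\pi(f)1_{\mathbb X}$. $\|\widehat\pi_n-\pi\|_{TV}:=\sup_{\|f\|_0\le1}|\widehat\pi_n(f)-\pi(f)|$. Convention: $|\ln0|\cdot0=0$. *)

theory Defs
  imports "HOL-Probability.Probability"
begin

text \<open>
  For a weight \<open>V\<close> (positive on \<open>space M\<close>), \<open>wspace M V\<close> is the Banach space of measurable
  \<open>f\<close> with \<open>sup |f| / V < \<infinity>\<close>, and \<open>wnorm M V\<close> is its norm. Functions are extended by \<open>0\<close>
  outside \<open>space M\<close>, so that equality of functions is equality on \<open>space M\<close>.
  The weight \<open>1\<close> gives the bounded measurable functions with the supremum norm.
\<close>

definition wspace :: "'a measure \<Rightarrow> ('a \<Rightarrow> real) \<Rightarrow> ('a \<Rightarrow> complex) set" where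
  "wspace M V = {f \<in> borel_measurable M.
     (\<forall>x. x \<notin> space M \<longrightarrow> f x = 0) \<and> bdd_above ((\<lambda>x. cmod (f x) / V x) ` space M)}"

definition wnorm :: "'a measure \<Rightarrow> ('a \<Rightarrow> real) \<Rightarrow> ('a \<Rightarrow> complex) \<Rightarrow> real" where
  "wnorm M V f = (SUP x\<in>space M. cmod (f x) / V x)"

definition wball :: "'a measure \<Rightarrow> ('a \<Rightarrow> real) \<Rightarrow> ('a \<Rightarrow> complex) set" where
  "wball M V = {f \<in> wspace M V. wnorm M V f \<le> 1}"

abbreviation one_weight :: "'a \<Rightarrow> real" where
  "one_weight \<equiv> (\<lambda>_. 1)"

type_synonym 'a oper = "('a \<Rightarrow> complex) \<Rightarrow> 'a \<Rightarrow> complex"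

definition oper_diff :: "'a oper \<Rightarrow> 'a oper \<Rightarrow> 'a oper" where
  "oper_diff S T = (\<lambda>f x. S f x - T f x)"

text \<open>
  Norm of an operator from \<open>wspace M V\<close> to \<open>wspace M W\<close>. The supremum is a real one, hence
  meaningful only for bounded operators. The kernel operators of \<open>approx_setting\<close> below are
  bounded, and so are compact operators and resolvents off the spectrum.
\<close>

definition opnorm :: "'a measure \<Rightarrow> ('a \<Rightarrow> real) \<Rightarrow> ('a \<Rightarrow> real) \<Rightarrow> 'a oper \<Rightarrow> real" where
  "opnorm M V W T = (SUP f\<in>wball M V. wnorm M W (T f))"

definition linear_oper :: "'a measure \<Rightarrow> ('a \<Rightarrow> real) \<Rightarrow> 'a oper \<Rightarrow> bool" where
  "linear_oper M V T \<longleftrightarrow> T ` wspace M V \<subseteq> wspace M V \<and>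
     (\<forall>f\<in>wspace M V. \<forall>g\<in>wspace M V. \<forall>a b.
        T (\<lambda>x. a * f x + b * g x) = (\<lambda>x. a * T f x + b * T g x))"

definition bounded_oper :: "'a measure \<Rightarrow> ('a \<Rightarrow> real) \<Rightarrow> 'a oper \<Rightarrow> bool" where
  "bounded_oper M V T \<longleftrightarrow> linear_oper M V T \<and>
     (\<exists>C. \<forall>f\<in>wspace M V. wnorm M V (T f) \<le> C * wnorm M V f)"

text \<open>
  The norm topology. The absolute value changes nothing on \<open>wspace M V\<close>; it makes the distance
  nonnegative on all functions, as \<open>Metric_space\<close> requires.
\<close>

definition wtopology :: "'a measure \<Rightarrow> ('a \<Rightarrow> real) \<Rightarrow> ('a \<Rightarrow> complex) topology" where
  "wtopology M V =
     Metric_space.mtopology (wspace M V) (\<lambda>f g. \<bar>wnorm M V (\<lambda>x. f x - g x)\<bar>)"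

definition compact_oper :: "'a measure \<Rightarrow> ('a \<Rightarrow> real) \<Rightarrow> 'a oper \<Rightarrow> bool" where
  "compact_oper M V T \<longleftrightarrow> linear_oper M V T \<and>
     compactin (wtopology M V) (wtopology M V closure_of (T ` wball M V))"

definition finite_rank :: "'a measure \<Rightarrow> ('a \<Rightarrow> real) \<Rightarrow> 'a oper \<Rightarrow> bool" where
  "finite_rank M V T \<longleftrightarrow> (\<exists>G. finite G \<and> G \<subseteq> wspace M V \<and>
     (\<forall>f\<in>wspace M V. \<exists>c. T f = (\<lambda>x. \<Sum>g\<in>G. c g * g x)))"

definition ess_spectral_radius :: "'a measure \<Rightarrow> ('a \<Rightarrow> real) \<Rightarrow> 'a oper \<Rightarrow> real" where
  "ess_spectral_radius M V T =
     lim (\<lambda>n. root n (INF K\<in>{K. compact_oper M V K}. opnorm M V V (oper_diff (T ^^ n) K)))"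

definition resolvent :: "'a measure \<Rightarrow> ('a \<Rightarrow> real) \<Rightarrow> 'a oper \<Rightarrow> complex \<Rightarrow> 'a oper" where
  "resolvent M V T z = inv_into (wspace M V) (\<lambda>f x. z * f x - T f x)"

definition spectrum :: "'a measure \<Rightarrow> ('a \<Rightarrow> real) \<Rightarrow> 'a oper \<Rightarrow> complex set" where
  "spectrum M V T = {z. \<not> (bij_betw (\<lambda>f x. z * f x - T f x) (wspace M V) (wspace M V) \<and>
                           bounded_oper M V (resolvent M V T z))}"

text \<open>
  \<open>infdist z {} = 0\<close>, but the spectrum of a bounded operator on \<open>wspace M V \<noteq> {0}\<close> is nonempty.
\<close>

definition spectral_nbhd ::
  "'a measure \<Rightarrow> ('a \<Rightarrow> real) \<Rightarrow> real \<Rightarrow> real \<Rightarrow> 'a oper \<Rightarrow> complex set" where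
  "spectral_nbhd M V r \<theta> T = {z. cmod z \<le> r \<or> infdist z (spectrum M V T) \<le> \<theta>}"

definition kernel_oper :: "'a measure \<Rightarrow> ('a \<Rightarrow> 'a measure) \<Rightarrow> 'a oper" where
  "kernel_oper M K = (\<lambda>f x. if x \<in> space M then (LINT y|K x. f y) else 0)"

text \<open>The operator mapping \<open>f\<close> to \<open>\<mu>(f) h\<close>.\<close>

definition rank_one :: "'a measure \<Rightarrow> 'a measure \<Rightarrow> ('a \<Rightarrow> real) \<Rightarrow> 'a oper" where
  "rank_one M \<mu> h = (\<lambda>f x. if x \<in> space M then (LINT y|\<mu>. f y) * complex_of_real (h x) else 0)"

definition invariant_measure :: "'a measure \<Rightarrow> ('a \<Rightarrow> 'a measure) \<Rightarrow> 'a measure \<Rightarrow> bool" where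
  "invariant_measure M K \<mu> \<longleftrightarrow> sets \<mu> = sets M \<and>
     (\<forall>A\<in>sets M. (\<integral>\<^sup>+x. emeasure (K x) A \<partial>\<mu>) = emeasure \<mu> A)"

definition geom_ergodic ::
  "'a measure \<Rightarrow> ('a \<Rightarrow> real) \<Rightarrow> ('a \<Rightarrow> 'a measure) \<Rightarrow> 'a measure \<Rightarrow> ('a \<Rightarrow> real) \<Rightarrow> real \<Rightarrow> bool" where
  "geom_ergodic M V K \<mu> h \<rho> \<longleftrightarrow> 0 < \<rho> \<and> \<rho> < 1 \<and>
     (\<exists>C>0. \<forall>n. opnorm M V V (oper_diff (kernel_oper M K ^^ n) (rank_one M \<mu> h)) \<le> C * \<rho> ^ n)"

definition tv_dist :: "'a measure \<Rightarrow> 'a measure \<Rightarrow> 'a measure \<Rightarrow> real" where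
  "tv_dist M \<mu> \<nu> = (SUP f\<in>wball M one_weight. cmod ((LINT x|\<mu>. f x) - (LINT x|\<nu>. f x)))"

definition drift ::
  "'a measure \<Rightarrow> ('a \<Rightarrow> real) \<Rightarrow> ('a \<Rightarrow> 'a measure) \<Rightarrow> real \<Rightarrow> real \<Rightarrow> bool" where
  "drift M V K \<delta> L \<longleftrightarrow> (\<forall>x\<in>space M. (\<integral>\<^sup>+y. ennreal (V y) \<partial>K x) \<le> ennreal (\<delta> * V x + L))"

text \<open>The approximating kernels \<open>Q k\<close>, with \<open>\<mu> k\<close> and \<open>\<phi> k\<close>, are indexed by \<open>k \<ge> 1\<close>.\<close>

locale approx_setting =
  fixes M :: "'a measure"
    and V :: "'a \<Rightarrow> real"
    and P :: "'a \<Rightarrow> 'a measure"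
    and \<pi> :: "'a measure"
    and Q :: "nat \<Rightarrow> 'a \<Rightarrow> 'a measure"
    and \<mu> :: "nat \<Rightarrow> 'a measure"
    and \<phi> :: "nat \<Rightarrow> 'a \<Rightarrow> real"
  assumes V_measurable: "V \<in> borel_measurable M"
    and V_ge_1: "\<And>x. x \<in> space M \<Longrightarrow> 1 \<le> V x"
    and V_eq_1: "\<exists>x\<in>space M. V x = 1"
    and P_kernel: "P \<in> M \<rightarrow>\<^sub>M prob_algebra M"
    and Q_kernel: "\<And>k. k \<ge> 1 \<Longrightarrow> Q k \<in> M \<rightarrow>\<^sub>M subprob_algebra M"
    and P_V_bounded:
      "\<exists>C. \<forall>x\<in>space M. (\<integral>\<^sup>+y. ennreal (V y) \<partial>P x) \<le> ennreal (C * V x)"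
    and Q_V_bounded:
      "\<And>k. k \<ge> 1 \<Longrightarrow> \<exists>C. \<forall>x\<in>space M. (\<integral>\<^sup>+y. ennreal (V y) \<partial>Q k x) \<le> ennreal (C * V x)"
    and pi_prob: "prob_space \<pi>"
    and pi_invariant: "invariant_measure M P \<pi>"
    and pi_V: "(\<integral>\<^sup>+x. ennreal (V x) \<partial>\<pi>) < \<infinity>"
    and mu_finite: "\<And>k. k \<ge> 1 \<Longrightarrow> finite_measure (\<mu> k)"
    and mu_invariant: "\<And>k. k \<ge> 1 \<Longrightarrow> invariant_measure M (Q k) (\<mu> k)"
    and mu_V: "\<And>k. k \<ge> 1 \<Longrightarrow> (\<integral>\<^sup>+x. ennreal (V x) \<partial>\<mu> k) < \<infinity>"
    and phi_measurable: "\<And>k. k \<ge> 1 \<Longrightarrow> \<phi> k \<in> borel_measurable M"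
    and phi_nonneg: "\<And>k x. k \<ge> 1 \<Longrightarrow> x \<in> space M \<Longrightarrow> 0 \<le> \<phi> k x"
    and phi_bounded: "\<And>k. k \<ge> 1 \<Longrightarrow> bounded (\<phi> k ` space M)"
    and phi_eigen: "\<And>k x. k \<ge> 1 \<Longrightarrow> x \<in> space M \<Longrightarrow> (LINT y|Q k x. \<phi> k y) = \<phi> k x"
    and mu_phi: "\<And>k. k \<ge> 1 \<Longrightarrow> (LINT x|\<mu> k. \<phi> k x) = 1"
    and Q_finite_rank: "\<And>k. k \<ge> 1 \<Longrightarrow> finite_rank M V (kernel_oper M (Q k))"
    and pi_phi_lim: "(\<lambda>k. LINT x|\<pi>. \<phi> k x) \<longlonglongrightarrow> 1"
    and mu_one_lim: "(\<lambda>k. measure (\<mu> k) (space M)) \<longlonglongrightarrow> 1"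

end

theory Submission
  imports Defs
begin

text \<open>
  The theorem transfers a known spectral gap of one approximating kernel \<open>Q k\<close> to the limit kernel
  \<open>P\<close>, with explicit constants, although the two kernels are close only in the weak sense: as
  operators from bounded functions to \<open>wspace M V\<close>.

  Let \<open>z\<close> satisfy \<open>|z| > r\<close> and \<open>|z - 1| > \<theta>\<close>. There the resolvent of \<open>Q k\<close> is bounded by \<open>H\<close>. The
  drift condition gives a Lasota-Yorke inequality for the powers of both kernels, with contraction
  \<open>\<alpha>\<close> in the strong norm and a constant \<open>B = L / (1 - \<alpha>)\<close> in front of the weak norm. In the manner of
  Keller and Liverani, one lets \<open>n\<^sub>1\<close> steps of \<open>P\<close> reduce the strong norm of the resolvent of \<open>P\<close> to its
  weak norm, and \<open>n\<^sub>2\<close> steps of \<open>Q k\<close> inside the resolvent of \<open>Q k\<close> reduce the weak norm to a small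
  multiple of the strong one. The two inequalities close up as soon as the weak distance of the
  kernels is at most \<open>\<epsilon>\<close>, and give \<open>\<parallel>u\<parallel> \<le> c \<parallel>(z - P) u\<parallel>\<close> for every \<open>z\<close> in the region at which the
  resolvent of \<open>P\<close> exists (\<open>functional_estimate\<close>, \<open>resolvent_estimate\<close>). The argument is usually run
  on the dual spaces; here the dual inequality is obtained by splitting a function dominated by
  \<open>a V + b\<close> into a part dominated by \<open>a V\<close> and a part dominated by \<open>b\<close> (\<open>wspace_decompose\<close>).

  Geometric ergodicity of \<open>P\<close>, at an unspecified rate, provides the resolvent outside some disc. The
  uniform bound \<open>c\<close> pushes this disc inwards until its radius is \<open>r\<close>: a bound on the squared
  resolvent bounds \<open>n + 1\<close> times the \<open>n\<close>-th deviation from equilibrium, which is incompatible with an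
  optimal rate above \<open>r\<close> (\<open>rate_above_r\<close>). Cauchy's estimate on circles of radius slightly larger
  than \<open>r\<close> then yields part (a), without any loss in the constant (\<open>dev_bound\<close>).

  For part (b) let \<open>f\<close> be bounded. By invariance of \<open>\<mu> n\<close> under \<open>Q n\<close>, the integral of \<open>f\<close> changes by
  at most \<open>j \<Delta>\<^sub>n\<close> times the integral of \<open>V\<close> when \<open>f\<close> is replaced by its \<open>j\<close>-th iterate under \<open>P\<close>
  (\<open>stationary_distance\<close>). By part (a) this iterate is within \<open>c r ^ (j + 1) V\<close> of a constant, and a
  suitable \<open>j\<close> of order \<open>ln \<Delta>\<^sub>n / ln r\<close> balances the two errors (\<open>optimal_iteration_bound\<close>).
\<close>

section \<open>Weighted spaces of measurable functions\<close>

locale weight_space =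
  fixes M :: "'a measure" and V :: "'a \<Rightarrow> real"
  assumes weight_measurable: "V \<in> borel_measurable M"
    and weight_ge_1: "x \<in> space M \<Longrightarrow> 1 \<le> V x"
    and space_nonempty: "space M \<noteq> {}"
begin

lemma weight_pos: "x \<in> space M \<Longrightarrow> 0 < V x"
  using weight_ge_1 by force

lemma wspaceI:
  assumes "f \<in> borel_measurable M" "\<And>x. x \<notin> space M \<Longrightarrow> f x = 0"
    and "\<And>x. x \<in> space M \<Longrightarrow> cmod (f x) \<le> C * V x"
  shows "f \<in> wspace M V"
proof -
  have "bdd_above ((\<lambda>x. cmod (f x) / V x) ` space M)"
    using assms(3) weight_pos by (intro bdd_aboveI2[of _ _ C]) (simp add: divide_le_eq)
  then show ?thesis using assms by (simp add: wspace_def)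
qed

lemma wspace_measurable: "f \<in> wspace M V \<Longrightarrow> f \<in> borel_measurable M"
  and wspace_outside: "f \<in> wspace M V \<Longrightarrow> x \<notin> space M \<Longrightarrow> f x = 0"
  by (auto simp: wspace_def)

lemma wnorm_bound:
  assumes "f \<in> wspace M V" "x \<in> space M"
  shows "cmod (f x) \<le> wnorm M V f * V x"
proof -
  have "cmod (f x) / V x \<le> wnorm M V f"
    unfolding wnorm_def using assms by (intro cSUP_upper) (auto simp: wspace_def)
  then show ?thesis using weight_pos[OF assms(2)] by (simp add: divide_le_eq)
qed

lemma wnorm_leI:
  assumes "\<And>x. x \<in> space M \<Longrightarrow> cmod (f x) \<le> C * V x"
  shows "wnorm M V f \<le> C"
  unfolding wnorm_def using assms space_nonempty weight_pos
  by (intro cSUP_least) (simp_all add: divide_le_eq)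

lemma wnorm_nonneg:
  assumes "f \<in> wspace M V" shows "0 \<le> wnorm M V f"
proof -
  obtain x where x: "x \<in> space M" using space_nonempty by blast
  have "0 \<le> wnorm M V f * V x" using wnorm_bound[OF assms x] norm_ge_zero[of "f x"] by linarith
  then show ?thesis using weight_pos[OF x] by (simp add: zero_le_mult_iff)
qed

lemma wspace_lincomb:
  assumes "f \<in> wspace M V" "g \<in> wspace M V"
  shows "(\<lambda>x. a * f x + b * g x) \<in> wspace M V"
proof (rule wspaceI)
  have [measurable]: "f \<in> borel_measurable M" "g \<in> borel_measurable M"
    using assms by (auto dest: wspace_measurable)
  show "(\<lambda>x. a * f x + b * g x) \<in> borel_measurable M" by measurable
  show "a * f x + b * g x = 0" if "x \<notin> space M" for x using assms that by (simp add: wspace_outside)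
  show "cmod (a * f x + b * g x) \<le> (cmod a * wnorm M V f + cmod b * wnorm M V g) * V x"
    if "x \<in> space M" for x
  proof -
    have "cmod (a * f x + b * g x) \<le> cmod a * cmod (f x) + cmod b * cmod (g x)"
      by (metis norm_mult norm_triangle_ineq)
    also have "\<dots> \<le> cmod a * (wnorm M V f * V x) + cmod b * (wnorm M V g * V x)"
      using wnorm_bound[OF assms(1) that] wnorm_bound[OF assms(2) that]
      by (intro add_mono mult_left_mono) auto
    finally show ?thesis by (simp add: algebra_simps)
  qed
qed

lemma wspace_zero: "(\<lambda>x. 0) \<in> wspace M V"
  by (rule wspaceI[of _ 0]) auto

lemma wspace_cmult: "f \<in> wspace M V \<Longrightarrow> (\<lambda>x. a * f x) \<in> wspace M V"
  using wspace_lincomb[of f f a 0] by simp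

lemma wspace_add: "f \<in> wspace M V \<Longrightarrow> g \<in> wspace M V \<Longrightarrow> (\<lambda>x. f x + g x) \<in> wspace M V"
  using wspace_lincomb[of f g 1 1] by simp

lemma wspace_diff: "f \<in> wspace M V \<Longrightarrow> g \<in> wspace M V \<Longrightarrow> (\<lambda>x. f x - g x) \<in> wspace M V"
  using wspace_lincomb[of f g 1 "-1"] by simp

lemma wspace_sum:
  "(\<And>i. i \<in> I \<Longrightarrow> f i \<in> wspace M V) \<Longrightarrow> (\<lambda>x. \<Sum>i\<in>I. f i x) \<in> wspace M V"
  by (induction I rule: infinite_finite_induct) (auto intro: wspace_zero wspace_add)

lemma wnorm_diff_le:
  assumes "f \<in> wspace M V" "g \<in> wspace M V"
  shows "wnorm M V (\<lambda>x. f x - a * g x) \<le> wnorm M V f + cmod a * wnorm M V g"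
proof (rule wnorm_leI)
  fix x assume x: "x \<in> space M"
  have "cmod (f x - a * g x) \<le> cmod (f x) + cmod a * cmod (g x)"
    by (metis norm_mult norm_triangle_ineq4)
  also have "\<dots> \<le> wnorm M V f * V x + cmod a * (wnorm M V g * V x)"
    using wnorm_bound[OF assms(1) x] wnorm_bound[OF assms(2) x] by (intro add_mono mult_left_mono) auto
  finally show "cmod (f x - a * g x) \<le> (wnorm M V f + cmod a * wnorm M V g) * V x"
    by (simp add: algebra_simps)
qed

lemma wball_scaled:
  assumes f: "f \<in> wspace M V" and a: "0 < a" "wnorm M V f \<le> a"
  shows "(\<lambda>x. complex_of_real (inverse a) * f x) \<in> wball M V"
proof -
  have "wnorm M V (\<lambda>x. complex_of_real (inverse a) * f x) \<le> 1"
  proof (rule wnorm_leI)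
    fix x assume x: "x \<in> space M"
    have "cmod (f x) \<le> a * V x"
      using wnorm_bound[OF f x] a weight_pos[OF x]
      by (meson dual_order.trans less_imp_le mult_right_mono)
    then show "cmod (complex_of_real (inverse a) * f x) \<le> 1 * V x"
      using a by (simp add: norm_mult norm_divide divide_le_eq divide_inverse[symmetric] mult.commute)
  qed
  then show ?thesis using f by (simp add: wball_def wspace_cmult)
qed

lemma wball_zero: "(\<lambda>x. 0) \<in> wball M V"
  using wspace_zero weight_pos by (auto simp: wball_def less_imp_le intro!: wnorm_leI)

lemma wballD: "f \<in> wball M V \<Longrightarrow> f \<in> wspace M V" "f \<in> wball M V \<Longrightarrow> wnorm M V f \<le> 1"
  by (auto simp: wball_def)

lemma wball_bound: "f \<in> wball M V \<Longrightarrow> x \<in> space M \<Longrightarrow> cmod (f x) \<le> V x"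
  using wnorm_bound[of f x] wballD[of f] weight_pos[of x]
  by (smt (verit) mult_left_le_one_le mult_right_mono)

lemma wballI: "f \<in> wspace M V \<Longrightarrow> (\<And>x. x \<in> space M \<Longrightarrow> cmod (f x) \<le> V x) \<Longrightarrow> f \<in> wball M V"
  by (auto simp: wball_def intro!: wnorm_leI)

sublocale one: weight_space M one_weight
  by unfold_locales (auto simp: space_nonempty)

lemma one_wspace_imp_wspace: "f \<in> wspace M one_weight \<Longrightarrow> f \<in> wspace M V"
proof (rule wspaceI[where C = "wnorm M one_weight f"])
  fix x assume f: "f \<in> wspace M one_weight" and x: "x \<in> space M"
  have "cmod (f x) \<le> wnorm M one_weight f * 1" using one.wnorm_bound[OF f x] .
  also have "\<dots> \<le> wnorm M one_weight f * V x"
    using one.wnorm_nonneg[OF f] weight_ge_1[OF x] by (intro mult_left_mono) auto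
  finally show "cmod (f x) \<le> wnorm M one_weight f * V x" .
qed (auto dest: one.wspace_measurable one.wspace_outside)

text \<open>
A function dominated by \<open>a V + b\<close> is shared out between the strong and the weak space in the
proportion \<open>a V : b\<close>. This replaces duality: it turns a drift bound \<open>|T f| \<le> a V + b\<close> into the
estimate \<open>|F (T f)| \<le> a N + b w\<close> for every linear functional \<open>F\<close> of strong norm \<open>N\<close> and weak
norm \<open>w\<close>.
\<close>

lemma wspace_decompose:
  assumes f: "f \<in> wspace M V" and a: "0 \<le> a" and b: "0 \<le> b"
    and bound: "\<And>x. x \<in> space M \<Longrightarrow> cmod (f x) \<le> a * V x + b"
  obtains u v where "u \<in> wspace M V" "v \<in> wspace M one_weight" "f = (\<lambda>x. u x + v x)"
    "\<forall>x\<in>space M. cmod (u x) \<le> a * V x" "\<forall>x\<in>space M. cmod (v x) \<le> b"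
proof -
  define p where "p x = a * V x / (a * V x + b)" for x
  define q where "q x = b / (a * V x + b)" for x
  note [measurable] = weight_measurable wspace_measurable[OF f]
  have aV: "0 \<le> a * V x" if "x \<in> space M" for x using a weight_pos[OF that] by simp
  have pq: "cmod (f x) * p x \<le> a * V x" "cmod (f x) * q x \<le> b"
    "f x = complex_of_real (p x) * f x + complex_of_real (q x) * f x"
    "0 \<le> p x" "0 \<le> q x" if x: "x \<in> space M" for x
  proof -
    show "0 \<le> p x" "0 \<le> q x" using aV[OF x] b by (auto simp: p_def q_def)
    consider "a * V x + b = 0" | "a * V x + b > 0" using aV[OF x] b by linarith
    then have "cmod (f x) * p x \<le> a * V x \<and> cmod (f x) * q x \<le> b
      \<and> f x = complex_of_real (p x) * f x + complex_of_real (q x) * f x"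
    proof cases
      case 1
      then have "f x = 0" using bound[OF x] by simp
      then show ?thesis using aV[OF x] b by simp
    next
      case 2
      have "p x + q x = 1" using 2 by (simp add: p_def q_def flip: add_divide_distrib)
      then have "complex_of_real (p x) * f x + complex_of_real (q x) * f x = f x"
        by (metis distrib_right mult_1 of_real_1 of_real_add)
      moreover have "cmod (f x) * p x \<le> (a * V x + b) * p x"
        using bound[OF x] \<open>0 \<le> p x\<close> by (rule mult_right_mono)
      moreover have "cmod (f x) * q x \<le> (a * V x + b) * q x"
        using bound[OF x] \<open>0 \<le> q x\<close> by (rule mult_right_mono)
      ultimately show ?thesis using 2 by (simp add: p_def q_def)
    qed
    then show "cmod (f x) * p x \<le> a * V x" "cmod (f x) * q x \<le> b"
      "f x = complex_of_real (p x) * f x + complex_of_real (q x) * f x" by auto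
  qed
  show thesis
  proof
    show "(\<lambda>x. complex_of_real (p x) * f x) \<in> wspace M V"
    proof (rule wspaceI[where C = a])
      show "(\<lambda>x. complex_of_real (p x) * f x) \<in> borel_measurable M"
        unfolding p_def by measurable
    qed (use pq f in \<open>auto simp: norm_mult wspace_outside mult.commute\<close>)
    show "(\<lambda>x. complex_of_real (q x) * f x) \<in> wspace M one_weight"
    proof (rule one.wspaceI[where C = b])
      show "(\<lambda>x. complex_of_real (q x) * f x) \<in> borel_measurable M"
        unfolding q_def by measurable
    qed (use pq f in \<open>auto simp: norm_mult wspace_outside mult.commute\<close>)
    show "f = (\<lambda>x. complex_of_real (p x) * f x + complex_of_real (q x) * f x)"
      using pq(3) f by (auto simp: fun_eq_iff wspace_outside)
         (metis add.right_neutral mult_zero_right wspace_outside)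
  qed (use pq in \<open>auto simp: norm_mult mult.commute\<close>)
qed

end

section \<open>Bounded operators between weighted spaces\<close>

text \<open>
The bound is stated pointwise and the operator may change the weight, so that the same notion
serves operators on one weighted space and the difference of two kernels viewed as an operator
from bounded functions to \<open>wspace M V\<close>.
\<close>

definition bounded_between ::
  "'a measure \<Rightarrow> ('a \<Rightarrow> real) \<Rightarrow> ('a \<Rightarrow> real) \<Rightarrow> 'a oper \<Rightarrow> bool" where
  "bounded_between M V W T \<longleftrightarrow> T ` wspace M V \<subseteq> wspace M W \<and>
     (\<forall>f\<in>wspace M V. \<forall>g\<in>wspace M V. \<forall>a b.
        T (\<lambda>x. a * f x + b * g x) = (\<lambda>x. a * T f x + b * T g x)) \<and>
     (\<exists>C. \<forall>f\<in>wspace M V. \<forall>x\<in>space M. cmod (T f x) \<le> C * wnorm M V f * W x)"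

lemma bounded_betweenD:
  assumes "bounded_between M V W T"
  shows bounded_between_maps: "f \<in> wspace M V \<Longrightarrow> T f \<in> wspace M W"
    and bounded_between_lincomb: "f \<in> wspace M V \<Longrightarrow> g \<in> wspace M V \<Longrightarrow>
      T (\<lambda>x. a * f x + b * g x) = (\<lambda>x. a * T f x + b * T g x)"
  using assms unfolding bounded_between_def by blast+

lemma bounded_between_bound:
  assumes "bounded_between M V W T" "weight_space M V" "weight_space M W"
  obtains C where "0 \<le> C"
    "\<And>f x. f \<in> wspace M V \<Longrightarrow> x \<in> space M \<Longrightarrow> cmod (T f x) \<le> C * wnorm M V f * W x"
proof -
  obtain C where C: "\<forall>f\<in>wspace M V. \<forall>x\<in>space M. cmod (T f x) \<le> C * wnorm M V f * W x"
    using assms(1) unfolding bounded_between_def by blast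
  have "cmod (T f x) \<le> \<bar>C\<bar> * wnorm M V f * W x" if f: "f \<in> wspace M V" and x: "x \<in> space M" for f x
  proof -
    have "0 \<le> wnorm M V f * W x"
      using weight_space.wnorm_nonneg[OF assms(2) f] weight_space.weight_pos[OF assms(3) x] by simp
    then have "C * (wnorm M V f * W x) \<le> \<bar>C\<bar> * (wnorm M V f * W x)"
      by (intro mult_right_mono) auto
    then show ?thesis using C f x by (force simp: mult.assoc)
  qed
  then show thesis using that[of "\<bar>C\<bar>"] by simp
qed

lemma bounded_between_diff:
  assumes S: "bounded_between M V W S" and T: "bounded_between M V W T"
    and V: "weight_space M V" and W: "weight_space M W"
  shows "bounded_between M V W (oper_diff S T)"
proof -
  interpret W: weight_space M W by fact
  obtain C D where
    C: "\<And>f x. f \<in> wspace M V \<Longrightarrow> x \<in> space M \<Longrightarrow> cmod (S f x) \<le> C * wnorm M V f * W x" and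
    D: "\<And>f x. f \<in> wspace M V \<Longrightarrow> x \<in> space M \<Longrightarrow> cmod (T f x) \<le> D * wnorm M V f * W x"
    using bounded_between_bound[OF S V W] bounded_between_bound[OF T V W] by metis
  have "cmod (oper_diff S T f x) \<le> (C + D) * wnorm M V f * W x"
    if "f \<in> wspace M V" "x \<in> space M" for f x
    using norm_triangle_ineq4[of "S f x" "T f x"] C[OF that] D[OF that]
    by (simp add: oper_diff_def algebra_simps)
  then have "\<exists>E. \<forall>f\<in>wspace M V. \<forall>x\<in>space M. cmod (oper_diff S T f x) \<le> E * wnorm M V f * W x"
    by blast
  moreover have "oper_diff S T (\<lambda>x. a * f x + b * g x)
      = (\<lambda>x. a * oper_diff S T f x + b * oper_diff S T g x)"
    if "f \<in> wspace M V" "g \<in> wspace M V" for f g a b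
    by (simp add: oper_diff_def bounded_between_lincomb[OF S that]
        bounded_between_lincomb[OF T that] algebra_simps)
  ultimately show ?thesis
    using bounded_between_maps[OF S] bounded_between_maps[OF T]
    by (auto simp: bounded_between_def oper_diff_def intro!: W.wspace_diff)
qed

lemma bounded_between_cmult:
  assumes T: "bounded_between M V W T" and "weight_space M V" and f: "f \<in> wspace M V"
  shows "T (\<lambda>x. a * f x) = (\<lambda>x. a * T f x)"
  using bounded_between_lincomb[OF T f f, of a 0] by simp

lemma bounded_between_sum:
  assumes T: "bounded_between M V W T" and V: "weight_space M V" and "finite I"
    and f: "\<And>i. i \<in> I \<Longrightarrow> f i \<in> wspace M V"
  shows "T (\<lambda>x. \<Sum>i\<in>I. c i * f i x) = (\<lambda>x. \<Sum>i\<in>I. c i * T (f i) x)"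
  using \<open>finite I\<close> f
proof (induction I rule: finite_induct)
  case empty
  then show ?case
    using bounded_between_lincomb[OF T weight_space.wspace_zero[OF V] weight_space.wspace_zero[OF V], of 0 0]
    by simp
next
  case (insert i I)
  have "(\<lambda>x. \<Sum>i\<in>I. c i * f i x) \<in> wspace M V"
    using insert.prems by (intro weight_space.wspace_sum[OF V] weight_space.wspace_cmult[OF V]) auto
  then show ?case
    using bounded_between_lincomb[OF T, of "f i" _ "c i" 1] insert by simp
qed

lemma bounded_between_power:
  assumes T: "bounded_between M V V T" and V: "weight_space M V"
  shows "bounded_between M V V (T ^^ n)"
proof (induction n)
  case 0
  have "\<forall>f\<in>wspace M V. \<forall>x\<in>space M. cmod (f x) \<le> 1 * wnorm M V f * V x"
    using weight_space.wnorm_bound[OF V] by simp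
  then show ?case by (auto simp: bounded_between_def id_def intro!: exI[of _ 1])
next
  case (Suc n)
  obtain C where C: "0 \<le> C"
    "\<And>f x. f \<in> wspace M V \<Longrightarrow> x \<in> space M \<Longrightarrow> cmod (T f x) \<le> C * wnorm M V f * V x"
    using bounded_between_bound[OF T V V] by metis
  obtain D where D: "0 \<le> D"
    "\<And>f x. f \<in> wspace M V \<Longrightarrow> x \<in> space M \<Longrightarrow> cmod ((T ^^ n) f x) \<le> D * wnorm M V f * V x"
    using bounded_between_bound[OF Suc V V] by metis
  have "cmod ((T ^^ Suc n) f x) \<le> (C * D) * wnorm M V f * V x"
    if f: "f \<in> wspace M V" and x: "x \<in> space M" for f x
  proof -
    have "cmod (T ((T ^^ n) f) x) \<le> C * wnorm M V ((T ^^ n) f) * V x"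
      using C(2) bounded_between_maps[OF Suc f] x by blast
    also have "\<dots> \<le> C * (D * wnorm M V f) * V x"
      using weight_space.wnorm_leI[OF V D(2)[OF f]] C(1) weight_space.weight_pos[OF V x]
      by (intro mult_right_mono mult_left_mono) auto
    finally show ?thesis by (simp add: mult.assoc)
  qed
  then have "\<exists>E. \<forall>f\<in>wspace M V. \<forall>x\<in>space M. cmod ((T ^^ Suc n) f x) \<le> E * wnorm M V f * V x"
    by blast
  moreover have "(T ^^ Suc n) (\<lambda>x. a * f x + b * g x)
      = (\<lambda>x. a * (T ^^ Suc n) f x + b * (T ^^ Suc n) g x)"
    if "f \<in> wspace M V" "g \<in> wspace M V" for f g a b
    using that by (simp add: bounded_between_lincomb[OF Suc] bounded_between_lincomb[OF T]
        bounded_between_maps[OF Suc])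
  ultimately show ?case
    using bounded_between_maps[OF T] bounded_between_maps[OF Suc]
    by (auto simp: bounded_between_def)
qed

text \<open>
The supremum that defines \<open>opnorm\<close> is a real one and carries information only if it is taken over
a bounded set; this is what boundedness of \<open>T\<close> provides.
\<close>

lemma opnorm_bound:
  assumes T: "bounded_between M V W T" and V: "weight_space M V" and W: "weight_space M W"
    and f: "f \<in> wspace M V" and x: "x \<in> space M"
  shows "cmod (T f x) \<le> opnorm M V W T * wnorm M V f * W x"
proof -
  interpret V: weight_space M V by fact
  interpret W: weight_space M W by fact
  obtain C where C: "0 \<le> C"
    "\<And>f x. f \<in> wspace M V \<Longrightarrow> x \<in> space M \<Longrightarrow> cmod (T f x) \<le> C * wnorm M V f * W x"
    using bounded_between_bound[OF T V W] by metis
  have "wnorm M W (T g) \<le> C" if "g \<in> wball M V" for g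
  proof (rule W.wnorm_leI)
    fix x assume x: "x \<in> space M"
    have "cmod (T g x) \<le> C * wnorm M V g * W x" using C V.wballD[OF that] x by blast
    also have "\<dots> \<le> C * 1 * W x"
      using C V.wballD[OF that] W.weight_pos[OF x] by (intro mult_right_mono mult_left_mono) auto
    finally show "cmod (T g x) \<le> C * W x" by simp
  qed
  then have bdd: "bdd_above ((\<lambda>f. wnorm M W (T f)) ` wball M V)" by (intro bdd_aboveI2)
  \<comment> \<open>Scaling by \<open>a\<close> slightly above the norm of \<open>f\<close> avoids a division by zero when \<open>f\<close> vanishes.\<close>
  have *: "cmod (T f x) \<le> opnorm M V W T * a * W x" if a: "0 < a" "wnorm M V f \<le> a" for a
  proof -
    let ?g = "\<lambda>x. complex_of_real (inverse a) * f x"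
    have g: "?g \<in> wball M V" using V.wball_scaled[OF f a] .
    have "wnorm M W (T ?g) \<le> opnorm M V W T"
      unfolding opnorm_def by (intro cSUP_upper bdd g)
    moreover have "cmod (T ?g x) \<le> wnorm M W (T ?g) * W x"
      using W.wnorm_bound bounded_between_maps[OF T] V.wballD(1)[OF g] x by blast
    ultimately have "cmod (T ?g x) \<le> opnorm M V W T * W x"
      using W.weight_pos[OF x] by (meson dual_order.trans less_imp_le mult_right_mono)
    then have "inverse a * cmod (T f x) \<le> opnorm M V W T * W x"
      unfolding bounded_between_cmult[OF T V f] using a by (simp add: norm_mult norm_inverse mult.commute)
    then show ?thesis
      using a by (simp add: field_simps)
  qed
  have "((\<lambda>a. opnorm M V W T * a * W x) \<longlongrightarrow> opnorm M V W T * wnorm M V f * W x)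
      (at_right (wnorm M V f))"
    by (intro tendsto_intros)
  moreover have "\<forall>\<^sub>F a in at_right (wnorm M V f). cmod (T f x) \<le> opnorm M V W T * a * W x"
    by (rule eventually_mono[OF eventually_at_right_less]) (use * V.wnorm_nonneg[OF f] in auto)
  ultimately show ?thesis by (rule tendsto_lowerbound) simp
qed

lemma opnorm_leI:
  assumes V: "weight_space M V" and W: "weight_space M W"
    and bound: "\<And>f x. f \<in> wball M V \<Longrightarrow> x \<in> space M \<Longrightarrow> cmod (T f x) \<le> C * W x"
  shows "opnorm M V W T \<le> C"
  unfolding opnorm_def using weight_space.wball_zero[OF V] bound
  by (intro cSUP_least weight_space.wnorm_leI[OF W]) auto

context weight_space begin

lemma bounded_between_one_imp:
  assumes T: "bounded_between M one_weight one_weight T"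
  shows "bounded_between M one_weight V T"
proof -
  obtain C where C: "0 \<le> C"
    "\<And>f x. f \<in> wspace M one_weight \<Longrightarrow> x \<in> space M \<Longrightarrow> cmod (T f x) \<le> C * wnorm M one_weight f * 1"
    using bounded_between_bound[OF T one.weight_space_axioms one.weight_space_axioms] by blast
  have bound: "cmod (T f x) \<le> C * wnorm M one_weight f * V x"
    if f: "f \<in> wspace M one_weight" and x: "x \<in> space M" for f x
  proof -
    have "C * wnorm M one_weight f * 1 \<le> C * wnorm M one_weight f * V x"
      using C(1) one.wnorm_nonneg[OF f] weight_ge_1[OF x] by (intro mult_left_mono) auto
    then show ?thesis using C(2)[OF f x] by linarith
  qed
  show ?thesis
    unfolding bounded_between_def
  proof (intro conjI ballI allI exI)
    show "T ` wspace M one_weight \<subseteq> wspace M V"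
      by (rule image_subsetI) (rule one_wspace_imp_wspace[OF bounded_between_maps[OF T]])
  qed (rule bounded_between_lincomb[OF T], assumption+, rule bound)
qed

lemma opnorm_one_nonneg:
  assumes "bounded_between M one_weight V T"
  shows "0 \<le> opnorm M one_weight V T"
proof -
  obtain x where x: "x \<in> space M" using space_nonempty by blast
  let ?f = "\<lambda>x. if x \<in> space M then 1 else 0 :: complex"
  have "(\<lambda>x. 1 :: complex) \<in> borel_measurable M" by simp
  then have "?f \<in> borel_measurable M"
    by (rule measurable_cong[THEN iffD1, rotated]) simp
  then have f: "?f \<in> wspace M one_weight" by (rule one.wspaceI[where C = 1]) auto
  have "1 \<le> wnorm M one_weight ?f" using one.wnorm_bound[OF f x] x by simp
  then have pos: "0 < wnorm M one_weight ?f * V x" using weight_pos[OF x] by simp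
  have "0 \<le> opnorm M one_weight V T * (wnorm M one_weight ?f * V x)"
    using order_trans[OF norm_ge_zero opnorm_bound[OF assms one.weight_space_axioms weight_space_axioms f x]]
    by (simp only: mult.assoc)
  then show ?thesis using pos by (simp add: zero_le_mult_iff)
qed

end

section \<open>Kernels and the drift condition\<close>

context weight_space begin

lemma wspace_integrable:
  assumes N: "sets N = sets M" and V: "(\<integral>\<^sup>+y. ennreal (V y) \<partial>N) < \<infinity>"
  shows "integrable N V" and "f \<in> wspace M V \<Longrightarrow> integrable N f"
proof -
  have sp: "space N = space M" using N by (rule sets_eq_imp_space_eq)
  have [measurable]: "V \<in> borel_measurable N"
    using weight_measurable N by (simp cong: measurable_cong_sets)
  have "(\<integral>\<^sup>+y. ennreal (norm (V y)) \<partial>N) = (\<integral>\<^sup>+y. ennreal (V y) \<partial>N)"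
    using weight_pos by (intro nn_integral_cong) (simp add: sp less_imp_le)
  then show V': "integrable N V" using V by (intro integrableI_bounded) auto
  assume f: "f \<in> wspace M V"
  have "f \<in> borel_measurable N"
    using wspace_measurable[OF f] N by (simp cong: measurable_cong_sets)
  moreover have "AE x in N. norm (f x) \<le> norm (wnorm M V f * V x)"
  proof (intro AE_I2)
    fix x assume "x \<in> space N"
    then show "norm (f x) \<le> norm (wnorm M V f * V x)"
      using wnorm_bound[OF f, of x] by (simp add: sp)
  qed
  ultimately show "integrable N f"
    by (rule Bochner_Integration.integrable_bound[OF integrable_mult_right[OF V']])
qed

lemma integral_lincomb:
  assumes N: "sets N = sets M" and V: "(\<integral>\<^sup>+y. ennreal (V y) \<partial>N) < \<infinity>"
    and fg: "f \<in> wspace M V" "g \<in> wspace M V"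
  shows "(LINT y|N. a * f y + b * g y) = a * (LINT y|N. f y) + b * (LINT y|N. g y)"
  using wspace_integrable(2)[OF N V fg(1)] wspace_integrable(2)[OF N V fg(2)] by simp

lemma integral_weight_bound:
  assumes N: "sets N = sets M" "finite_measure N" and V: "(\<integral>\<^sup>+y. ennreal (V y) \<partial>N) < \<infinity>"
    and f: "f \<in> wspace M V" and bound: "\<And>x. x \<in> space M \<Longrightarrow> cmod (f x) \<le> a * V x + b"
  shows "cmod (LINT y|N. f y) \<le> a * (LINT y|N. V y) + b * measure N (space M)"
proof -
  interpret finite_measure N by fact
  have sp: "space N = space M" using N(1) by (rule sets_eq_imp_space_eq)
  note int = wspace_integrable(1)[OF N(1) V] wspace_integrable(2)[OF N(1) V f]
  have "cmod (LINT y|N. f y) \<le> (LINT y|N. cmod (f y))" by (rule integral_norm_bound)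
  also have "\<dots> \<le> (LINT y|N. a * V y + b)"
    using int bound by (intro integral_mono) (auto simp: sp)
  also have "\<dots> = a * (LINT y|N. V y) + b * measure N (space M)"
    using int by (simp add: sp mult.commute)
  finally show ?thesis .
qed

end

locale weighted_kernel = weight_space +
  fixes K :: "'a \<Rightarrow> 'a measure"
  assumes kernel: "K \<in> M \<rightarrow>\<^sub>M subprob_algebra M"
    and kernel_weight: "\<exists>C. \<forall>x\<in>space M. (\<integral>\<^sup>+y. ennreal (V y) \<partial>K x) \<le> ennreal (C * V x)"
begin

lemma kernel_sets: "x \<in> space M \<Longrightarrow> sets (K x) = sets M"
  using kernel by (rule sets_kernel)

lemma kernel_subprob: "x \<in> space M \<Longrightarrow> subprob_space (K x)"
  using kernel by (rule subprob_space_kernel)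

lemma kernel_finite: "x \<in> space M \<Longrightarrow> finite_measure (K x)"
  using kernel_subprob by (simp add: subprob_space_def)

lemma kernel_mass_le_1: "x \<in> space M \<Longrightarrow> measure (K x) (space M) \<le> 1"
  using subprob_space.subprob_measure_le_1[OF kernel_subprob] .

lemma kernel_weight_finite: "x \<in> space M \<Longrightarrow> (\<integral>\<^sup>+y. ennreal (V y) \<partial>K x) < \<infinity>"
  using kernel_weight by (metis ennreal_less_top infinity_ennreal_def le_less_trans)

lemma kernel_oper_bound:
  assumes f: "f \<in> wspace M V" and x: "x \<in> space M" and a: "0 \<le> a" and b: "0 \<le> b"
    and bound: "\<And>x. x \<in> space M \<Longrightarrow> cmod (f x) \<le> a * V x + b"
    and v: "(\<integral>\<^sup>+y. ennreal (V y) \<partial>K x) \<le> ennreal v" "0 \<le> v"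
  shows "cmod (kernel_oper M K f x) \<le> a * v + b"
proof -
  have "ennreal (LINT y|K x. V y) = (\<integral>\<^sup>+y. ennreal (V y) \<partial>K x)"
    using wspace_integrable(1)[OF kernel_sets[OF x] kernel_weight_finite[OF x]] weight_pos
    by (intro nn_integral_eq_integral[symmetric])
       (auto simp: sets_eq_imp_space_eq[OF kernel_sets[OF x]] less_imp_le)
  then have "(LINT y|K x. V y) \<le> v" using v by (metis ennreal_le_iff)
  then have "a * (LINT y|K x. V y) + b * measure (K x) (space M) \<le> a * v + b * 1"
    using a b kernel_mass_le_1[OF x] by (intro add_mono mult_left_mono) auto
  moreover have "cmod (LINT y|K x. f y) \<le> a * (LINT y|K x. V y) + b * measure (K x) (space M)"
    using integral_weight_bound[OF kernel_sets[OF x] kernel_finite[OF x] kernel_weight_finite[OF x] f bound] .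
  ultimately show ?thesis using x by (simp add: kernel_oper_def)
qed

lemma kernel_oper_bounded: "bounded_between M V V (kernel_oper M K)"
proof -
  obtain C where C: "\<And>x. x \<in> space M \<Longrightarrow> (\<integral>\<^sup>+y. ennreal (V y) \<partial>K x) \<le> ennreal (C * V x)"
    using kernel_weight by blast
  have C': "(\<integral>\<^sup>+y. ennreal (V y) \<partial>K x) \<le> ennreal (\<bar>C\<bar> * V x)" if "x \<in> space M" for x
    using C[OF that] weight_pos[OF that]
    by (elim order_trans) (intro ennreal_leI mult_right_mono, auto)
  have bound: "cmod (kernel_oper M K f x) \<le> \<bar>C\<bar> * wnorm M V f * V x"
    if "f \<in> wspace M V" "x \<in> space M" for f x
    using kernel_oper_bound[OF that wnorm_nonneg[OF that(1)], of 0, OF _ _ C'[OF that(2)]]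
      wnorm_bound[OF that(1)] weight_pos[OF that(2)] by (simp add: mult_ac)
  have "kernel_oper M K f \<in> wspace M V" if f: "f \<in> wspace M V" for f
  proof (rule wspaceI[OF _ _ bound[OF f]])
    have "(\<lambda>x. LINT y|K x. f y) \<in> borel_measurable M"
      using integral_measurable_subprob_algebra[OF wspace_measurable[OF f]] kernel
      by (rule measurable_compose[rotated])
    then show "kernel_oper M K f \<in> borel_measurable M"
      by (rule measurable_cong[THEN iffD1, rotated]) (simp add: kernel_oper_def)
  qed (auto simp: kernel_oper_def)
  moreover have "kernel_oper M K (\<lambda>x. a * f x + b * g x)
      = (\<lambda>x. a * kernel_oper M K f x + b * kernel_oper M K g x)"
    if "f \<in> wspace M V" "g \<in> wspace M V" for f g a b
    using that kernel_sets kernel_weight_finite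
    by (auto simp: kernel_oper_def fun_eq_iff integral_lincomb)
  ultimately show ?thesis using bound unfolding bounded_between_def by blast
qed

sublocale one: weighted_kernel M one_weight K
proof unfold_locales
  show "\<exists>C. \<forall>x\<in>space M. (\<integral>\<^sup>+y. ennreal 1 \<partial>K x) \<le> ennreal (C * 1)"
    using kernel_subprob by (intro exI[of _ 1]) (auto simp: subprob_space.emeasure_space_le_1)
qed (rule kernel)

lemma kernel_power_bounded: "bounded_between M V V (kernel_oper M K ^^ n)"
  using bounded_between_power[OF kernel_oper_bounded] weight_space_axioms by blast

end

context weighted_kernel begin

text \<open>
Kernels of mass at most \<open>1\<close> do not increase the supremum norm. This is what makes the weak norm
stable under iteration.
\<close>

lemma kernel_contraction:
  assumes f: "f \<in> wspace M one_weight" and b: "0 \<le> b"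
    and bound: "\<And>x. x \<in> space M \<Longrightarrow> cmod (f x) \<le> b" and x: "x \<in> space M"
  shows "cmod ((kernel_oper M K ^^ n) f x) \<le> b"
  using x
proof (induction n arbitrary: x)
  case 0
  then show ?case using bound by simp
next
  case (Suc n)
  have "(kernel_oper M K ^^ n) f \<in> wspace M one_weight"
    using bounded_between_maps[OF one.kernel_power_bounded f] .
  moreover have "(\<integral>\<^sup>+y. ennreal 1 \<partial>K x) \<le> ennreal 1"
    using kernel_subprob[OF Suc.prems] by (simp add: subprob_space.emeasure_space_le_1)
  ultimately have "cmod (kernel_oper M K ((kernel_oper M K ^^ n) f) x) \<le> 0 * 1 + b"
    using Suc b by (intro one.kernel_oper_bound[where v = 1]) auto
  then show ?case by simp
qed

end

lemma drift_mono:
  assumes "weight_space M V" "drift M V K \<delta> L" "\<delta> \<le> \<alpha>"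
  shows "drift M V K \<alpha> L"
  unfolding drift_def
proof
  interpret weight_space M V by fact
  fix x assume x: "x \<in> space M"
  have "ennreal (\<delta> * V x + L) \<le> ennreal (\<alpha> * V x + L)"
    using assms(3) weight_pos[OF x] by (intro ennreal_leI add_right_mono mult_right_mono) auto
  then show "(\<integral>\<^sup>+y. ennreal (V y) \<partial>K x) \<le> ennreal (\<alpha> * V x + L)"
    using assms(2) x unfolding drift_def by (meson order_trans)
qed

locale drift_kernel = weighted_kernel +
  fixes \<alpha> L :: real
  assumes drift: "drift M V K \<alpha> L" and \<alpha>: "0 < \<alpha>" "\<alpha> < 1" and L: "0 < L"
begin

lemma drift_step:
  assumes f: "f \<in> wspace M V" and a: "0 \<le> a" and b: "0 \<le> b"
    and bound: "\<And>x. x \<in> space M \<Longrightarrow> cmod (f x) \<le> a * V x + b" and x: "x \<in> space M"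
  shows "cmod (kernel_oper M K f x) \<le> a * (\<alpha> * V x + L) + b"
proof (rule kernel_oper_bound[OF f x a b bound])
  show "(\<integral>\<^sup>+y. ennreal (V y) \<partial>K x) \<le> ennreal (\<alpha> * V x + L)"
    using drift x by (simp add: drift_def)
  show "0 \<le> \<alpha> * V x + L" using \<alpha> L weight_pos[OF x] by simp
qed

text \<open>
The additive constants of the iterated drift condition sum to a geometric series: after \<open>n\<close> steps
the strong part has shrunk by \<open>\<alpha>\<^sup>n\<close>, at the price of a weak part that never exceeds \<open>L / (1 - \<alpha>)\<close>.
This is the Lasota-Yorke inequality on which the perturbation argument rests.
\<close>

lemma drift_power:
  assumes f: "f \<in> wspace M V" and a: "0 \<le> a"
    and bound: "\<And>x. x \<in> space M \<Longrightarrow> cmod (f x) \<le> a * V x" and x: "x \<in> space M"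
  shows "cmod ((kernel_oper M K ^^ n) f x) \<le> a * \<alpha> ^ n * V x + a * (L / (1 - \<alpha>))"
proof -
  define B where "B = L / (1 - \<alpha>)"
  have BL: "\<alpha> * B + L = B" using \<alpha> by (simp add: B_def field_simps)
  have B: "0 \<le> B" using \<alpha> L by (simp add: B_def)
  \<comment> \<open>The factor \<open>1 - \<alpha>\<^sup>n\<close> is the partial sum of the geometric series and makes the induction exact.\<close>
  have "cmod ((kernel_oper M K ^^ n) f x) \<le> a * \<alpha> ^ n * V x + a * B * (1 - \<alpha> ^ n)"
    using x
  proof (induction n arbitrary: x)
    case 0
    then show ?case using bound by simp
  next
    case (Suc n)
    have "\<alpha> ^ n \<le> 1" using \<alpha> by (simp add: power_le_one)
    then have "cmod (kernel_oper M K ((kernel_oper M K ^^ n) f) x)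
        \<le> a * \<alpha> ^ n * (\<alpha> * V x + L) + a * B * (1 - \<alpha> ^ n)"
      using a B \<alpha> Suc f
      by (intro drift_step bounded_between_maps[OF kernel_power_bounded]) auto
    also have "\<dots> = a * \<alpha> ^ Suc n * V x + a * B + a * \<alpha> ^ n * (L - B)" by (simp add: algebra_simps)
    also have "L - B = - (\<alpha> * B)" using BL by simp
    finally show ?case by (simp add: algebra_simps)
  qed
  also have "\<dots> \<le> a * \<alpha> ^ n * V x + a * B * 1"
    using a B \<alpha> by (intro add_left_mono mult_left_mono) auto
  finally show ?thesis by (simp add: B_def)
qed

end

section \<open>The resolvent of a geometrically ergodic operator\<close>

text \<open>
An operator with the eigenvalue \<open>1\<close>, eigenvector \<open>h\<close> and invariant functional \<open>\<nu>\<close>. The map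
\<open>f \<mapsto> \<nu> f h\<close> is then a projection that commutes with \<open>T\<close>, and \<open>dev f n\<close> is the error of the \<open>n\<close>-th
iterate as an approximation of this projection.
\<close>

locale spectral_oper = weight_space +
  fixes T :: "'a oper" and \<nu> :: "('a \<Rightarrow> complex) \<Rightarrow> complex" and h :: "'a \<Rightarrow> complex"
    and D :: real
  assumes T_bounded: "bounded_between M V V T"
    and nu_lincomb: "f \<in> wspace M V \<Longrightarrow> g \<in> wspace M V \<Longrightarrow> \<nu> (\<lambda>x. a * f x + b * g x) = a * \<nu> f + b * \<nu> g"
    and nu_T: "f \<in> wspace M V \<Longrightarrow> \<nu> (T f) = \<nu> f"
    and h_wspace: "h \<in> wspace M V" and T_h: "T h = h" and nu_h: "\<nu> h = 1"
    and projection_bound: "f \<in> wspace M V \<Longrightarrow> x \<in> space M \<Longrightarrow>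
      cmod (\<nu> f * h x) \<le> D * wnorm M V f * V x"
    and D_nonneg: "0 \<le> D"
begin

definition dev :: "('a \<Rightarrow> complex) \<Rightarrow> nat \<Rightarrow> 'a \<Rightarrow> complex" where
  "dev f n = (\<lambda>x. (T ^^ n) f x - \<nu> f * h x)"

lemmas V_weight = weight_space_axioms
lemmas T_maps = bounded_between_maps[OF T_bounded]
lemmas T_lincomb = bounded_between_lincomb[OF T_bounded]
lemmas Tn_bounded = bounded_between_power[OF T_bounded V_weight]
lemmas Tn_maps = bounded_between_maps[OF Tn_bounded]
lemmas Tn_lincomb = bounded_between_lincomb[OF Tn_bounded]

lemma nu_zero: "\<nu> (\<lambda>x. 0) = 0"
  using nu_lincomb[OF wspace_zero wspace_zero, of 0 0] by simp

lemma h_nonzero: obtains y where "y \<in> space M" "h y \<noteq> 0"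
proof -
  have "h \<noteq> (\<lambda>x. 0)" using nu_zero nu_h by force
  then show thesis using that wspace_outside[OF h_wspace] by (metis ext)
qed

lemma nu_Tn: "f \<in> wspace M V \<Longrightarrow> \<nu> ((T ^^ n) f) = \<nu> f"
  by (induction n) (auto simp: nu_T Tn_maps)

lemma dev_wspace: "f \<in> wspace M V \<Longrightarrow> dev f n \<in> wspace M V"
  unfolding dev_def by (intro wspace_diff wspace_cmult Tn_maps h_wspace)

lemma nu_dev: "f \<in> wspace M V \<Longrightarrow> \<nu> (dev f n) = 0"
  using nu_lincomb[OF Tn_maps h_wspace, of f 1 n "- \<nu> f"] by (simp add: dev_def nu_Tn nu_h)

lemma T_dev: "f \<in> wspace M V \<Longrightarrow> T (dev f n) = dev f (Suc n)"
  using T_lincomb[OF Tn_maps h_wspace, of f 1 n "- \<nu> f"] by (simp add: dev_def T_h)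

lemma dev_lincomb:
  "f \<in> wspace M V \<Longrightarrow> g \<in> wspace M V \<Longrightarrow>
    dev (\<lambda>x. a * f x + b * g x) n = (\<lambda>x. a * dev f n x + b * dev g n x)"
  by (simp add: dev_def Tn_lincomb nu_lincomb algebra_simps)

text \<open>
Deviations obey a semigroup law because \<open>dev f m\<close> has no component along \<open>h\<close>. Hence a single
contracting iterate is enough for geometric decay.
\<close>

lemma dev_dev:
  assumes f: "f \<in> wspace M V"
  shows "dev (dev f m) n = dev f (m + n)"
proof -
  have "(T ^^ n) (dev f m) = dev f (m + n)"
    by (induction n) (auto simp: T_dev f)
  then show ?thesis by (simp add: dev_def[of "dev f m"] nu_dev f)
qed

end

locale ergodic_oper = spectral_oper +
  fixes C s :: real
  assumes convergence: "f \<in> wspace M V \<Longrightarrow> x \<in> space M \<Longrightarrow>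
      cmod (dev f n x) \<le> C * s ^ n * wnorm M V f * V x"
    and C_nonneg: "0 \<le> C" and s_pos: "0 < s"
begin

text \<open>
The Neumann series of \<open>inverse (z - T)\<close>, with the eigenvalue \<open>1\<close> summed separately. It therefore
converges wherever \<open>|z|\<close> exceeds the rate \<open>s\<close>, also inside the unit disc.
\<close>

definition res :: "complex \<Rightarrow> 'a oper" where
  "res z f = (\<lambda>x. (\<Sum>n. inverse z ^ Suc n * dev f n x) + \<nu> f * h x / (z - 1))"

lemma res_term_bound:
  assumes f: "f \<in> wspace M V" and x: "x \<in> space M"
  shows "cmod (inverse z ^ Suc n * dev f n x)
    \<le> (C * wnorm M V f * V x * inverse (cmod z)) * (s / cmod z) ^ n"
proof -
  have "cmod (inverse z ^ Suc n * dev f n x) = inverse (cmod z) ^ Suc n * cmod (dev f n x)"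
    by (simp add: norm_mult norm_power norm_inverse)
  also have "\<dots> \<le> inverse (cmod z) ^ Suc n * (C * s ^ n * wnorm M V f * V x)"
    using convergence[OF f x] by (intro mult_left_mono) auto
  finally show ?thesis by (simp add: field_simps)
qed

lemma ratio_less_1: "s < cmod z \<Longrightarrow> norm (s / cmod z) < 1"
  using s_pos by (auto simp: divide_less_eq)

lemma res_summable:
  assumes f: "f \<in> wspace M V" and x: "x \<in> space M" and z: "s < cmod z"
  shows "summable (\<lambda>n. inverse z ^ Suc n * dev f n x)"
proof (rule summable_comparison_test')
  show "summable (\<lambda>n. (C * wnorm M V f * V x * inverse (cmod z)) * (s / cmod z) ^ n)"
    by (intro summable_mult summable_geometric ratio_less_1 z)
qed (use res_term_bound[OF f x] in auto)

lemma res_tail_bound: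
  assumes f: "f \<in> wspace M V" and x: "x \<in> space M" and z: "s < cmod z"
  shows "cmod (\<Sum>n. inverse z ^ Suc (n + N) * dev f (n + N) x)
    \<le> C / (cmod z - s) * wnorm M V f * V x * (s / cmod z) ^ N"
proof -
  let ?q = "s / cmod z" and ?c = "C * wnorm M V f * V x * inverse (cmod z)"
  have z0: "0 < cmod z" using z s_pos by linarith
  have q: "\<bar>?q\<bar> < 1" using ratio_less_1[OF z] by simp
  have bound: "cmod (inverse z ^ Suc (n + N) * dev f (n + N) x) \<le> ?c * ?q ^ N * ?q ^ n" for n
    using res_term_bound[OF f x, of z "n + N"] by (simp add: power_add mult_ac)
  have "cmod (\<Sum>n. inverse z ^ Suc (n + N) * dev f (n + N) x) \<le> (\<Sum>n. ?c * ?q ^ N * ?q ^ n)"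
    by (intro norm_suminf_le bound summable_mult summable_geometric) (use q in simp)
  also have "\<dots> = ?c * ?q ^ N * (1 / (1 - ?q))"
    using q suminf_mult[OF summable_geometric[of ?q], of "?c * ?q ^ N"] by (simp only: real_norm_def suminf_geometric)
  also have "1 / (1 - ?q) = cmod z / (cmod z - s)" using z z0 by (simp add: field_simps)
  also have "?c * ?q ^ N * (cmod z / (cmod z - s)) = C / (cmod z - s) * wnorm M V f * V x * ?q ^ N"
    using z0 by simp
  finally show ?thesis .
qed

lemma res_bound:
  assumes f: "f \<in> wspace M V" and x: "x \<in> space M" and z: "s < cmod z"
  shows "cmod (res z f x) \<le> (C / (cmod z - s) + D / cmod (z - 1)) * wnorm M V f * V x"
proof -
  have "cmod (res z f x) \<le> cmod (\<Sum>n. inverse z ^ Suc n * dev f n x) + cmod (\<nu> f * h x) / cmod (z - 1)"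
    unfolding res_def by (rule order_trans[OF norm_triangle_ineq]) (simp add: norm_divide)
  also have "\<dots> \<le> C / (cmod z - s) * wnorm M V f * V x + (D * wnorm M V f * V x) / cmod (z - 1)"
    using res_tail_bound[OF f x z, of 0] projection_bound[OF f x]
    by (intro add_mono divide_right_mono) auto
  finally show ?thesis by (simp add: algebra_simps)
qed

lemma res_wspace:
  assumes f: "f \<in> wspace M V" and z: "s < cmod z"
  shows "res z f \<in> wspace M V"
proof (rule wspaceI[OF _ _ res_bound[OF f _ z]])
  note [measurable] = wspace_measurable[OF dev_wspace[OF f]] wspace_measurable[OF h_wspace]
  show "res z f \<in> borel_measurable M" unfolding res_def by measurable
  show "res z f x = 0" if "x \<notin> space M" for x
    using that by (simp add: res_def wspace_outside[OF dev_wspace[OF f]] wspace_outside[OF h_wspace])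
qed

lemma res_lincomb:
  assumes f: "f \<in> wspace M V" and g: "g \<in> wspace M V" and z: "s < cmod z"
  shows "res z (\<lambda>x. a * f x + b * g x) = (\<lambda>x. a * res z f x + b * res z g x)"
proof
  fix x
  show "res z (\<lambda>x. a * f x + b * g x) x = a * res z f x + b * res z g x"
  proof (cases "x \<in> space M")
    case True
    let ?F = "\<lambda>f n. inverse z ^ Suc n * dev f n x"
    have "(\<Sum>n. ?F (\<lambda>x. a * f x + b * g x) n) = (\<Sum>n. a * ?F f n + b * ?F g n)"
      by (simp add: dev_lincomb[OF f g] algebra_simps)
    also have "\<dots> = a * (\<Sum>n. ?F f n) + b * (\<Sum>n. ?F g n)"
      using res_summable[OF f True z] res_summable[OF g True z]
      by (simp add: suminf_add[symmetric] suminf_mult summable_mult del: power_Suc)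
    finally show ?thesis
      by (simp add: res_def nu_lincomb[OF f g] algebra_simps add_divide_distrib del: power_Suc)
  next
    case False
    then show ?thesis
      using wspace_outside[OF res_wspace[OF wspace_lincomb[OF f g] z]]
        wspace_outside[OF res_wspace[OF f z]] wspace_outside[OF res_wspace[OF g z]]
      by simp
  qed
qed

lemma res_left_inverse:
  assumes f: "f \<in> wspace M V" and z: "s < cmod z" "z \<noteq> 1"
  shows "res z (\<lambda>x. z * f x - T f x) = f"
proof
  fix x
  let ?g = "\<lambda>x. z * f x - T f x"
  have g: "?g \<in> wspace M V" using f by (intro wspace_diff wspace_cmult T_maps)
  have z0: "z \<noteq> 0" using z s_pos by auto
  have nu: "\<nu> ?g = (z - 1) * \<nu> f"
    using nu_lincomb[OF f T_maps[OF f], of z "-1"] nu_T[OF f] by (simp add: algebra_simps)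
  show "res z ?g x = f x"
  proof (cases "x \<in> space M")
    case True
    let ?a = "\<lambda>n. inverse z ^ n * dev f n x"
    have dev_g: "dev ?g n x = z * dev f n x - dev f (Suc n) x" for n
      using Tn_lincomb[OF f T_maps[OF f], of n z "-1"]
      by (simp add: dev_def nu funpow_swap1 algebra_simps)
    have "(\<lambda>n. ?a n) \<longlonglongrightarrow> 0"
      using summable_LIMSEQ_zero[OF summable_mult[OF res_summable[OF f True z(1)], of z]] z0
      by (simp add: mult.assoc[symmetric])
    then have "(\<lambda>n. ?a n - ?a (Suc n)) sums (?a 0 - 0)" by (rule telescope_sums')
    moreover have "?a n - ?a (Suc n) = inverse z ^ Suc n * dev ?g n x" for n
      using z0 by (simp add: dev_g algebra_simps)
    ultimately have "(\<Sum>n. inverse z ^ Suc n * dev ?g n x) = dev f 0 x"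
      by (simp add: sums_iff del: power_Suc)
    then show ?thesis using z(2) unfolding res_def nu by (simp add: dev_def)
  next
    case False
    then show ?thesis using wspace_outside[OF res_wspace[OF g z(1)]] wspace_outside[OF f] by simp
  qed
qed

text \<open>
\<open>T\<close> is exchanged with the series by continuity: the partial sums converge in norm, at the
geometric speed given by the bound on the tail.
\<close>

lemma res_right_inverse:
  assumes f: "f \<in> wspace M V" and z: "s < cmod z" "z \<noteq> 1"
  shows "(\<lambda>x. z * res z f x - T (res z f) x) = f"
proof
  fix x
  let ?R = "res z f"
  have R: "?R \<in> wspace M V" using res_wspace[OF f z(1)] .
  have z0: "z \<noteq> 0" using z s_pos by auto
  show "z * ?R x - T ?R x = f x"
  proof (cases "x \<in> space M")
    case True
    define u where "u N = (\<lambda>x. (\<Sum>n<N. inverse z ^ Suc n * dev f n x) + \<nu> f / (z - 1) * h x)" for N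
    have u: "u N \<in> wspace M V" for N
      unfolding u_def by (intro wspace_add wspace_sum wspace_cmult dev_wspace f h_wspace)
    have Tu: "z * u N x - T (u N) x = f x - inverse z ^ N * dev f N x" for N
    proof -
      have S: "(\<lambda>x. \<Sum>n<N. inverse z ^ Suc n * dev f n x) \<in> wspace M V"
        by (intro wspace_sum wspace_cmult dev_wspace f)
      have "T (u N) x = (\<Sum>n<N. inverse z ^ Suc n * dev f (Suc n) x) + \<nu> f / (z - 1) * h x"
        unfolding u_def
        using T_lincomb[OF S h_wspace, of 1 "\<nu> f / (z - 1)"]
          bounded_between_sum[OF T_bounded V_weight, of "{..<N}" "dev f" "\<lambda>n. inverse z ^ Suc n"]
        by (simp add: dev_wspace[OF f] T_dev[OF f] T_h del: power_Suc)
      then have "z * u N x - T (u N) x = (z - 1) * (\<nu> f / (z - 1) * h x)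
          + (\<Sum>n<N. z * (inverse z ^ Suc n * dev f n x) - inverse z ^ Suc n * dev f (Suc n) x)"
        by (simp add: u_def sum_distrib_left sum_subtractf ring_distribs left_diff_distrib
            del: power_Suc times_divide_eq_left)
      also have "(\<Sum>n<N. z * (inverse z ^ Suc n * dev f n x) - inverse z ^ Suc n * dev f (Suc n) x)
          = (\<Sum>n<N. inverse z ^ n * dev f n x - inverse z ^ Suc n * dev f (Suc n) x)"
        using z0 by (intro sum.cong) simp_all
      also have "\<dots> = dev f 0 x - inverse z ^ N * dev f N x"
        by (subst sum_lessThan_telescope') simp
      finally show ?thesis using z by (simp add: dev_def)
    qed
    obtain K where K: "0 \<le> K"
      "\<And>f x. f \<in> wspace M V \<Longrightarrow> x \<in> space M \<Longrightarrow> cmod (T f x) \<le> K * wnorm M V f * V x"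
      using bounded_between_bound[OF T_bounded V_weight V_weight] by metis
    define E where "E N = C / (cmod z - s) * wnorm M V f * (s / cmod z) ^ N" for N
    have E: "E \<longlonglongrightarrow> 0"
      unfolding E_def by (intro tendsto_mult_right_zero LIMSEQ_power_zero ratio_less_1 z)
    have diff: "cmod (?R y - u N y) \<le> E N * V y" if y: "y \<in> space M" for N y
    proof -
      have "?R y - u N y = (\<Sum>n. inverse z ^ Suc (n + N) * dev f (n + N) y)"
        using suminf_split_initial_segment[OF res_summable[OF f y z(1)], of N]
        by (simp add: res_def u_def del: power_Suc)
      then show ?thesis using res_tail_bound[OF f y z(1), of N] by (simp add: E_def mult_ac)
    qed
    have Tdiff: "cmod (T ?R x - T (u N) x) \<le> K * E N * V x" for N
    proof -
      let ?d = "\<lambda>y. ?R y - u N y"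
      have "cmod (T ?d x) \<le> K * wnorm M V ?d * V x"
        by (rule K(2)[OF wspace_diff[OF R u] True])
      also have "\<dots> \<le> K * E N * V x"
        using K(1) weight_pos[OF True] wnorm_leI[of ?d, OF diff] by (intro mult_right_mono mult_left_mono) auto
      finally show ?thesis using T_lincomb[OF R u, of 1 "-1"] by simp
    qed
    have "(\<lambda>N. inverse z ^ N * dev f N x) \<longlonglongrightarrow> 0"
      using summable_LIMSEQ_zero[OF summable_mult[OF res_summable[OF f True z(1)], of z]] z0
      by (simp add: mult.assoc[symmetric])
    then have "(\<lambda>N. cmod z * (E N * V x) + K * E N * V x + cmod (inverse z ^ N * dev f N x))
        \<longlonglongrightarrow> cmod z * (0 * V x) + K * 0 * V x + cmod 0"
      by (intro tendsto_intros E)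
    then have lim: "(\<lambda>N. cmod z * (E N * V x) + K * E N * V x + cmod (inverse z ^ N * dev f N x))
        \<longlonglongrightarrow> 0" by simp
    have "cmod (z * ?R x - T ?R x - f x) \<le> cmod z * (E N * V x) + K * E N * V x + cmod (inverse z ^ N * dev f N x)" for N
    proof -
      have eq: "z * ?R x - T ?R x - f x
          = z * (?R x - u N x) + (T (u N) x - T ?R x) + (- (inverse z ^ N * dev f N x))"
        using Tu[of N] by (simp add: algebra_simps)
      have "cmod (z * (?R x - u N x)) \<le> cmod z * (E N * V x)"
        using diff[OF True] by (auto simp: norm_mult intro: mult_left_mono)
      then show ?thesis
        unfolding eq using Tdiff[of N]
        by (intro norm_triangle_le add_mono) (auto simp: norm_minus_commute)
    qed
    then have "cmod (z * ?R x - T ?R x - f x) \<le> 0"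
      by (intro tendsto_lowerbound[OF lim]) auto
    then show ?thesis by simp
  next
    case False
    then show ?thesis
      using wspace_outside[OF R] wspace_outside[OF T_maps[OF R]] wspace_outside[OF f] by simp
  qed
qed

lemma resolvent_eq_res:
  assumes f: "f \<in> wspace M V" and z: "s < cmod z" "z \<noteq> 1"
  shows "resolvent M V T z f = res z f"
proof -
  have "inj_on (\<lambda>f x. z * f x - T f x) (wspace M V)"
    by (rule inj_on_inverseI[of _ "res z"]) (rule res_left_inverse[OF _ z])
  then have "inv_into (wspace M V) (\<lambda>f x. z * f x - T f x) (\<lambda>x. z * res z f x - T (res z f) x) = res z f"
    by (rule inv_into_f_f[OF _ res_wspace[OF f z(1)]])
  then show ?thesis by (simp add: resolvent_def res_right_inverse[OF f z])
qed

lemma not_in_spectrum: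
  assumes z: "s < cmod z" "z \<noteq> 1"
  shows "z \<notin> spectrum M V T"
proof -
  have "bij_betw (\<lambda>f x. z * f x - T f x) (wspace M V) (wspace M V)"
    by (rule bij_betw_byWitness[where f' = "res z"])
       (auto simp: res_left_inverse[OF _ z] res_right_inverse[OF _ z] res_wspace[OF _ z(1)]
         intro!: wspace_diff wspace_cmult T_maps)
  moreover have "bounded_oper M V (resolvent M V T z)"
    unfolding bounded_oper_def linear_oper_def
  proof (intro conjI ballI allI exI)
    fix f g a b assume fg: "f \<in> wspace M V" "g \<in> wspace M V"
    show "resolvent M V T z (\<lambda>x. a * f x + b * g x)
        = (\<lambda>x. a * resolvent M V T z f x + b * resolvent M V T z g x)"
      using fg by (simp add: resolvent_eq_res z wspace_lincomb res_lincomb)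
  next
    fix f assume f: "f \<in> wspace M V"
    show "wnorm M V (resolvent M V T z f) \<le> (C / (cmod z - s) + D / cmod (z - 1)) * wnorm M V f"
      using res_bound[OF f _ z(1)] by (simp add: resolvent_eq_res[OF f z] wnorm_leI)
  qed (auto simp: resolvent_eq_res z res_wspace)
  ultimately show ?thesis by (simp add: spectrum_def)
qed

lemma res_bounded: 
  assumes z: "s < cmod z"
  shows "bounded_between M V V (res z)"
  using res_wspace[OF _ z] res_lincomb[OF _ _ z] res_bound[OF _ _ z] unfolding bounded_between_def
  by blast

lemma opnorm_resolvent:
  assumes z: "s < cmod z" "z \<noteq> 1"
  shows "opnorm M V V (resolvent M V T z) = opnorm M V V (res z)"
  unfolding opnorm_def by (intro SUP_cong) (auto simp: resolvent_eq_res[OF _ z] wballD)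

lemma opnorm_res_le:
  assumes z: "s < cmod z"
  shows "opnorm M V V (res z) \<le> C / (cmod z - s) + D / cmod (z - 1)"
proof (rule opnorm_leI[OF V_weight V_weight])
  fix f x assume f: "f \<in> wball M V" and x: "x \<in> space M"
  have "cmod (res z f x) \<le> (C / (cmod z - s) + D / cmod (z - 1)) * wnorm M V f * V x"
    using res_bound[OF wballD(1)[OF f] x z] .
  also have "\<dots> \<le> (C / (cmod z - s) + D / cmod (z - 1)) * 1 * V x"
    using wballD(2)[OF f] weight_pos[OF x] C_nonneg D_nonneg z by (intro mult_right_mono mult_left_mono) auto
  finally show "cmod (res z f x) \<le> (C / (cmod z - s) + D / cmod (z - 1)) * V x" by simp
qed

text \<open>
Below, the spectrum lies in the disc of radius \<open>s\<close> together with the point \<open>1\<close>. As \<open>r\<close> exceeds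
\<open>s\<close> by more than \<open>\<theta>\<close>, the disc of radius \<open>r\<close> already absorbs the \<open>\<theta>\<close>-neighbourhood of everything
but \<open>1\<close>.
\<close>

context
  fixes r \<theta> :: real
  assumes \<theta>: "0 < \<theta>" and r: "s + \<theta> < r" "r < 1 - \<theta>"
begin

lemma one_in_spectrum: "1 \<in> spectrum M V T"
proof -
  have "(\<lambda>x. 1 * h x - T h x) = (\<lambda>x. 1 * 0 - T (\<lambda>x. 0) x)"
    using bounded_between_cmult[OF T_bounded V_weight wspace_zero, of 0] by (simp add: T_h)
  moreover have "h \<noteq> (\<lambda>x. 0)" using nu_zero nu_h by force
  ultimately have "\<not> inj_on (\<lambda>f x. 1 * f x - T f x) (wspace M V)"
    using h_wspace wspace_zero inj_onD[of "\<lambda>f x. 1 * f x - T f x" "wspace M V" h "\<lambda>x. 0"] by metis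
  then show ?thesis by (simp add: spectrum_def bij_betw_def)
qed

lemma spectral_nbhd_compl: "- spectral_nbhd M V r \<theta> T = {z. r < cmod z \<and> \<theta> < cmod (z - 1)}"
proof (intro set_eqI iffI)
  fix z assume "z \<in> - spectral_nbhd M V r \<theta> T"
  then have "r < cmod z" "\<theta> < infdist z (spectrum M V T)" by (auto simp: spectral_nbhd_def)
  moreover have "infdist z (spectrum M V T) \<le> dist z 1" by (rule infdist_le[OF one_in_spectrum])
  ultimately show "z \<in> {z. r < cmod z \<and> \<theta> < cmod (z - 1)}" by (simp add: dist_norm)
next
  fix z assume z: "z \<in> {z. r < cmod z \<and> \<theta> < cmod (z - 1)}"
  have "min (cmod z - s) (cmod (z - 1)) \<le> dist z w" if w: "w \<in> spectrum M V T" for w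
  proof (cases "w = 1")
    case False
    then have "cmod w \<le> s" using not_in_spectrum w by force
    moreover have "cmod z - cmod w \<le> cmod (z - w)" by (rule norm_triangle_ineq2)
    ultimately show ?thesis by (simp add: dist_norm)
  qed (simp add: dist_norm)
  then have "min (cmod z - s) (cmod (z - 1)) \<le> infdist z (spectrum M V T)"
    using one_in_spectrum by (subst infdist_notempty) (auto intro!: cINF_greatest)
  moreover have "\<theta> < min (cmod z - s) (cmod (z - 1))" using z r by auto
  ultimately have "\<theta> < infdist z (spectrum M V T)" by linarith
  then show "z \<in> - spectral_nbhd M V r \<theta> T" using z by (simp add: spectral_nbhd_def)
qed

text \<open>
The explicit bound on the resolvent makes the supremum a genuine one. Its lower bound, read off
from the eigenvector \<open>h\<close> at \<open>z = 1 + 2 \<theta>\<close>, is what later makes the second iteration count positive.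
\<close>

lemma resolvent_sup:
  defines "H \<equiv> SUP z \<in> - spectral_nbhd M V r \<theta> T. opnorm M V V (resolvent M V T z)"
  shows "r < cmod z \<Longrightarrow> \<theta> < cmod (z - 1) \<Longrightarrow> f \<in> wspace M V \<Longrightarrow> x \<in> space M \<Longrightarrow>
      cmod (res z f x) \<le> H * wnorm M V f * V x"
    and "1 / (2 * \<theta>) \<le> H"
proof -
  have region: "s < cmod z \<and> z \<noteq> 1" if "z \<in> - spectral_nbhd M V r \<theta> T" for z
    using that \<theta> r unfolding spectral_nbhd_compl by auto
  have "opnorm M V V (resolvent M V T z) \<le> C / (r - s) + D / \<theta>" if z: "z \<in> - spectral_nbhd M V r \<theta> T" for z
  proof -
    have "opnorm M V V (resolvent M V T z) \<le> C / (cmod z - s) + D / cmod (z - 1)"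
      using opnorm_resolvent[of z] opnorm_res_le[of z] region[OF z] by simp
    also have "\<dots> \<le> C / (r - s) + D / \<theta>"
    proof (intro add_mono divide_left_mono)
      have "r < cmod z" "\<theta> < cmod (z - 1)" using z unfolding spectral_nbhd_compl by auto
      then show "r - s \<le> cmod z - s" "\<theta> \<le> cmod (z - 1)" "0 < (cmod z - s) * (r - s)" "0 < cmod (z - 1) * \<theta>"
        using r \<theta> by (auto intro!: mult_pos_pos)
    qed (rule C_nonneg, rule D_nonneg)
    finally show ?thesis .
  qed
  then have bdd: "bdd_above ((\<lambda>z. opnorm M V V (resolvent M V T z)) ` (- spectral_nbhd M V r \<theta> T))"
    by (rule bdd_aboveI2)
  have H: "opnorm M V V (res z) \<le> H" if z: "r < cmod z" "\<theta> < cmod (z - 1)" for z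
  proof -
    have z': "z \<in> - spectral_nbhd M V r \<theta> T" using z unfolding spectral_nbhd_compl by simp
    show ?thesis unfolding H_def using cSUP_upper[OF z' bdd] opnorm_resolvent region[OF z'] by simp
  qed
  show res: "cmod (res z f x) \<le> H * wnorm M V f * V x"
    if z: "r < cmod z" "\<theta> < cmod (z - 1)" and f: "f \<in> wspace M V" and x: "x \<in> space M" for z f x
  proof -
    have "s < cmod z" using z r \<theta> by linarith
    then have "cmod (res z f x) \<le> opnorm M V V (res z) * wnorm M V f * V x"
      using opnorm_bound[OF res_bounded V_weight V_weight f x] by blast
    also have "\<dots> \<le> H * wnorm M V f * V x"
      using H[OF z] wnorm_nonneg[OF f] weight_pos[OF x] by (intro mult_right_mono) auto
    finally show ?thesis .
  qed
  show "1 / (2 * \<theta>) \<le> H"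
  proof -
    define z where "z = complex_of_real (1 + 2 * \<theta>)"
    have z1: "z - 1 = complex_of_real (2 * \<theta>)" by (simp add: z_def)
    have "(T ^^ n) h = h" for n by (induction n) (auto simp: T_h)
    then have "res z h = (\<lambda>x. h x / (z - 1))" by (simp add: res_def dev_def nu_h)
    then have hx: "cmod (h x) / (2 * \<theta>) \<le> H * wnorm M V h * V x" if "x \<in> space M" for x
    proof -
      have "cmod z = 1 + 2 * \<theta>" unfolding z_def norm_of_real using \<theta> by simp
      moreover have "cmod (z - 1) = 2 * \<theta>" unfolding z1 norm_of_real using \<theta> by simp
      ultimately show ?thesis
        using res[OF _ _ h_wspace that, of z] \<theta> r \<open>res z h = _\<close> by (simp add: norm_divide)
    qed
    then have "wnorm M V h \<le> (2 * \<theta>) * H * wnorm M V h"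
      using \<theta> by (intro wnorm_leI) (simp add: field_simps)
    moreover have "0 < wnorm M V h"
    proof -
      obtain y where y: "y \<in> space M" "h y \<noteq> 0" by (rule h_nonzero)
      have "0 < wnorm M V h * V y" using wnorm_bound[OF h_wspace y(1)] y(2) by (smt (verit) zero_less_norm_iff)
      then show ?thesis using weight_pos[OF y(1)] by (simp add: zero_less_mult_iff)
    qed
    ultimately show ?thesis using \<theta> by (simp add: field_simps)
  qed
qed

end

end

section \<open>The resolvent of a perturbation that is small in the weak norm\<close>

lemma sum_inverse_powers_le:
  fixes r :: real
  assumes r: "0 < r" "r < 1"
  shows "(\<Sum>j<n. inverse r ^ Suc j) \<le> inverse r ^ n / (1 - r)"
proof (induction n)
  case (Suc n)
  have "inverse r ^ n / (1 - r) + inverse r ^ Suc n = inverse r ^ Suc n * (r / (1 - r) + 1)"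
    using r by (simp add: distrib_left)
  also have "r / (1 - r) + 1 = 1 / (1 - r)" using r by (simp add: field_simps)
  finally show ?case using Suc by simp
qed (use r in simp)

lemma norm_weighted_sum_le:
  fixes z :: complex and y :: "nat \<Rightarrow> complex"
  assumes r: "0 < r" "r < 1" "r \<le> cmod z" and y: "\<And>j. j < n \<Longrightarrow> cmod (y j) \<le> Y" and Y: "0 \<le> Y"
  shows "cmod (\<Sum>j<n. inverse z ^ Suc j * y j) \<le> Y * (inverse r ^ n / (1 - r))"
proof -
  have "inverse (cmod z) \<le> inverse r" using r by (intro le_imp_inverse_le) auto
  then have "cmod (inverse z ^ Suc j * y j) \<le> inverse r ^ Suc j * Y" if "j < n" for j
    using y[OF that] r unfolding norm_mult norm_power norm_inverse
    by (intro mult_mono power_mono) auto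
  then have "cmod (\<Sum>j<n. inverse z ^ Suc j * y j) \<le> (\<Sum>j<n. inverse r ^ Suc j * Y)"
    by (intro sum_norm_le) auto
  also have "\<dots> \<le> inverse r ^ n / (1 - r) * Y"
    unfolding sum_distrib_right[symmetric] by (intro mult_right_mono sum_inverse_powers_le r Y)
  finally show ?thesis by (simp add: mult.commute)
qed

definition functional_norm :: "'a measure \<Rightarrow> ('a \<Rightarrow> real) \<Rightarrow> (('a \<Rightarrow> complex) \<Rightarrow> complex) \<Rightarrow> real" where
  "functional_norm M V F = (SUP f\<in>wball M V. cmod (F f))"

definition linear_functional :: "'a measure \<Rightarrow> ('a \<Rightarrow> real) \<Rightarrow> (('a \<Rightarrow> complex) \<Rightarrow> complex) \<Rightarrow> bool" where
  "linear_functional M V F \<longleftrightarrow>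
     (\<forall>f\<in>wspace M V. \<forall>g\<in>wspace M V. \<forall>a b. F (\<lambda>x. a * f x + b * g x) = a * F f + b * F g)"

context weight_space begin

lemma linear_functional_lincomb:
  "linear_functional M V F \<Longrightarrow> f \<in> wspace M V \<Longrightarrow> g \<in> wspace M V \<Longrightarrow>
    F (\<lambda>x. a * f x + b * g x) = a * F f + b * F g"
  by (simp add: linear_functional_def)

lemma linear_functional_zero: "linear_functional M V F \<Longrightarrow> F (\<lambda>x. 0) = 0"
  using linear_functional_lincomb[of F _ _ 0 0, OF _ wspace_zero wspace_zero] by simp

lemma functional_norm_bound:
  assumes F: "linear_functional M V F" and bdd: "\<And>f. f \<in> wball M V \<Longrightarrow> cmod (F f) \<le> C"
    and f: "f \<in> wspace M V" and bound: "\<And>x. x \<in> space M \<Longrightarrow> cmod (f x) \<le> a * V x" and a: "0 \<le> a"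
  shows "cmod (F f) \<le> a * functional_norm M V F"
proof (cases "a = 0")
  case True
  then have "f = (\<lambda>x. 0)"
    using bound wspace_outside[OF f] by (intro ext) (metis mult_zero_left norm_le_zero_iff)
  then show ?thesis using linear_functional_zero[OF F] True by simp
next
  case False
  let ?g = "\<lambda>x. complex_of_real (inverse a) * f x"
  have g: "?g \<in> wball M V" using wball_scaled[OF f, of a] wnorm_leI[OF bound] a False by simp
  have "cmod (F ?g) \<le> functional_norm M V F"
    unfolding functional_norm_def by (intro cSUP_upper g bdd_aboveI2[OF bdd])
  moreover have "F ?g = complex_of_real (inverse a) * F f"
    using linear_functional_lincomb[OF F f f, of "complex_of_real (inverse a)" 0] by simp
  ultimately have "inverse a * cmod (F f) \<le> functional_norm M V F"
    using a by (simp add: norm_mult norm_inverse)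
  then show ?thesis using a False by (simp add: field_simps)
qed

lemma functional_norm_nonneg:
  assumes "linear_functional M V F" "\<And>f. f \<in> wball M V \<Longrightarrow> cmod (F f) \<le> C"
  shows "0 \<le> functional_norm M V F"
  using functional_norm_bound[OF assms wspace_zero, of 1] weight_pos
  by (simp add: linear_functional_zero[OF assms(1)] less_imp_le)

lemma functional_norm_leI:
  "(\<And>f. f \<in> wball M V \<Longrightarrow> cmod (F f) \<le> C) \<Longrightarrow> functional_norm M V F \<le> C"
  unfolding functional_norm_def using wball_zero by (intro cSUP_least) auto

text \<open>
This is the identity \<open>(z - T) (\<Sum>j<n. T ^ j / z ^ Suc j) = 1 - T ^ n / z ^ n\<close> seen through a linear functional. The
drift condition makes the strong part of the remainder small once \<open>|z|\<close> exceeds \<open>\<alpha>\<close>.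
\<close>

lemma functional_power_expansion:
  assumes F: "linear_functional M V F" and T: "bounded_between M V V T" and f: "f \<in> wspace M V" and z: "z \<noteq> 0"
  shows "F f = (\<Sum>j<n. inverse z ^ Suc j * F (\<lambda>x. z * (T ^^ j) f x - (T ^^ Suc j) f x))
           + inverse z ^ n * F ((T ^^ n) f)"
proof (induction n)
  case (Suc n)
  have maps: "(T ^^ j) f \<in> wspace M V" for j
    using bounded_between_maps[OF bounded_between_power[OF T weight_space_axioms] f] .
  have "inverse z ^ Suc n * F (\<lambda>x. z * (T ^^ n) f x - (T ^^ Suc n) f x)
      = inverse z ^ Suc n * (z * F ((T ^^ n) f) - F ((T ^^ Suc n) f))"
    using linear_functional_lincomb[OF F maps[of n] maps[of "Suc n"], of z "-1"] by simp
  also have "\<dots> = inverse z ^ n * F ((T ^^ n) f) - inverse z ^ Suc n * F ((T ^^ Suc n) f)"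
    using z by (simp add: algebra_simps)
  finally show ?case using Suc.IH by (simp del: power_Suc funpow.simps)
qed simp

end

text \<open>
The arithmetic of the perturbation argument, with \<open>q = r ^ n1\<close>, \<open>p = r ^ n2\<close> and \<open>a = (\<alpha> / r) ^ n2\<close>.
The strong norm \<open>N\<close> and the weak norm \<open>w\<close> of a functional bound each other, and the constants are
small enough for the system to close: the second inequality gives
\<open>15/16 w \<le> H + 3/16 q N / B\<close>, so that the weak term contributes \<open>N / 5\<close> and a multiple of \<open>H\<close> to the first one.
Replacing \<open>H\<close> by \<open>H * B\<close> at the end uses \<open>1 \<le> B\<close>.
\<close>

lemma strong_norm_estimate:
  fixes N w B H L \<alpha> \<epsilon> q p a r :: real
  assumes N: "0 \<le> N" and w: "0 \<le> w" and B: "1 \<le> B" and H: "0 < H" and L: "0 < L" "L \<le> B"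
    and \<alpha>: "0 < \<alpha>" "\<alpha> < 1" and r: "0 < r" "r < 1" and q: "0 < q" "q \<le> 1" and p: "0 < p" "p \<le> 1"
    and a: "0 \<le> a" "8 * B * (B + 3) * H * a \<le> q"
    and \<epsilon>: "\<epsilon> \<le> q * p / (8 * B * (H * B + inverse (1 - r)))"
    and strong: "N \<le> N / 2 + B * w / q + (1 + B) / (q * (1 - r))"
    and weak: "w \<le> H + \<epsilon> * N / (p * (1 - r)) + \<epsilon> * H * B * N / p + H * a * (2 * \<alpha> * N + 2 * L * w)"
  shows "N \<le> 4 * (B + 1) / (q * (1 - r)) + 4 * B * (H * B + inverse (1 - r)) / (q * p)"
proof -
  define Y where "Y = H * B + inverse (1 - r)"
  have Y: "0 < Y" using H B r by (auto simp: Y_def intro!: add_pos_pos mult_pos_pos)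
  have "\<epsilon> * Y / p \<le> q / (8 * B)"
    using \<epsilon> Y p B unfolding Y_def[symmetric] by (simp add: field_simps)
  then have "\<epsilon> * Y / p * N \<le> q / (8 * B) * N" using N by (rule mult_right_mono)
  moreover have "\<epsilon> * N / (p * (1 - r)) + \<epsilon> * H * B * N / p = \<epsilon> * Y / p * N"
    using p r by (simp add: Y_def field_simps)
  ultimately have \<epsilon>N: "\<epsilon> * N / (p * (1 - r)) + \<epsilon> * H * B * N / p \<le> q * N / (8 * B)" by simp
  have Ha: "H * a * (8 * B * (B + 3)) \<le> q" using a by (simp add: mult_ac)
  have Ha0: "0 \<le> H * a" using H a by simp
  have "H * a * (32 * B) \<le> H * a * (8 * B * (B + 3))"
    using B Ha0 by (intro mult_left_mono) (auto simp: algebra_simps)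
  then have HaB: "H * a * (32 * B) \<le> q" using Ha by linarith
  have "2 * \<alpha> * (H * a) \<le> 2 * (H * a)" using \<alpha> Ha0 by (simp add: mult_right_mono)
  also have "\<dots> \<le> q / (16 * B)" using HaB B by (simp add: field_simps)
  finally have "2 * \<alpha> * (H * a) * N \<le> q / (16 * B) * N" using N by (rule mult_right_mono)
  moreover have "2 * L * (H * a) * w \<le> w / 16"
  proof -
    have "L * (H * a) \<le> B * (H * a)" using L Ha0 by (intro mult_right_mono) auto
    also have "\<dots> \<le> q / 32" using HaB by (simp add: mult_ac)
    finally have "2 * L * (H * a) \<le> 1 / 16" using q by linarith
    then show ?thesis using w by (metis mult_right_mono divide_inverse mult_1 mult.commute inverse_eq_divide)
  qed
  ultimately have Ha_bound: "H * a * (2 * \<alpha> * N + 2 * L * w) \<le> q / (16 * B) * N + w / 16"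
    by (simp add: algebra_simps)
  define X where "X = q * N / B"
  have "w \<le> H + q * N / (8 * B) + (q / (16 * B) * N + w / 16)"
    by (rule order_trans[OF weak]) (use \<epsilon>N Ha_bound in \<open>simp only: add.assoc add_left_mono add_mono\<close>)
  also have "\<dots> = H + X / 8 + (X / 16 + w / 16)" by (simp add: X_def)
  finally have w': "15 / 16 * w \<le> H + 3 / 16 * X" by simp
  have "B / q * (15 / 16 * w) \<le> B / q * (H + 3 / 16 * X)"
    using w' B q by (intro mult_left_mono) auto
  also have "\<dots> = B * H / q + 3 / 16 * N" using B q by (simp add: X_def field_simps)
  finally have "B * w / q \<le> 16 / 15 * (B * H / q) + N / 5" by simp
  moreover have S: "0 \<le> (1 + B) / (q * (1 - r))" using B q r by simp
  moreover have BH: "0 \<le> B * H / q" using B H q by simp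
  ultimately have "N \<le> 4 * (B * H / q) + 4 * ((1 + B) / (q * (1 - r)))"
    using strong by linarith
  moreover have "B * H / q \<le> B * Y / (q * p)"
  proof -
    have "H \<le> H * B" using B H by simp
    then have "H \<le> Y" unfolding Y_def using r by (smt (verit) inverse_nonnegative_iff_nonnegative)
    then have "B * H / q \<le> B * Y / q" using B q by (intro divide_right_mono mult_left_mono) auto
    also have "\<dots> \<le> B * Y / (q * p)"
      using B Y q p by (intro divide_left_mono) (auto intro: mult_left_le)
    finally show ?thesis .
  qed
  ultimately show ?thesis unfolding Y_def[symmetric] by (simp add: add.commute)
qed

text \<open>
Both kernels satisfy the same drift condition, but they are close only as operators from bounded
functions to \<open>wspace M V\<close>; their difference need not be small on \<open>wspace M V\<close>.
\<close>

locale perturbed_kernel =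
  P: drift_kernel M V P \<alpha> L + Q: drift_kernel M V Q \<alpha> L for M V P Q \<alpha> L +
  fixes \<epsilon> :: real
  assumes close: "f \<in> wspace M one_weight \<Longrightarrow> x \<in> space M \<Longrightarrow>
      cmod (kernel_oper M P f x - kernel_oper M Q f x) \<le> \<epsilon> * wnorm M one_weight f * V x"
    and \<epsilon>_nonneg: "0 \<le> \<epsilon>"
begin

abbreviation "TP \<equiv> kernel_oper M P"
abbreviation "TQ \<equiv> kernel_oper M Q"
abbreviation "B \<equiv> L / (1 - \<alpha>)"

lemma B_pos: "0 < B" using P.\<alpha> P.L by simp

text \<open>
The perturbation argument of Keller and Liverani. Composed with \<open>z - TP\<close>, the functional \<open>F\<close> has
norm at most \<open>1\<close>; it will be a coordinate of the resolvent of \<open>P\<close>. Its strong norm is controlled by its weak norm through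
\<open>n1\<close> steps of \<open>P\<close>, where the factor \<open>(\<alpha> / r) ^ n1 \<le> 1/2\<close> absorbs the strong remainder. Its weak norm is
controlled through the resolvent \<open>R\<close> of \<open>Q\<close> and the identity
\<open>F f = F ((z - TP) (R f)) + F ((TP - TQ) (R f))\<close>. In the last term \<open>R f\<close> is expanded along \<open>n2\<close> steps of
\<open>Q\<close>: the bounded terms meet the small weak norm of \<open>TP - TQ\<close>, and the strong remainder is damped by
\<open>(\<alpha> / r) ^ n2\<close>.
\<close>

lemma functional_estimate:
  fixes F :: "('a \<Rightarrow> complex) \<Rightarrow> complex" and R :: "'a oper"
  assumes F: "linear_functional M V F"
    and F_bdd: "\<And>f. f \<in> wball M V \<Longrightarrow> cmod (F f) \<le> C"
    and F_inverse: "\<And>f. f \<in> wspace M V \<Longrightarrow> cmod (F (\<lambda>x. z * f x - TP f x)) \<le> wnorm M V f"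
    and R_maps: "\<And>f. f \<in> wspace M V \<Longrightarrow> R f \<in> wspace M V"
    and R_inverse: "\<And>f. f \<in> wspace M V \<Longrightarrow> (\<lambda>x. z * R f x - TQ (R f) x) = f"
    and R_bound: "\<And>f x. f \<in> wspace M V \<Longrightarrow> x \<in> space M \<Longrightarrow> cmod (R f x) \<le> H * wnorm M V f * V x"
    and H: "0 < H" and z: "r \<le> cmod z" and r: "0 < r" "r < 1" and B1: "1 \<le> B"
    and n1: "(\<alpha> / r) ^ n1 \<le> 1 / 2" and n2: "8 * B * (B + 3) * H * (\<alpha> / r) ^ n2 \<le> r ^ n1"
    and \<epsilon>: "\<epsilon> \<le> r ^ (n1 + n2) / (8 * B * (H * B + inverse (1 - r)))"
    and f: "f \<in> wspace M V"
  shows "cmod (F f) \<le> (4 * (B + 1) / (r ^ n1 * (1 - r))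
           + 4 * B * (H * B + inverse (1 - r)) / r ^ (n1 + n2)) * wnorm M V f"
proof -
  have z0: "z \<noteq> 0" using z r by auto
  define N where "N = functional_norm M V F"
  define w where "w = functional_norm M one_weight F"
  have F1: "linear_functional M one_weight F"
    using F P.one_wspace_imp_wspace by (auto simp: linear_functional_def)
  have F1_bdd: "cmod (F f) \<le> C" if "f \<in> wball M one_weight" for f
  proof (rule F_bdd, rule P.wballI)
    show "f \<in> wspace M V" using that P.one.wballD P.one_wspace_imp_wspace by blast
    show "cmod (f x) \<le> V x" if "x \<in> space M" for x
      using P.one.wball_bound[OF \<open>f \<in> wball M one_weight\<close> that] P.weight_ge_1[OF that] by simp
  qed
  have N0: "0 \<le> N" unfolding N_def by (rule P.functional_norm_nonneg[OF F F_bdd])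
  have w0: "0 \<le> w" unfolding w_def by (rule P.one.functional_norm_nonneg[OF F1 F1_bdd])
  have FN: "cmod (F f) \<le> a * N"
    if "f \<in> wspace M V" "\<And>x. x \<in> space M \<Longrightarrow> cmod (f x) \<le> a * V x" "0 \<le> a" for f a
    unfolding N_def by (rule P.functional_norm_bound[OF F F_bdd that])
  have Fw: "cmod (F f) \<le> b * w"
    if "f \<in> wspace M one_weight" "\<And>x. x \<in> space M \<Longrightarrow> cmod (f x) \<le> b" "0 \<le> b" for f b
    unfolding w_def using that by (intro P.one.functional_norm_bound[OF F1 F1_bdd]) auto
  have Fadd: "F (\<lambda>x. u x + v x) = F u + F v" if "u \<in> wspace M V" "v \<in> wspace M V" for u v
    using P.linear_functional_lincomb[OF F that, of 1 1] by simp
  have FNw: "cmod (F f) \<le> a * N + b * w"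
    if f: "f \<in> wspace M V" and ab: "0 \<le> a" "0 \<le> b"
      and bound: "\<And>x. x \<in> space M \<Longrightarrow> cmod (f x) \<le> a * V x + b" for f a b
  proof -
    obtain u v where uv: "u \<in> wspace M V" "v \<in> wspace M one_weight" "f = (\<lambda>x. u x + v x)"
      "\<forall>x\<in>space M. cmod (u x) \<le> a * V x" "\<forall>x\<in>space M. cmod (v x) \<le> b"
      using P.wspace_decompose[OF f ab bound] by blast
    have "F f = F u + F v"
      unfolding uv(3) by (intro Fadd uv(1) P.one_wspace_imp_wspace uv(2))
    then show ?thesis
      using FN[OF uv(1) uv(4)[rule_format] ab(1)] Fw[OF uv(2) uv(5)[rule_format] ab(2)] norm_triangle_ineq[of "F u" "F v"] by simp
  qed
  have rinv: "inverse (cmod z) ^ n \<le> inverse r ^ n" for n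
    using z r by (intro power_mono le_imp_inverse_le) auto

  have strong: "cmod (F f) \<le> (\<alpha> / r) ^ n1 * N + B * w / r ^ n1 + (1 + B) / (r ^ n1 * (1 - r))"
    if f: "f \<in> wball M V" for f
  proof -
    note fV = P.wballD(1)[OF f]
    have pow: "cmod ((TP ^^ n) f x) \<le> \<alpha> ^ n * V x + B" if "x \<in> space M" for n x
      using P.drift_power[OF fV, of 1 x n] P.wball_bound[OF f] that by simp
    have maps: "(TP ^^ n) f \<in> wspace M V" for n by (rule bounded_between_maps[OF P.kernel_power_bounded fV])
    have "cmod (F (\<lambda>x. z * (TP ^^ j) f x - (TP ^^ Suc j) f x)) \<le> 1 + B" for j
    proof -
      have "wnorm M V ((TP ^^ j) f) \<le> 1 + B"
      proof (rule P.wnorm_leI)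
        fix x assume x: "x \<in> space M"
        have "\<alpha> ^ j * V x + B \<le> 1 * V x + B * V x"
        proof (rule add_mono)
          have "\<alpha> ^ j \<le> 1" using P.\<alpha> by (intro power_le_one) auto
          then show "\<alpha> ^ j * V x \<le> 1 * V x" using P.weight_pos[OF x] by (intro mult_right_mono) auto
          show "B \<le> B * V x" using P.weight_ge_1[OF x] B_pos by (metis mult.right_neutral mult_left_mono less_imp_le)
        qed
        then show "cmod ((TP ^^ j) f x) \<le> (1 + B) * V x" using pow[OF x, of j] by (simp add: algebra_simps)
      qed
      then show ?thesis using F_inverse[OF maps[of j]] by simp
    qed
    then have "cmod (\<Sum>j<n1. inverse z ^ Suc j * F (\<lambda>x. z * (TP ^^ j) f x - (TP ^^ Suc j) f x))
        \<le> (1 + B) * (inverse r ^ n1 / (1 - r))"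
      using B_pos by (intro norm_weighted_sum_le r z) auto
    moreover have "cmod (inverse z ^ n1 * F ((TP ^^ n1) f)) \<le> inverse r ^ n1 * (\<alpha> ^ n1 * N + B * w)"
      unfolding norm_mult norm_power norm_inverse
      using P.\<alpha> B_pos rinv r pow by (intro mult_mono FNw maps) auto
    ultimately have "cmod (F f) \<le> (1 + B) * (inverse r ^ n1 / (1 - r)) + inverse r ^ n1 * (\<alpha> ^ n1 * N + B * w)"
      by (subst P.functional_power_expansion[OF F P.kernel_oper_bounded fV z0, of n1])
         (rule norm_triangle_le, rule add_mono)
    also have "\<dots> = (\<alpha> / r) ^ n1 * N + B * w / r ^ n1 + (1 + B) / (r ^ n1 * (1 - r))"
      using r by (simp add: divide_inverse power_mult_distrib power_inverse[symmetric]
          distrib_left distrib_right mult_ac)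
    finally show ?thesis .
  qed

  \<comment> \<open>\<open>G\<close> is small on bounded functions by closeness, and on \<open>wspace M V\<close> it is bounded by the two drifts.\<close>
  define G where "G f = F (\<lambda>x. TP f x - TQ f x)" for f
  have diff_maps: "(\<lambda>x. TP f x - TQ f x) \<in> wspace M V" if "f \<in> wspace M V" for f
    using that by (intro P.wspace_diff bounded_between_maps[OF P.kernel_oper_bounded]
        bounded_between_maps[OF Q.kernel_oper_bounded])
  have G: "linear_functional M V G"
    unfolding linear_functional_def
  proof (intro ballI allI)
    fix f g a b assume fg: "f \<in> wspace M V" "g \<in> wspace M V"
    have "(\<lambda>x. TP (\<lambda>x. a * f x + b * g x) x - TQ (\<lambda>x. a * f x + b * g x) x)
        = (\<lambda>x. a * (TP f x - TQ f x) + b * (TP g x - TQ g x))"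
      by (simp add: bounded_between_lincomb[OF P.kernel_oper_bounded fg]
          bounded_between_lincomb[OF Q.kernel_oper_bounded fg] algebra_simps)
    then show "G (\<lambda>x. a * f x + b * g x) = a * G f + b * G g"
      using P.linear_functional_lincomb[OF F diff_maps[OF fg(1)] diff_maps[OF fg(2)]] by (simp add: G_def)
  qed
  have G_weak: "cmod (G v) \<le> b * \<epsilon> * N"
    if v: "v \<in> wspace M one_weight" "\<And>x. x \<in> space M \<Longrightarrow> cmod (v x) \<le> b" "0 \<le> b" for v b
    unfolding G_def
  proof (rule FN)
    show "(\<lambda>x. TP v x - TQ v x) \<in> wspace M V" using v by (intro diff_maps P.one_wspace_imp_wspace)
    fix x assume x: "x \<in> space M"
    have "wnorm M one_weight v \<le> b" using v by (intro P.one.wnorm_leI) simp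
    then have "\<epsilon> * wnorm M one_weight v * V x \<le> \<epsilon> * b * V x"
      using \<epsilon>_nonneg P.weight_pos[OF x] by (intro mult_right_mono mult_left_mono) auto
    then show "cmod (TP v x - TQ v x) \<le> b * \<epsilon> * V x" using close[OF v(1) x] by (simp add: mult_ac)
  qed (use \<epsilon>_nonneg v in auto)
  have G_strong: "cmod (G u) \<le> a * (2 * \<alpha> * N + 2 * L * w)"
    if u: "u \<in> wspace M V" "\<And>x. x \<in> space M \<Longrightarrow> cmod (u x) \<le> a * V x" "0 \<le> a" for u a
  proof -
    have "cmod (G u) \<le> (2 * a * \<alpha>) * N + (2 * a * L) * w"
      unfolding G_def
    proof (rule FNw[OF diff_maps[OF u(1)]])
      fix x assume x: "x \<in> space M"
      show "cmod (TP u x - TQ u x) \<le> 2 * a * \<alpha> * V x + 2 * a * L"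
        using P.drift_step[OF u(1) u(3), of 0 x] Q.drift_step[OF u(1) u(3), of 0 x] u(2) x
          norm_triangle_ineq4[of "TP u x" "TQ u x"] by (simp add: algebra_simps)
    qed (use P.\<alpha> P.L u in auto)
    then show ?thesis by (simp add: algebra_simps)
  qed

  have weak: "cmod (F f) \<le> H + \<epsilon> * N / (r ^ n2 * (1 - r)) + \<epsilon> * H * B * N / r ^ n2
      + H * (\<alpha> / r) ^ n2 * (2 * \<alpha> * N + 2 * L * w)"
    if f: "f \<in> wball M one_weight" for f
  proof -
    note f1 = P.one.wballD(1)[OF f]
    note fV = P.one_wspace_imp_wspace[OF f1]
    have f_le: "cmod (f x) \<le> 1" if "x \<in> space M" for x using P.one.wball_bound[OF f that] .
    have fV1: "wnorm M V f \<le> 1"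
    proof (rule P.wnorm_leI)
      fix x assume "x \<in> space M"
      then show "cmod (f x) \<le> 1 * V x" using f_le[of x] P.weight_ge_1[of x] by simp
    qed
    define g where "g = R f"
    have g: "g \<in> wspace M V" unfolding g_def by (rule R_maps[OF fV])
    have g_inv: "(\<lambda>x. z * g x - TQ g x) = f" unfolding g_def by (rule R_inverse[OF fV])
    have g_bound: "cmod (g x) \<le> H * V x" if x: "x \<in> space M" for x
    proof -
      have "H * wnorm M V f * V x \<le> H * 1 * V x"
        using H fV1 P.weight_pos[OF x] by (intro mult_right_mono mult_left_mono) auto
      then show ?thesis unfolding g_def using R_bound[OF fV x] by simp
    qed
    have "(\<lambda>x. (z * g x - TP g x) + (TP g x - TQ g x)) = f" using g_inv by simp
    then have Ff: "F f = F (\<lambda>x. z * g x - TP g x) + G g"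
      using Fadd[OF P.wspace_diff[OF P.wspace_cmult[OF g] bounded_between_maps[OF P.kernel_oper_bounded g]]
          diff_maps[OF g], of z] by (simp only: G_def)
    have F1': "cmod (F (\<lambda>x. z * g x - TP g x)) \<le> H"
      using F_inverse[OF g] P.wnorm_leI[of g H, OF g_bound] by simp
    \<comment> \<open>The expansion of \<open>R f\<close> has the iterates of the bounded function \<open>f\<close> as its terms.\<close>
    have pow: "(\<lambda>x. z * (TQ ^^ j) g x - (TQ ^^ Suc j) g x) = (TQ ^^ j) f" for j
      using bounded_between_lincomb[OF Q.kernel_power_bounded g bounded_between_maps[OF Q.kernel_oper_bounded g],
          of j z "-1"] g_inv by (simp add: funpow_swap1)
    have "cmod (G (\<lambda>x. z * (TQ ^^ j) g x - (TQ ^^ Suc j) g x)) \<le> \<epsilon> * N" for j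
    proof -
      have "cmod (G ((TQ ^^ j) f)) \<le> 1 * \<epsilon> * N"
        by (intro G_weak bounded_between_maps[OF Q.one.kernel_power_bounded f1]
            Q.kernel_contraction[OF f1 _ f_le]) auto
      then show ?thesis unfolding pow by simp
    qed
    then have G1: "cmod (\<Sum>j<n2. inverse z ^ Suc j * G (\<lambda>x. z * (TQ ^^ j) g x - (TQ ^^ Suc j) g x))
        \<le> \<epsilon> * N * (inverse r ^ n2 / (1 - r))"
      using N0 \<epsilon>_nonneg by (intro norm_weighted_sum_le r z) auto
    have "cmod (G ((TQ ^^ n2) g)) \<le> H * B * \<epsilon> * N + H * \<alpha> ^ n2 * (2 * \<alpha> * N + 2 * L * w)"
    proof -
      have Qg: "(TQ ^^ n2) g \<in> wspace M V" by (rule bounded_between_maps[OF Q.kernel_power_bounded g])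
      have nn: "0 \<le> H * \<alpha> ^ n2" "0 \<le> H * B" using H P.\<alpha> mult_nonneg_nonneg[OF less_imp_le[OF H] less_imp_le[OF B_pos]] by auto
      obtain u v where uv: "u \<in> wspace M V" "v \<in> wspace M one_weight" "(TQ ^^ n2) g = (\<lambda>x. u x + v x)"
        "\<forall>x\<in>space M. cmod (u x) \<le> H * \<alpha> ^ n2 * V x" "\<forall>x\<in>space M. cmod (v x) \<le> H * B"
        using P.wspace_decompose[OF Qg nn Q.drift_power[OF g less_imp_le[OF H] g_bound]] by blast
      have "G ((TQ ^^ n2) g) = G u + G v"
        unfolding uv(3) using P.linear_functional_lincomb[OF G uv(1) P.one_wspace_imp_wspace[OF uv(2)], of 1 1] by simp
      then show ?thesis
        using G_strong[OF uv(1) uv(4)[rule_format] nn(1)] G_weak[OF uv(2) uv(5)[rule_format] nn(2)] norm_triangle_ineq[of "G u" "G v"] by simp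
    qed
    then have G2: "cmod (inverse z ^ n2 * G ((TQ ^^ n2) g))
        \<le> inverse r ^ n2 * (H * B * \<epsilon> * N + H * \<alpha> ^ n2 * (2 * \<alpha> * N + 2 * L * w))"
      unfolding norm_mult norm_power norm_inverse using rinv r by (intro mult_mono) auto
    have "cmod (G g) \<le> \<epsilon> * N * (inverse r ^ n2 / (1 - r))
        + inverse r ^ n2 * (H * B * \<epsilon> * N + H * \<alpha> ^ n2 * (2 * \<alpha> * N + 2 * L * w))"
      using G1 G2
      by (subst P.functional_power_expansion[OF G Q.kernel_oper_bounded g z0, of n2])
         (rule norm_triangle_le, rule add_mono)
    also have "\<dots> = \<epsilon> * N / (r ^ n2 * (1 - r)) + \<epsilon> * H * B * N / r ^ n2
        + H * (\<alpha> / r) ^ n2 * (2 * \<alpha> * N + 2 * L * w)"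
      using r by (simp add: divide_inverse power_mult_distrib power_inverse[symmetric]
          distrib_left distrib_right mult_ac)
    finally show ?thesis unfolding Ff using F1' norm_triangle_ineq[of "F (\<lambda>x. z * g x - TP g x)" "G g"] by linarith
  qed

  have "N \<le> 4 * (B + 1) / (r ^ n1 * (1 - r)) + 4 * B * (H * B + inverse (1 - r)) / (r ^ n1 * r ^ n2)"
  proof (rule strong_norm_estimate[OF N0 w0 B1 H P.L])
    show "L \<le> B" using P.\<alpha> P.L by (simp add: field_simps)
    show "8 * B * (B + 3) * H * (\<alpha> / r) ^ n2 \<le> r ^ n1" by (rule n2)
    show "\<epsilon> \<le> r ^ n1 * r ^ n2 / (8 * B * (H * B + inverse (1 - r)))" using \<epsilon> by (simp add: power_add)
    have "N \<le> (\<alpha> / r) ^ n1 * N + B * w / r ^ n1 + (1 + B) / (r ^ n1 * (1 - r))"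
      using P.functional_norm_leI[OF strong] by (simp add: N_def)
    moreover have "(\<alpha> / r) ^ n1 * N \<le> 1 / 2 * N" using n1 N0 by (rule mult_right_mono)
    ultimately show "N \<le> N / 2 + B * w / r ^ n1 + (1 + B) / (r ^ n1 * (1 - r))" by simp
    show "w \<le> H + \<epsilon> * N / (r ^ n2 * (1 - r)) + \<epsilon> * H * B * N / r ^ n2
        + H * (\<alpha> / r) ^ n2 * (2 * \<alpha> * N + 2 * L * w)"
      unfolding w_def by (rule P.one.functional_norm_leI) (use weak in \<open>simp add: w_def\<close>)
  qed (use P.\<alpha> r in \<open>auto intro: power_le_one\<close>)
  then have "N * wnorm M V f \<le> (4 * (B + 1) / (r ^ n1 * (1 - r))
      + 4 * B * (H * B + inverse (1 - r)) / r ^ (n1 + n2)) * wnorm M V f"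
    using P.wnorm_nonneg[OF f] by (simp only: power_add mult_right_mono)
  moreover have "cmod (F f) \<le> wnorm M V f * N"
    by (rule FN[OF f P.wnorm_bound[OF f] P.wnorm_nonneg[OF f]])
  ultimately show ?thesis by (simp only: mult.commute[of "wnorm M V f" N])
qed

end

section \<open>From a resolvent bound to a rate of convergence\<close>

text \<open>
Cauchy's estimate, by averaging over the \<open>d\<close>-th roots of unity: among the powers below \<open>d\<close>, all but
the one sought average to zero.
\<close>

lemma polynomial_coefficient_bound:
  fixes a :: "nat \<Rightarrow> complex"
  assumes s: "0 < s" and n: "n < d"
    and bound: "\<And>z. cmod z = s \<Longrightarrow> cmod (\<Sum>i<d. a i * z ^ i) \<le> K"
  shows "cmod (a n) * s ^ n \<le> K"
proof -
  define \<omega> where "\<omega> = exp (2 * of_real pi * \<i> * of_nat 1 / of_nat d :: complex)"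
  have d: "1 \<le> d" using n by simp
  have \<omega>d: "\<omega> ^ d = 1" unfolding \<omega>_def by (rule complex_root_unity) (use n in simp)
  have \<omega>i: "\<omega> ^ i = exp (2 * of_real pi * \<i> * of_nat i / of_nat d)" for i
    unfolding \<omega>_def by (simp add: exp_of_nat_mult[symmetric] mult_ac)
  have \<omega>0: "\<omega> \<noteq> 0" by (simp add: \<omega>_def)
  have \<omega>1: "cmod \<omega> = 1" unfolding \<omega>_def by (simp add: norm_exp_eq_Re)
  define q where "q i = \<omega> ^ i * inverse \<omega> ^ n" for i
  have orth: "(\<Sum>j<d. q i ^ j) = (if i = n then of_nat d else 0)" if i: "i < d" for i
  proof (cases "i = n")
    case True
    then have "q i = 1" using \<omega>0 by (simp add: q_def power_inverse)
    then show ?thesis using True by simp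
  next
    case False
    have "\<omega> ^ i \<noteq> \<omega> ^ n"
      using complex_root_unity_eq[OF d, of i n] i n False by (simp only: \<omega>i) simp
    then have "q i \<noteq> 1" using \<omega>0 by (simp add: q_def power_inverse field_simps)
    moreover have "q i ^ d = 1"
      using \<omega>d by (simp add: q_def power_mult_distrib power_mult[symmetric] mult.commute[of _ d] power_inverse)
         (simp add: power_mult \<omega>d)
    ultimately show ?thesis using False by (simp add: geometric_sum)
  qed
  let ?z = "\<lambda>j. of_real s * \<omega> ^ j"
  have "(\<Sum>j<d. (\<Sum>i<d. a i * ?z j ^ i) * (inverse \<omega> ^ n) ^ j)
      = (\<Sum>j<d. \<Sum>i<d. a i * of_real s ^ i * q i ^ j)"
    by (simp add: q_def sum_distrib_left power_mult_distrib mult_ac flip: power_mult)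
  also have "\<dots> = (\<Sum>i<d. a i * of_real s ^ i * (\<Sum>j<d. q i ^ j))"
    by (subst sum.swap) (simp add: sum_distrib_left)
  also have "\<dots> = (\<Sum>i<d. if i = n then a i * of_real s ^ i * of_nat d else 0)"
    by (intro sum.cong) (auto simp: orth)
  also have "\<dots> = a n * of_real s ^ n * of_nat d" using n by simp
  finally have "a n * of_real s ^ n * of_nat d
      = (\<Sum>j<d. (\<Sum>i<d. a i * ?z j ^ i) * (inverse \<omega> ^ n) ^ j)" ..
  moreover have "cmod \<dots> \<le> (\<Sum>j<d. K)"
  proof (rule sum_norm_le)
    fix j
    have "cmod ((inverse \<omega> ^ n) ^ j) = 1" by (simp add: norm_power norm_inverse \<omega>1)
    moreover have "cmod (\<Sum>i<d. a i * ?z j ^ i) \<le> K"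
      using s by (intro bound) (simp add: norm_mult norm_power \<omega>1)
    ultimately show "cmod ((\<Sum>i<d. a i * ?z j ^ i) * (inverse \<omega> ^ n) ^ j) \<le> K"
      by (simp only: norm_mult)
  qed
  ultimately have "cmod (a n * of_real s ^ n * of_nat d) \<le> (\<Sum>j<d. K)" by simp
  then have "cmod (a n) * s ^ n * real d \<le> K * real d"
    using s by (simp add: norm_mult norm_power mult.commute)
  then show ?thesis using d by simp
qed

lemma sum_lessThan_split:
  fixes g :: "nat \<Rightarrow> 'b::comm_monoid_add"
  shows "(\<Sum>i<m+n. g i) = (\<Sum>i<m. g i) + (\<Sum>i<n. g (m + i))"
  by (induction n) (simp_all add: add.assoc)

text \<open>
The hypothesis \<open>apriori\<close> bounds the resolvent of \<open>T\<close> uniformly off the disc of radius \<open>r\<close> and a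
neighbourhood of \<open>1\<close>, but only where the resolvent is already known to exist, that is, beyond a
radius \<open>s\<close> at which geometric decay holds. The initial rate \<open>\<rho>\<close> may well exceed \<open>r\<close>.
\<close>

locale resolvent_bounded_oper = spectral_oper +
  fixes r \<theta> c \<rho> :: real
  assumes r: "0 < r" "r < 1 - \<theta>" and \<rho>: "0 < \<rho>" "\<rho> < 1 - \<theta>" and \<theta>: "0 < \<theta>" and c: "0 \<le> c"
    and rate_\<rho>: "\<exists>C\<ge>0. \<forall>f\<in>wspace M V. \<forall>x\<in>space M. \<forall>n. cmod (dev f n x) \<le> C * \<rho> ^ n * wnorm M V f * V x"
    and apriori: "ergodic_oper M V T \<nu> h D C s \<Longrightarrow> s < cmod z \<Longrightarrow> r < cmod z \<Longrightarrow> \<theta> < cmod (z - 1) \<Longrightarrow>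
      u \<in> wspace M V \<Longrightarrow> wnorm M V u \<le> c * wnorm M V (\<lambda>x. z * u x - T u x)"
begin

definition rate :: "real \<Rightarrow> bool" where
  "rate s \<longleftrightarrow> 0 < s \<and> (\<exists>C\<ge>0. \<forall>f\<in>wspace M V. \<forall>x\<in>space M. \<forall>n.
     cmod (dev f n x) \<le> C * s ^ n * wnorm M V f * V x)"

lemma rate_mono:
  assumes "rate s" "s \<le> t" shows "rate t"
proof -
  obtain C where s: "0 < s" and C: "0 \<le> C"
    "\<forall>f\<in>wspace M V. \<forall>x\<in>space M. \<forall>n. cmod (dev f n x) \<le> C * s ^ n * wnorm M V f * V x"
    using assms by (auto simp: rate_def)
  have "cmod (dev f n x) \<le> C * t ^ n * wnorm M V f * V x"
    if f: "f \<in> wspace M V" and x: "x \<in> space M" for f x n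
  proof -
    have "C * s ^ n * wnorm M V f * V x \<le> C * t ^ n * wnorm M V f * V x"
      using s assms C(1) wnorm_nonneg[OF f] weight_pos[OF x]
      by (intro mult_right_mono mult_left_mono power_mono) auto
    then show ?thesis using C(2) f x by (meson order_trans)
  qed
  then show ?thesis using s assms C unfolding rate_def by auto
qed

lemma dev_norm:
  assumes "f \<in> wspace M V" "\<forall>f\<in>wspace M V. \<forall>x\<in>space M. \<forall>n. cmod (dev f n x) \<le> C * s ^ n * wnorm M V f * V x"
  shows "wnorm M V (dev f n) \<le> C * s ^ n * wnorm M V f"
  using assms by (intro wnorm_leI) auto

lemma apriori_circle:
  assumes s: "rate t" "t < s" "r < s" "s < 1 - \<theta>" and z: "cmod z = s" and u: "u \<in> wspace M V"
  shows "wnorm M V u \<le> c * wnorm M V (\<lambda>x. z * u x - T u x)"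
proof -
  obtain C where C: "0 < t" "0 \<le> C"
    "\<forall>f\<in>wspace M V. \<forall>x\<in>space M. \<forall>n. cmod (dev f n x) \<le> C * t ^ n * wnorm M V f * V x"
    using s by (auto simp: rate_def)
  have "ergodic_oper M V T \<nu> h D C t"
    by unfold_locales (use C in auto)
  moreover have "\<theta> < cmod (z - 1)"
    using norm_triangle_ineq2[of 1 z] z s by (simp add: norm_minus_commute)
  ultimately show ?thesis using s z u by (intro apriori) auto
qed

lemma T_dev_sum:
  assumes f: "f \<in> wspace M V"
  shows "T (\<lambda>x. \<Sum>n<N. b n * dev f n x) = (\<lambda>x. \<Sum>n<N. b n * dev f (Suc n) x)"
  using bounded_between_sum[OF T_bounded V_weight, of "{..<N}" "dev f" b] by (simp add: dev_wspace f T_dev)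

text \<open>
On the circle \<open>|z| = s\<close> the squared resolvent is bounded by \<open>c\<^sup>2\<close>; it is applied to \<open>dev f 0\<close>, whose
norm is at most \<open>1 + D\<close> times that of \<open>f\<close>. The square is minus the derivative
of the resolvent, so the \<open>n\<close>-th deviation is its coefficient with an extra factor \<open>n + 1\<close>. This
factor is the gain that moves the rate below its infimum. The partial sums \<open>u0\<close> and \<open>u1\<close> of the two
series avoid any exchange of \<open>T\<close> with an infinite sum; they are polynomials in \<open>w = 1 / z\<close>.
\<close>

lemma derivative_coefficient_bound:
  assumes t: "rate t" and s: "t < s" "r < s" "s < 1 - \<theta>" and f: "f \<in> wspace M V" and x: "x \<in> space M"
  shows "real (Suc n) * cmod (dev f n x) \<le> c ^ 2 * (1 + D) * s ^ (n + 2) * wnorm M V f * V x"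
proof -
  have s0: "0 < s" using r s by linarith
  obtain C where t0: "0 < t" and C: "0 \<le> C"
    "\<forall>f\<in>wspace M V. \<forall>x\<in>space M. \<forall>n. cmod (dev f n x) \<le> C * t ^ n * wnorm M V f * V x"
    using t by (auto simp: rate_def)
  define q where "q = t / s"
  have q: "0 \<le> q" "q < 1" using t0 s s0 by (auto simp: q_def)
  define err where "err N = c * (c * ((1 + D) + C * q ^ N) + C / s * (real N * q ^ N))" for N
  have "err \<longlonglongrightarrow> c * (c * ((1 + D) + C * 0) + C / s * 0)"
    unfolding err_def
    by (intro tendsto_intros LIMSEQ_power_zero lim_n_over_pown[of "inverse q", simplified])
      (use q in \<open>auto intro!: powser_times_n_limit_0\<close>)
  then have err: "err \<longlonglongrightarrow> c ^ 2 * (1 + D)" by (simp add: power2_eq_square mult.assoc)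

  have main: "real (Suc n) * cmod (dev f n x) * inverse s ^ n \<le> s ^ 2 * (err N * wnorm M V f * V x)"
    if N: "n < N" for N
  proof -
    have coeff: "cmod (\<Sum>i<N. (of_nat (Suc i) * dev f i x) * w ^ i) \<le> s ^ 2 * (err N * wnorm M V f * V x)"
      if w: "cmod w = inverse s" for w
    proof -
      define z where "z = inverse w"
      have z: "cmod z = s" "inverse z = w" using w s0 by (auto simp: z_def norm_inverse)
      have wz: "z \<noteq> 0" "z * w = 1" using z s0 by (auto simp flip: z(2))
      define u0 where "u0 = (\<lambda>x. \<Sum>i<N. w ^ Suc i * dev f i x)"
      define u1 where "u1 = (\<lambda>x. \<Sum>i<N. (of_nat (Suc i) * w ^ (i + 2)) * dev f i x)"
      have u: "u0 \<in> wspace M V" "u1 \<in> wspace M V"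
        unfolding u0_def u1_def by (intro wspace_sum wspace_cmult dev_wspace f)+
      have zu0: "(\<lambda>x. z * u0 x - T u0 x) = (\<lambda>x. dev f 0 x - w ^ N * dev f N x)"
      proof
        fix x
        have "z * u0 x - T u0 x = (\<Sum>i<N. w ^ i * dev f i x - w ^ Suc i * dev f (Suc i) x)"
          unfolding u0_def T_dev_sum[OF f] using wz
          by (simp add: sum_distrib_left sum_subtractf mult.assoc[symmetric])
        also have "\<dots> = dev f 0 x - w ^ N * dev f N x"
          by (subst sum_lessThan_telescope'[of "\<lambda>i. w ^ i * dev f i x"]) simp
        finally show "z * u0 x - T u0 x = dev f 0 x - w ^ N * dev f N x" .
      qed
      have zu1: "(\<lambda>x. z * u1 x - T u1 x) = (\<lambda>x. u0 x - (of_nat N * w ^ Suc N) * dev f N x)"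
      proof
        fix x
        have "z * u1 x - T u1 x = (\<Sum>i<N. of_nat (Suc i) * w ^ Suc i * dev f i x
            - of_nat (Suc i) * w ^ Suc (Suc i) * dev f (Suc i) x)"
          unfolding u1_def T_dev_sum[OF f] using wz
          by (simp add: sum_distrib_left sum_subtractf mult_ac)
             (simp add: mult.assoc[symmetric])
        also have "\<dots> = (\<Sum>i<N. w ^ Suc i * dev f i x) + (\<Sum>i<N. of_nat i * w ^ Suc i * dev f i x
            - of_nat (Suc i) * w ^ Suc (Suc i) * dev f (Suc i) x)"
          by (simp add: sum.distrib[symmetric] algebra_simps)
        also have "(\<Sum>i<N. of_nat i * w ^ Suc i * dev f i x - of_nat (Suc i) * w ^ Suc (Suc i) * dev f (Suc i) x)
            = - (of_nat N * w ^ Suc N * dev f N x)"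
          by (subst sum_lessThan_telescope'[of "\<lambda>i. of_nat i * w ^ Suc i * dev f i x"]) simp
        finally show "z * u1 x - T u1 x = u0 x - (of_nat N * w ^ Suc N) * dev f N x"
          by (simp add: u0_def)
      qed
      note ap = apriori_circle[OF t s z(1)]
      have dN: "wnorm M V (dev f N) \<le> C * t ^ N * wnorm M V f" by (rule dev_norm[OF f C(2)])
      have d0: "wnorm M V (dev f 0) \<le> (1 + D) * wnorm M V f"
      proof (rule wnorm_leI)
        fix x assume x: "x \<in> space M"
        have "cmod (dev f 0 x) \<le> cmod (f x) + cmod (\<nu> f * h x)" unfolding dev_def by (simp add: norm_triangle_ineq4)
        then show "cmod (dev f 0 x) \<le> (1 + D) * wnorm M V f * V x"
          using wnorm_bound[OF f x] projection_bound[OF f x] by (simp add: algebra_simps)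
      qed
      have wN: "cmod (w ^ N) * (C * t ^ N * wnorm M V f) = C * q ^ N * wnorm M V f"
        by (simp add: norm_power w q_def divide_inverse power_mult_distrib power_inverse[symmetric])
      have "wnorm M V u0 \<le> c * (wnorm M V (dev f 0) + cmod (w ^ N) * wnorm M V (dev f N))"
        using ap[OF u(1)] c wnorm_diff_le[OF dev_wspace[OF f] dev_wspace[OF f], of 0 "w ^ N" N] unfolding zu0
        by (meson mult_left_mono order_trans)
      also have "\<dots> \<le> c * ((1 + D) * wnorm M V f + cmod (w ^ N) * (C * t ^ N * wnorm M V f))"
        using d0 dN c by (intro mult_left_mono add_mono) auto
      finally have u0n: "wnorm M V u0 \<le> c * ((1 + D) + C * q ^ N) * wnorm M V f"
        unfolding wN by (simp add: algebra_simps)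
      have "wnorm M V u1 \<le> c * (wnorm M V u0 + cmod (of_nat N * w ^ Suc N) * wnorm M V (dev f N))"
        using ap[OF u(2)] c wnorm_diff_le[OF u(1) dev_wspace[OF f], of "of_nat N * w ^ Suc N" N] unfolding zu1
        by (meson mult_left_mono order_trans)
      also have "\<dots> \<le> c * (c * ((1 + D) + C * q ^ N) * wnorm M V f
          + cmod (of_nat N * w ^ Suc N) * (C * t ^ N * wnorm M V f))"
        using u0n dN c by (intro mult_left_mono add_mono) auto
      also have "cmod (of_nat N * w ^ Suc N) * (C * t ^ N * wnorm M V f)
          = C / s * (real N * q ^ N) * wnorm M V f"
        by (simp add: norm_mult norm_power w q_def divide_inverse power_mult_distrib power_inverse[symmetric])
      finally have u1n: "wnorm M V u1 \<le> err N * wnorm M V f"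
        unfolding err_def by (simp add: algebra_simps)
      have "cmod (u1 x) \<le> err N * wnorm M V f * V x"
        using wnorm_bound[OF u(2) x] u1n weight_pos[OF x] by (meson less_imp_le mult_right_mono order_trans)
      moreover have "u1 x = w ^ 2 * (\<Sum>i<N. (of_nat (Suc i) * dev f i x) * w ^ i)"
        unfolding u1_def sum_distrib_left by (intro sum.cong refl) (simp add: power_add power2_eq_square mult_ac)
      ultimately have "inverse s ^ 2 * cmod (\<Sum>i<N. (of_nat (Suc i) * dev f i x) * w ^ i) \<le> err N * wnorm M V f * V x"
        by (simp add: norm_mult norm_power w)
      then show ?thesis using s0 by (simp add: field_simps)
    qed
    have "cmod (of_nat (Suc n) * dev f n x) * inverse s ^ n \<le> s ^ 2 * (err N * wnorm M V f * V x)"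
      using polynomial_coefficient_bound[OF _ N coeff] s0 by simp
    then show ?thesis by (simp only: norm_mult norm_of_nat)
  qed
  have "(\<lambda>N. s ^ 2 * (err N * wnorm M V f * V x)) \<longlonglongrightarrow> s ^ 2 * (c ^ 2 * (1 + D) * wnorm M V f * V x)"
    by (intro tendsto_intros err)
  then have "real (Suc n) * cmod (dev f n x) * inverse s ^ n \<le> s ^ 2 * (c ^ 2 * (1 + D) * wnorm M V f * V x)"
    by (rule tendsto_lowerbound) (use main in \<open>auto simp: eventually_sequentially intro!: exI[of _ "Suc n"]\<close>)
  then show ?thesis using s0 by (simp add: field_simps power_add power2_eq_square)
qed

lemma rate_from_contraction:
  assumes m: "0 < m" and \<beta>: "0 < \<beta>" "\<beta> \<le> 1"
    and contr: "\<And>f x. f \<in> wspace M V \<Longrightarrow> x \<in> space M \<Longrightarrow> cmod (dev f m x) \<le> \<beta> * wnorm M V f * V x"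
  shows "rate (root m \<beta>)"
proof -
  define s where "s = root m \<beta>"
  have s: "0 < s" "s ^ m = \<beta>" "s \<le> 1" using m \<beta> by (auto simp: s_def)
  obtain C where C: "0 \<le> C"
    "\<forall>f\<in>wspace M V. \<forall>x\<in>space M. \<forall>n. cmod (dev f n x) \<le> C * \<rho> ^ n * wnorm M V f * V x"
    using rate_\<rho> by auto
  have C1: "wnorm M V (dev f n) \<le> C * wnorm M V f" if f: "f \<in> wspace M V" for f n
  proof -
    have "C * \<rho> ^ n * wnorm M V f \<le> C * 1 * wnorm M V f"
      using C(1) \<rho> \<theta> wnorm_nonneg[OF f] by (intro mult_right_mono mult_left_mono power_le_one) auto
    then show ?thesis using dev_norm[OF f C(2), of n] by simp
  qed
  have step: "wnorm M V (dev f (k * m + i)) \<le> \<beta> ^ k * (C * wnorm M V f)" if f: "f \<in> wspace M V" for f k i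
  proof (induction k)
    case (Suc k)
    have "dev f (Suc k * m + i) = dev (dev f (k * m + i)) m"
      using dev_dev[OF f, of "k * m + i" m] by (simp add: add_ac)
    then have "wnorm M V (dev f (Suc k * m + i)) \<le> \<beta> * wnorm M V (dev f (k * m + i))"
      using contr[OF dev_wspace[OF f]] by (auto intro!: wnorm_leI)
    also have "\<dots> \<le> \<beta> * (\<beta> ^ k * (C * wnorm M V f))" using Suc \<beta> by (intro mult_left_mono) auto
    finally show ?case by (simp add: mult.assoc)
  qed (use C1[OF f] in simp)
  have "cmod (dev f n x) \<le> C / \<beta> * s ^ n * wnorm M V f * V x"
    if f: "f \<in> wspace M V" and x: "x \<in> space M" for f x n
  proof -
    have "\<beta> ^ (n div m) = s ^ (n div m * m)" by (simp add: s(2)[symmetric] power_mult[symmetric] mult.commute)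
    moreover have "\<beta> \<le> s ^ (n mod m)"
      unfolding s(2)[symmetric] using s m by (intro power_decreasing) auto
    ultimately have "\<beta> ^ (n div m) * \<beta> \<le> s ^ (n div m * m) * s ^ (n mod m)"
      using s by (simp add: mult_left_mono)
    then have "\<beta> ^ (n div m) \<le> s ^ n / \<beta>" using \<beta> by (simp add: field_simps flip: power_add)
    then have "\<beta> ^ (n div m) * (C * wnorm M V f) \<le> s ^ n / \<beta> * (C * wnorm M V f)"
      using C(1) wnorm_nonneg[OF f] by (intro mult_right_mono) auto
    then have "wnorm M V (dev f n) \<le> C / \<beta> * s ^ n * wnorm M V f"
      using step[OF f, of "n div m" "n mod m"] by (simp add: mult_ac)
    then show ?thesis
      using wnorm_bound[OF dev_wspace[OF f] x, of n] weight_pos[OF x]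
      by (meson less_imp_le mult_right_mono order_trans)
  qed
  then have "\<forall>f\<in>wspace M V. \<forall>x\<in>space M. \<forall>n. cmod (dev f n x) \<le> C / \<beta> * s ^ n * wnorm M V f * V x" by blast
  moreover have "0 \<le> C / \<beta>" using C \<beta> by simp
  ultimately show ?thesis using s(1) unfolding rate_def s_def[symmetric] by blast
qed

text \<open>
The continuation step. If the infimum \<open>R\<close> of all rates exceeded \<open>r\<close>, the gain of a factor \<open>n + 1\<close>
would persist on circles shrinking to radius \<open>R\<close>, so some \<open>m\<close>-th iterate would contract by a
factor below \<open>R ^ m\<close>, and the semigroup law would turn this into a rate below \<open>R\<close>.
\<close>

lemma rate_above_r:
  assumes s: "r < s" shows "rate s"
proof (rule ccontr)
  assume "\<not> rate s"
  define R where "R = Inf {t. rate t}"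
  have "rate \<rho>" using rate_\<rho> \<rho> by (auto simp: rate_def)
  have bdd: "bdd_below {t. rate t}" by (rule bdd_belowI[of _ 0]) (auto simp: rate_def)
  have above: "rate t" if "R < t" for t
    using cInf_less_iff[of "{t. rate t}" t] bdd \<open>rate \<rho>\<close> that rate_mono unfolding R_def by force
  have Rr: "r < R" using above[of s] \<open>\<not> rate s\<close> s by (meson linorder_not_less order_less_le_trans)
  have R\<rho>: "R \<le> \<rho>" unfolding R_def using bdd \<open>rate \<rho>\<close> by (intro cInf_lower) auto
  have bound: "real (Suc n) * cmod (dev f n x) \<le> c ^ 2 * (1 + D) * R ^ (n + 2) * wnorm M V f * V x"
    if f: "f \<in> wspace M V" and x: "x \<in> space M" for f x n
  proof -
    have "((\<lambda>s. c ^ 2 * (1 + D) * s ^ (n + 2) * wnorm M V f * V x) \<longlongrightarrow>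
        c ^ 2 * (1 + D) * R ^ (n + 2) * wnorm M V f * V x) (at_right R)"
      by (intro tendsto_intros)
    moreover have "\<forall>\<^sub>F s in at_right R. real (Suc n) * cmod (dev f n x) \<le> c ^ 2 * (1 + D) * s ^ (n + 2) * wnorm M V f * V x"
    proof -
      have "\<forall>\<^sub>F s in at_right R. s \<in> {R<..<1 - \<theta>}" using R\<rho> \<rho> by (intro eventually_at_right_real) auto
      then show ?thesis
      proof eventually_elim
        case (elim s)
        then obtain t where "R < t" "t < s" using dense by auto
        then show ?case using elim Rr by (intro derivative_coefficient_bound[OF above _ _ _ f x]) auto
      qed
    qed
    ultimately show ?thesis by (rule tendsto_lowerbound) simp
  qed
  \<comment> \<open>For this \<open>m\<close> the factor \<open>m + 1\<close> outweighs the constant twice over.\<close>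
  obtain m where m: "2 * (c ^ 2 * (1 + D) * R ^ 2) \<le> real m" using real_arch_simple by blast
  define m' where "m' = Suc m"
  have R0: "0 < R" using Rr r by linarith
  define \<beta> where "\<beta> = R ^ m' / 2"
  have "cmod (dev f m' x) \<le> \<beta> * wnorm M V f * V x" if f: "f \<in> wspace M V" and x: "x \<in> space M" for f x
  proof -
    have nn: "0 \<le> R ^ m' * wnorm M V f * V x" using R0 wnorm_nonneg[OF f] weight_pos[OF x] by simp
    have "real (Suc m') * cmod (dev f m' x) \<le> (c ^ 2 * (1 + D) * R ^ 2) * (R ^ m' * wnorm M V f * V x)"
      using bound[OF f x, of m'] by (simp add: power_add power2_eq_square mult_ac)
    also have "\<dots> \<le> real (Suc m') / 2 * (R ^ m' * wnorm M V f * V x)"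
      using m nn by (intro mult_right_mono) (auto simp: m'_def)
    finally show ?thesis by (simp add: \<beta>_def)
  qed
  moreover have "R ^ m' \<le> 1" using R0 R\<rho> \<rho> \<theta> by (intro power_le_one) auto
  moreover have "0 < \<beta>" using R0 by (simp add: \<beta>_def)
  ultimately have "rate (root m' \<beta>)" by (intro rate_from_contraction) (auto simp: m'_def \<beta>_def)
  then have "R \<le> root m' \<beta>" unfolding R_def using bdd by (intro cInf_lower) auto
  then have "R ^ m' \<le> root m' \<beta> ^ m'" using R0 by (intro power_mono) auto
  also have "\<dots> = \<beta>" using \<open>0 < \<beta>\<close> by (intro real_root_pow_pos2) (auto simp: m'_def)
  finally show False using R0 by (simp add: \<beta>_def)
qed

text \<open>
Now every circle of radius \<open>s\<close> between \<open>r\<close> and \<open>1 - \<theta>\<close> carries the bound \<open>c\<close>, and the deviation is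
a Laurent coefficient of the resolvent on it. The part \<open>\<nu> f h / (z - 1)\<close> is expanded in nonnegative
powers of \<open>z\<close>, since \<open>s < 1\<close>, and therefore does not disturb the negative powers that carry the
deviations; this keeps the constant equal to \<open>c\<close>. Both expansions are truncated after \<open>N\<close> terms, and
multiplication by \<open>z ^ N\<close> produces a polynomial.
\<close>

lemma dev_bound:
  assumes f: "f \<in> wspace M V" and x: "x \<in> space M"
  shows "cmod (dev f n x) \<le> c * r ^ (n + 1) * wnorm M V f * V x"
proof -
  have circle: "cmod (dev f n x) \<le> c * s ^ (n + 1) * wnorm M V f * V x" if s: "r < s" "s < 1 - \<theta>" for s
  proof -
    have s0: "0 < s" "s < 1" using r s \<theta> by linarith+
    obtain t where t: "r < t" "t < s" using dense s by blast
    note rt = rate_above_r[OF t(1)]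
    obtain C where t0: "0 < t" and C: "0 \<le> C"
      "\<forall>f\<in>wspace M V. \<forall>x\<in>space M. \<forall>n. cmod (dev f n x) \<le> C * t ^ n * wnorm M V f * V x"
      using rt by (auto simp: rate_def)
    define q where "q = t / s"
    have q: "norm q < 1" using t0 t s0 by (auto simp: q_def)
    define err where "err N = c * (1 + C * q ^ N + D * s ^ N)" for N
    have "err \<longlonglongrightarrow> c * (1 + C * 0 + D * 0)"
      unfolding err_def using q s0 by (intro tendsto_intros LIMSEQ_power_zero) auto
    then have err: "err \<longlonglongrightarrow> c" by simp
    have main: "cmod (dev f n x) \<le> s ^ Suc n * (err N * wnorm M V f * V x)" if N: "n < N" for N
    proof -
      define a where "a i = (if i < N then dev f (N - Suc i) x else - (\<nu> f * h x))" for i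
      have coeff: "cmod (\<Sum>i<N+N. a i * z ^ i) \<le> s ^ N * (err N * wnorm M V f * V x)"
        if z: "cmod z = s" for z
      proof -
        have z0: "z \<noteq> 0" using z s0 by auto
        define w where "w = inverse z"
        have wz: "z * w = 1" using z0 by (simp add: w_def)
        define Z where "Z = (\<Sum>k<N. z ^ k)"
        define u where "u = (\<lambda>x. (\<Sum>i<N. w ^ Suc i * dev f i x) + (- \<nu> f * Z) * h x)"
        have S: "(\<lambda>x. \<Sum>i<N. w ^ Suc i * dev f i x) \<in> wspace M V"
          by (intro wspace_sum wspace_cmult dev_wspace f)
        have u: "u \<in> wspace M V" unfolding u_def by (intro wspace_add S wspace_cmult h_wspace)
        have zu: "z * u x - T u x = f x - w ^ N * dev f N x - z ^ N * (\<nu> f * h x)" for x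
        proof -
          have ux: "u x = (\<Sum>i<N. w ^ Suc i * dev f i x) + (- \<nu> f * Z) * h x" by (simp only: u_def)
          have Tu: "T u x = (\<Sum>i<N. w ^ Suc i * dev f (Suc i) x) + (- \<nu> f * Z) * h x"
            unfolding u_def using T_lincomb[OF S h_wspace, of 1 "- \<nu> f * Z"]
            by (simp add: T_dev_sum[OF f] T_h del: power_Suc)
          have "z * u x - T u x = (\<Sum>i<N. w ^ i * dev f i x - w ^ Suc i * dev f (Suc i) x)
              + ((z - 1) * Z) * (- (\<nu> f * h x))"
          proof -
            have "z * (\<Sum>i<N. w ^ Suc i * dev f i x) = (\<Sum>i<N. w ^ i * dev f i x)"
              using wz by (simp add: sum_distrib_left mult.assoc[symmetric])
            then show ?thesis
              unfolding ux Tu by (simp add: sum_subtractf algebra_simps del: power_Suc)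
          qed
          also have "(\<Sum>i<N. w ^ i * dev f i x - w ^ Suc i * dev f (Suc i) x) = dev f 0 x - w ^ N * dev f N x"
            by (subst sum_lessThan_telescope'[of "\<lambda>i. w ^ i * dev f i x"]) simp
          also have "(z - 1) * Z = z ^ N - 1" unfolding Z_def by (rule power_diff_1_eq[symmetric])
          finally show ?thesis by (simp add: dev_def algebra_simps)
        qed
        have "wnorm M V (\<lambda>x. z * u x - T u x) \<le> (1 + C * q ^ N + D * s ^ N) * wnorm M V f"
        proof (rule wnorm_leI)
          fix x assume x: "x \<in> space M"
          have "cmod (w ^ N * dev f N x) \<le> inverse s ^ N * (C * t ^ N * wnorm M V f * V x)"
            unfolding norm_mult norm_power w_def norm_inverse z
            using s0 C(2) f x by (intro mult_left_mono) auto
          also have "\<dots> = C * q ^ N * wnorm M V f * V x"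
            by (simp add: q_def divide_inverse power_mult_distrib power_inverse[symmetric])
          finally have 1: "cmod (w ^ N * dev f N x) \<le> C * q ^ N * wnorm M V f * V x" .
          have 2: "cmod (z ^ N * (\<nu> f * h x)) \<le> s ^ N * (D * wnorm M V f * V x)"
            unfolding norm_mult[of "z ^ N"] norm_power z
            using s0 projection_bound[OF f x] by (intro mult_left_mono) auto
          have "cmod (z * u x - T u x) \<le> cmod (f x) + cmod (w ^ N * dev f N x) + cmod (z ^ N * (\<nu> f * h x))"
            unfolding zu by (intro order_trans[OF norm_triangle_ineq4] add_right_mono norm_triangle_ineq4)
          then show "cmod (z * u x - T u x) \<le> (1 + C * q ^ N + D * s ^ N) * wnorm M V f * V x"
            using 1 2 wnorm_bound[OF f x] by (simp add: algebra_simps)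
        qed
        then have "wnorm M V u \<le> c * ((1 + C * q ^ N + D * s ^ N) * wnorm M V f)"
          using apriori_circle[OF rt t(2) s z u] c by (meson mult_left_mono order_trans)
        then have "wnorm M V u \<le> err N * wnorm M V f" by (simp add: err_def mult.assoc)
        then have ux: "cmod (u x) \<le> err N * wnorm M V f * V x"
          using wnorm_bound[OF u x] weight_pos[OF x] by (meson less_imp_le mult_right_mono order_trans)
        have "(\<Sum>i<N+N. a i * z ^ i) = (\<Sum>i<N. a i * z ^ i) + (\<Sum>i<N. a (N + i) * z ^ (N + i))"
          by (rule sum_lessThan_split)
        also have "(\<Sum>i<N. a i * z ^ i) = (\<Sum>i<N. z ^ (N - Suc i) * dev f i x)"
          by (subst sum.nat_diff_reindex[symmetric]) (auto simp: a_def intro!: sum.cong)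
        also have "\<dots> = z ^ N * (\<Sum>i<N. w ^ Suc i * dev f i x)"
        proof -
          have "z ^ (N - Suc i) = z ^ N * w ^ Suc i" if "i < N" for i
            using that z0 by (simp add: w_def power_diff power_inverse divide_inverse del: power_Suc)
          then show ?thesis by (simp add: sum_distrib_left mult.assoc)
        qed
        also have "(\<Sum>i<N. a (N + i) * z ^ (N + i)) = z ^ N * ((- \<nu> f * Z) * h x)"
          by (simp add: a_def Z_def power_add sum_distrib_left sum_distrib_right sum_negf mult_ac)
        finally have "(\<Sum>i<N+N. a i * z ^ i) = z ^ N * u x" by (simp add: u_def distrib_left right_diff_distrib)
        then show ?thesis using ux s0 by (simp add: norm_mult norm_power z mult_left_mono)
      qed
      have "cmod (a (N - Suc n)) * s ^ (N - Suc n) \<le> s ^ N * (err N * wnorm M V f * V x)"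
        by (rule polynomial_coefficient_bound[OF s0(1) _ coeff]) (use N in auto)
      moreover have "a (N - Suc n) = dev f n x" using N by (simp add: a_def)
      moreover have "s ^ N = s ^ (N - Suc n) * s ^ Suc n" using N by (simp flip: power_add del: power_Suc)
      ultimately have "s ^ (N - Suc n) * cmod (dev f n x) \<le> s ^ (N - Suc n) * (s ^ Suc n * (err N * wnorm M V f * V x))"
        by (simp add: mult_ac)
      then show ?thesis using s0 by (simp only: mult_le_cancel_left_pos zero_less_power)
    qed
    have "(\<lambda>N. s ^ Suc n * (err N * wnorm M V f * V x)) \<longlonglongrightarrow> s ^ Suc n * (c * wnorm M V f * V x)"
      by (intro tendsto_intros err)
    then have "cmod (dev f n x) \<le> s ^ Suc n * (c * wnorm M V f * V x)"
      by (rule tendsto_lowerbound) (use main in \<open>auto simp: eventually_sequentially intro!: exI[of _ "Suc n"]\<close>)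
    then show ?thesis by (simp add: mult_ac)
  qed
  have "((\<lambda>s. c * s ^ (n + 1) * wnorm M V f * V x) \<longlongrightarrow> c * r ^ (n + 1) * wnorm M V f * V x) (at_right r)"
    by (intro tendsto_intros)
  moreover have "\<forall>\<^sub>F s in at_right r. cmod (dev f n x) \<le> c * s ^ (n + 1) * wnorm M V f * V x"
  proof -
    have "\<forall>\<^sub>F s in at_right r. s \<in> {r<..<1 - \<theta>}" using r by (intro eventually_at_right_real) auto
    then show ?thesis by eventually_elim (use circle in auto)
  qed
  ultimately show ?thesis by (rule tendsto_lowerbound) simp
qed

end

section \<open>Two elementary estimates\<close>

lemma le_floor_power:
  fixes x y :: real
  assumes x: "1 < x" and y: "1 \<le> y"
  defines "n \<equiv> \<lfloor>ln y / ln x\<rfloor> + 1"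
  shows "0 < n" and "y \<le> x ^ nat n"
proof -
  have "0 \<le> ln y / ln x" using x y by simp
  then show n: "0 < n" unfolding n_def by (simp add: zero_le_floor add_nonneg_pos)
  have "ln y / ln x < of_int n" unfolding n_def using floor_correct[of "ln y / ln x"] by simp
  also have "of_int n = real (nat n)" using n by simp
  finally have "ln y < real (nat n) * ln x" using x by (simp add: divide_less_eq)
  then have "ln y < ln (x ^ nat n)" using x by (simp add: ln_realpow)
  then show "y \<le> x ^ nat n" using x y by simp
qed

text \<open>
The two errors, mixing and accumulated perturbation, balance when \<open>r ^ j\<close> is of the order of
\<open>\<Delta>\<close>, that is, at \<open>j = \<lfloor>ln \<Delta> / ln r\<rfloor>\<close>. The extreme cases are separate: \<open>\<Delta> = 0\<close> lets \<open>j\<close> tend to infinity,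
and for \<open>\<Delta> \<ge> 1\<close> no iteration is needed.
\<close>

lemma optimal_iteration_bound:
  fixes X W c r \<Delta> A :: real
  assumes bound: "\<And>j::nat. X \<le> W * (c * r ^ (j + 1) + real j * \<Delta>)"
    and W: "0 \<le> W" and c: "0 \<le> c" and r: "0 < r" "r < 1" and \<Delta>: "0 \<le> \<Delta>" and A: "1 \<le> A"
  shows "X \<le> W * (2 * c + A / ln (inverse r) * \<bar>ln \<Delta>\<bar>) * \<Delta>"
proof -
  have lr: "0 < ln (inverse r)" using r by (simp add: ln_inverse)
  have nonneg: "0 \<le> A / ln (inverse r) * \<bar>ln \<Delta>\<bar>" using A lr by simp
  consider "\<Delta> = 0" | "0 < \<Delta>" "\<Delta> < 1" | "1 \<le> \<Delta>" using \<Delta> by linarith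
  then show ?thesis
  proof cases
    case 1
    have "(\<lambda>j. W * (c * r ^ Suc j + real j * 0)) \<longlonglongrightarrow> W * (c * 0 + 0)"
      using r by (intro tendsto_intros LIMSEQ_Suc[OF LIMSEQ_power_zero]) auto
    then have "(\<lambda>j. W * (c * r ^ Suc j + real j * 0)) \<longlonglongrightarrow> 0" by simp
    then have "X \<le> 0"
      by (rule tendsto_lowerbound) (use bound 1 in auto)
    then show ?thesis using 1 by simp
  next
    case 2
    define j where "j = nat \<lfloor>ln \<Delta> / ln r\<rfloor>"
    have q: "0 \<le> ln \<Delta> / ln r" using 2 r by (simp add: divide_nonpos_neg less_imp_le)
    have j: "real j \<le> ln \<Delta> / ln r" "ln \<Delta> / ln r < real j + 1"
      using q unfolding j_def by auto
    have "real (j + 1) * ln r < ln \<Delta>" using j(2) r by (simp add: neg_divide_less_eq add.commute)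
    then have "ln (r ^ (j + 1)) < ln \<Delta>" using r by (simp only: ln_realpow)
    then have "r ^ (j + 1) \<le> \<Delta>" using r 2 by (subst (asm) ln_less_cancel_iff) auto
    then have "c * r ^ (j + 1) \<le> c * \<Delta>" using c by (rule mult_left_mono)
    moreover have "real j \<le> A / ln (inverse r) * \<bar>ln \<Delta>\<bar>"
    proof -
      have "ln \<Delta> / ln r = 1 / ln (inverse r) * \<bar>ln \<Delta>\<bar>" using r 2 by (simp add: ln_inverse)
      also have "\<dots> \<le> A / ln (inverse r) * \<bar>ln \<Delta>\<bar>"
        using A lr by (intro mult_right_mono divide_right_mono) auto
      finally show ?thesis using j(1) by linarith
    qed
    then have "real j * \<Delta> \<le> A / ln (inverse r) * \<bar>ln \<Delta>\<bar> * \<Delta>" using \<Delta> by (rule mult_right_mono)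
    moreover have "c * \<Delta> \<le> 2 * c * \<Delta>" using c \<Delta> by simp
    ultimately have "c * r ^ (j + 1) + real j * \<Delta> \<le> (2 * c + A / ln (inverse r) * \<bar>ln \<Delta>\<bar>) * \<Delta>"
      unfolding distrib_right by linarith
    from order_trans[OF bound mult_left_mono[OF this W]] show ?thesis by (simp only: mult.assoc)
  next
    case 3
    have "c * r ^ (0 + 1) + real 0 * \<Delta> \<le> c * 1" using c r by (simp add: mult_left_le)
    also have "\<dots> \<le> 2 * c * \<Delta>" using c 3 by (intro order_trans[OF _ mult_left_mono[OF 3]]) auto
    also have "\<dots> \<le> (2 * c + A / ln (inverse r) * \<bar>ln \<Delta>\<bar>) * \<Delta>"
      using nonneg \<Delta> by (intro mult_right_mono) auto
    finally have "c * r ^ (0 + 1) + real 0 * \<Delta> \<le> (2 * c + A / ln (inverse r) * \<bar>ln \<Delta>\<bar>) * \<Delta>" .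
    from order_trans[OF bound mult_left_mono[OF this W]] show ?thesis by (simp only: mult.assoc)
  qed
qed

section \<open>Kernels with an invariant measure\<close>

locale invariant_kernel = weighted_kernel +
  fixes N :: "'a measure"
  assumes invariant: "invariant_measure M K N" and N_finite: "finite_measure N"
    and N_weight: "(\<integral>\<^sup>+x. ennreal (V x) \<partial>N) < \<infinity>"
begin

lemma N_sets: "sets N = sets M"
  using invariant by (simp add: invariant_measure_def)

lemma N_space: "space N = space M"
  using N_sets by (rule sets_eq_imp_space_eq)

lemma kernel_N: "K \<in> N \<rightarrow>\<^sub>M subprob_algebra M"
  using kernel by (simp add: measurable_cong_sets[OF N_sets refl])

lemma bind_invariant: "N \<bind> K = N"
proof (rule measure_eqI)
  show "sets (N \<bind> K) = sets N"
    using sets_bind[of N K M, OF kernel_sets] space_nonempty by (simp add: N_sets N_space)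
  fix A assume "A \<in> sets (N \<bind> K)"
  then have "A \<in> sets M" using \<open>sets (N \<bind> K) = sets N\<close> N_sets by simp
  then show "emeasure (N \<bind> K) A = emeasure N A"
    using emeasure_bind[OF _ kernel_N \<open>A \<in> sets M\<close>] invariant N_space space_nonempty
    by (simp add: invariant_measure_def)
qed

lemma integral_kernel_oper:
  assumes f: "f \<in> wspace M one_weight"
  shows "(LINT x|N. kernel_oper M K f x) = (LINT x|N. f x)"
proof -
  let ?b = "wnorm M one_weight f"
  have fm [measurable]: "f \<in> borel_measurable M" by (rule one.wspace_measurable[OF f])
  have fb: "cmod (f x) \<le> ?b" if "x \<in> space M" for x using one.wnorm_bound[OF f that] by simp
  have mass: "AE x in N. emeasure (K x) (space (K x)) \<le> ennreal 1"
    by (intro AE_I2) (use kernel_subprob in \<open>auto simp: N_space subprob_space.emeasure_space_le_1\<close>)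
  have f_int: "integrable (K x) f" if "x \<in> space M" for x
    using one.wspace_integrable(2)[OF kernel_sets[OF that] one.kernel_weight_finite[OF that] f] .
  have N1: "(\<integral>\<^sup>+x. ennreal 1 \<partial>N) < \<infinity>"
    using finite_measure.emeasure_finite[OF N_finite, of "space N"] by (simp add: top.not_eq_extremum)
  have Kf_int: "integrable N (kernel_oper M K f)" "integrable N f"
    using one.wspace_integrable(2)[OF N_sets N1] f bounded_between_maps[OF one.kernel_oper_bounded f] by auto
  have Re: "(LINT x|N. Re (f x)) = (LINT x|N. Re (kernel_oper M K f x))"
  proof -
    have "integral\<^sup>L (N \<bind> K) (\<lambda>x. Re (f x)) = (LINT x|N. LINT y|K x. Re (f y))"
      by (rule integral_bind[OF _ _ kernel_N N_finite mass, where B = ?b])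
         (measurable, use fb order_trans[OF abs_Re_le_cmod] in blast)
    also have "\<dots> = (LINT x|N. Re (kernel_oper M K f x))"
      by (intro Bochner_Integration.integral_cong) (auto simp: N_space kernel_oper_def f_int)
    finally show ?thesis by (simp add: bind_invariant)
  qed
  have Im: "(LINT x|N. Im (f x)) = (LINT x|N. Im (kernel_oper M K f x))"
  proof -
    have "integral\<^sup>L (N \<bind> K) (\<lambda>x. Im (f x)) = (LINT x|N. LINT y|K x. Im (f y))"
      by (rule integral_bind[OF _ _ kernel_N N_finite mass, where B = ?b])
         (measurable, use fb order_trans[OF abs_Im_le_cmod] in blast)
    also have "\<dots> = (LINT x|N. Im (kernel_oper M K f x))"
      by (intro Bochner_Integration.integral_cong) (auto simp: N_space kernel_oper_def f_int)
    finally show ?thesis by (simp add: bind_invariant)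
  qed
  show ?thesis using Re Im Kf_int by (simp add: complex_eq_iff)
qed

text \<open>
Integrating the drift condition against the invariant measure gives \<open>v \<le> \<delta> v + L N(1)\<close> for the
integral \<open>v\<close> of \<open>V\<close>, which can be solved for \<open>v\<close> because \<open>v\<close> is finite.
\<close>

lemma invariant_weight_bound:
  assumes d: "drift M V K \<delta> L" and \<delta>: "0 < \<delta>" "\<delta> < 1" and L: "0 < L"
  shows "(LINT x|N. V x) \<le> L / (1 - \<delta>) * measure N (space M)"
proof -
  interpret N: finite_measure N by (rule N_finite)
  note V_int = wspace_integrable(1)[OF N_sets N_weight]
  have V0: "0 \<le> V x" if "x \<in> space M" for x using weight_pos[OF that] by simp
  have "ennreal (LINT x|N. V x) = (\<integral>\<^sup>+x. ennreal (V x) \<partial>N)"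
    using V_int V0 by (intro nn_integral_eq_integral[symmetric] AE_I2) (auto simp: N_space)
  also have "\<dots> = (\<integral>\<^sup>+x. \<integral>\<^sup>+y. ennreal (V y) \<partial>K x \<partial>N)"
    using nn_integral_bind[OF _ kernel_N, of "\<lambda>y. ennreal (V y)"] weight_measurable by (simp add: bind_invariant)
  also have "\<dots> \<le> (\<integral>\<^sup>+x. ennreal (\<delta> * V x + L) \<partial>N)"
    using d by (intro nn_integral_mono) (auto simp: drift_def N_space)
  also have "\<dots> = ennreal (LINT x|N. \<delta> * V x + L)"
    using V_int V0 \<delta> L by (intro nn_integral_eq_integral AE_I2) (auto simp: N_space)
  also have "(LINT x|N. \<delta> * V x + L) = \<delta> * (LINT x|N. V x) + L * measure N (space M)"
    using V_int by (simp add: N_space mult.commute)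
  finally have "ennreal (LINT x|N. V x) \<le> ennreal (\<delta> * (LINT x|N. V x) + L * measure N (space M))" .
  moreover have "0 \<le> (LINT x|N. V x)" using V0 by (intro integral_nonneg_AE AE_I2) (simp add: N_space)
  ultimately have "(LINT x|N. V x) \<le> \<delta> * (LINT x|N. V x) + L * measure N (space M)"
    using \<delta> L by (subst (asm) ennreal_le_iff) auto
  then show ?thesis using \<delta> by (simp add: field_simps)
qed

text \<open>
Geometric ergodicity, stated with the operator norm, becomes a pointwise bound. Invariance of the
integral on the unbounded functions of \<open>wspace M V\<close> follows from convergence: the iterates of \<open>f\<close> and
of \<open>T f\<close> have the same limit.
\<close>

lemma ergodic_operI:
  fixes \<phi> :: "'a \<Rightarrow> real" and \<rho> :: real
  assumes \<phi>: "\<phi> \<in> borel_measurable M" "bounded (\<phi> ` space M)"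
    and eigen: "\<And>x. x \<in> space M \<Longrightarrow> (LINT y|K x. \<phi> y) = \<phi> x"
    and normalised: "(LINT x|N. \<phi> x) = 1"
    and ergodic: "geom_ergodic M V K N \<phi> \<rho>"
  defines "h \<equiv> \<lambda>x. if x \<in> space M then complex_of_real (\<phi> x) else 0"
  obtains C D where "ergodic_oper M V (kernel_oper M K) (\<lambda>f. LINT y|N. f y) h D C \<rho>"
proof -
  let ?T = "kernel_oper M K" and ?\<nu> = "\<lambda>f. LINT y|N. (f y :: complex)"
  have W: "weight_space M V" by (rule weight_space_axioms)
  obtain b where b: "\<And>x. x \<in> space M \<Longrightarrow> \<bar>\<phi> x\<bar> \<le> b"
    using \<phi>(2) unfolding bounded_iff by auto
  have b0: "0 \<le> b" using b space_nonempty by (meson abs_ge_zero ex_in_conv order_trans)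
  have "(\<lambda>x. complex_of_real (\<phi> x)) \<in> borel_measurable M" using \<phi>(1) by measurable
  then have "h \<in> borel_measurable M"
    by (rule measurable_cong[THEN iffD1, rotated]) (simp add: h_def)
  then have h1: "h \<in> wspace M one_weight"
    using b by (intro one.wspaceI[where C = b]) (auto simp: h_def)
  then have h: "h \<in> wspace M V" by (rule one_wspace_imp_wspace)
  have h_le: "cmod (h x) \<le> b * V x" if "x \<in> space M" for x
    using b[OF that] mult_left_mono[OF weight_ge_1[OF that] b0] that by (simp add: h_def)
  have Th: "?T h = h"
  proof
    fix x
    show "?T h x = h x"
    proof (cases "x \<in> space M")
      case True
      have "(LINT y|K x. h y) = (LINT y|K x. complex_of_real (\<phi> y))"
        by (intro Bochner_Integration.integral_cong)
           (auto simp: h_def sets_eq_imp_space_eq[OF kernel_sets[OF True]])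
      then show ?thesis using True eigen[OF True] by (simp add: kernel_oper_def h_def)
    qed (simp add: kernel_oper_def h_def)
  qed
  have "(LINT y|N. h y) = (LINT y|N. complex_of_real (\<phi> y))"
    by (intro Bochner_Integration.integral_cong) (auto simp: h_def N_space)
  then have \<nu>h: "?\<nu> h = 1" using normalised by simp
  have \<nu>_lin: "?\<nu> (\<lambda>x. a * f x + b * g x) = a * ?\<nu> f + b * ?\<nu> g"
    if "f \<in> wspace M V" "g \<in> wspace M V" for f g a b
    using integral_lincomb[OF N_sets N_weight that] .
  define D where "D = (LINT x|N. V x) * b"
  have V0: "0 \<le> (LINT x|N. V x)"
    using weight_pos by (intro integral_nonneg_AE AE_I2) (simp add: N_space less_imp_le)
  have D: "cmod (?\<nu> f * h x) \<le> D * wnorm M V f * V x" if f: "f \<in> wspace M V" and x: "x \<in> space M" for f x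
  proof -
    have "cmod (?\<nu> f) \<le> wnorm M V f * (LINT x|N. V x)"
      using integral_weight_bound[OF N_sets N_finite N_weight f, of "wnorm M V f" 0] wnorm_bound[OF f] by simp
    then have "cmod (?\<nu> f) * cmod (h x) \<le> wnorm M V f * (LINT x|N. V x) * (b * V x)"
      using h_le[OF x] V0 wnorm_nonneg[OF f] by (intro mult_mono) auto
    then show ?thesis by (simp add: D_def norm_mult mult_ac)
  qed
  have rank: "rank_one M N \<phi> f = (\<lambda>x. ?\<nu> f * h x)" for f
    by (auto simp: rank_one_def h_def)
  have rank_bounded: "bounded_between M V V (rank_one M N \<phi>)"
    unfolding bounded_between_def
  proof (intro conjI ballI allI exI)
    show "rank_one M N \<phi> ` wspace M V \<subseteq> wspace M V" using h by (auto simp: rank intro!: wspace_cmult)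
    show "rank_one M N \<phi> (\<lambda>x. a * f x + b * g x)
        = (\<lambda>x. a * rank_one M N \<phi> f x + b * rank_one M N \<phi> g x)"
      if "f \<in> wspace M V" "g \<in> wspace M V" for f g a b
      using \<nu>_lin[OF that] by (simp add: rank algebra_simps)
    show "cmod (rank_one M N \<phi> f x) \<le> D * wnorm M V f * V x"
      if "f \<in> wspace M V" "x \<in> space M" for f x
      using D[OF that] by (simp add: rank)
  qed
  obtain C where C: "0 < C" "\<And>n. opnorm M V V (oper_diff (?T ^^ n) (rank_one M N \<phi>)) \<le> C * \<rho> ^ n"
    and \<rho>: "0 < \<rho>" "\<rho> < 1"
    using ergodic by (auto simp: geom_ergodic_def)
  have conv: "cmod ((?T ^^ n) f x - ?\<nu> f * h x) \<le> C * \<rho> ^ n * wnorm M V f * V x"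
    if f: "f \<in> wspace M V" and x: "x \<in> space M" for f x n
  proof -
    have "bounded_between M V V (oper_diff (?T ^^ n) (rank_one M N \<phi>))"
      by (intro bounded_between_diff kernel_power_bounded rank_bounded W)
    then have "cmod (oper_diff (?T ^^ n) (rank_one M N \<phi>) f x)
        \<le> opnorm M V V (oper_diff (?T ^^ n) (rank_one M N \<phi>)) * wnorm M V f * V x"
      by (rule opnorm_bound[OF _ W W f x])
    also have "\<dots> \<le> C * \<rho> ^ n * wnorm M V f * V x"
      using C(2) wnorm_nonneg[OF f] weight_pos[OF x] by (intro mult_right_mono) auto
    finally show ?thesis by (simp add: oper_diff_def rank)
  qed
  have limit: "(\<lambda>n. (?T ^^ n) f x) \<longlonglongrightarrow> ?\<nu> f * h x" if f: "f \<in> wspace M V" and x: "x \<in> space M" for f x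
  proof -
    have "(\<lambda>n. C * \<rho> ^ n * wnorm M V f * V x) \<longlonglongrightarrow> C * 0 * wnorm M V f * V x"
      using \<rho> by (intro tendsto_intros LIMSEQ_power_zero) auto
    then have lim: "(\<lambda>n. C * \<rho> ^ n * wnorm M V f * V x) \<longlonglongrightarrow> 0" by simp
    have "(\<lambda>n. (?T ^^ n) f x - ?\<nu> f * h x) \<longlonglongrightarrow> 0"
      by (rule Lim_null_comparison[OF always_eventually lim]) (rule allI, rule conv[OF f x])
    then show ?thesis by (rule LIM_zero_cancel)
  qed
  have "h \<noteq> (\<lambda>x. 0)" using \<nu>h by auto
  then obtain y where y: "y \<in> space M" "h y \<noteq> 0" using wspace_outside[OF h] by blast
  have \<nu>T: "?\<nu> (?T f) = ?\<nu> f" if f: "f \<in> wspace M V" for f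
  proof -
    have "(\<lambda>n. (?T ^^ Suc n) f y) \<longlonglongrightarrow> ?\<nu> f * h y"
      by (rule LIMSEQ_Suc[OF limit[OF f y(1)]])
    moreover have "(\<lambda>n. (?T ^^ Suc n) f y) \<longlonglongrightarrow> ?\<nu> (?T f) * h y"
      using limit[OF bounded_between_maps[OF kernel_oper_bounded f] y(1)] by (simp add: funpow_swap1)
    ultimately show ?thesis using LIMSEQ_unique y(2) by fastforce
  qed
  interpret S: spectral_oper M V ?T ?\<nu> h D
    by unfold_locales
       (use kernel_oper_bounded \<nu>_lin \<nu>T h Th \<nu>h D V0 b0 in \<open>auto simp: D_def\<close>)
  have "ergodic_oper M V ?T ?\<nu> h D C \<rho>"
    by unfold_locales (use conv C \<rho> in \<open>auto simp: S.dev_def\<close>)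
  then show thesis by (rule that)
qed

end

section \<open>The explicit rate for the limit kernel\<close>

context perturbed_kernel begin

text \<open>
\<open>functional_estimate\<close> applied to the functionals \<open>f \<mapsto> res z f x / V x\<close>. They are norming, so
their uniform bound is a lower bound for \<open>z - TP\<close>.
\<close>

lemma resolvent_estimate:
  assumes P: "ergodic_oper M V TP \<nu> h D C s" and z: "s < cmod z" "z \<noteq> 1"
    and R_maps: "\<And>f. f \<in> wspace M V \<Longrightarrow> R f \<in> wspace M V"
    and R_inverse: "\<And>f. f \<in> wspace M V \<Longrightarrow> (\<lambda>x. z * R f x - TQ (R f) x) = f"
    and R_bound: "\<And>f x. f \<in> wspace M V \<Longrightarrow> x \<in> space M \<Longrightarrow> cmod (R f x) \<le> H * wnorm M V f * V x"
    and H: "0 < H" and rz: "r \<le> cmod z" and r: "0 < r" "r < 1" and B1: "1 \<le> B"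
    and n1: "(\<alpha> / r) ^ n1 \<le> 1 / 2" and n2: "8 * B * (B + 3) * H * (\<alpha> / r) ^ n2 \<le> r ^ n1"
    and \<epsilon>: "\<epsilon> \<le> r ^ (n1 + n2) / (8 * B * (H * B + inverse (1 - r)))"
    and u: "u \<in> wspace M V"
  shows "wnorm M V u \<le> (4 * (B + 1) / (r ^ n1 * (1 - r))
           + 4 * B * (H * B + inverse (1 - r)) / r ^ (n1 + n2)) * wnorm M V (\<lambda>x. z * u x - TP u x)"
proof (rule P.wnorm_leI)
  fix x assume x: "x \<in> space M"
  interpret E: ergodic_oper M V TP \<nu> h D C s by (rule P)
  define F where "F f = E.res z f x / complex_of_real (V x)" for f
  have V: "0 < V x" using P.weight_pos[OF x] .
  have norm_F: "cmod (F f) = cmod (E.res z f x) / V x" for f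
    using V by (simp add: F_def norm_divide)
  have F: "linear_functional M V F"
    unfolding linear_functional_def F_def
    by (auto simp: E.res_lincomb[OF _ _ z(1)] add_divide_distrib)
  have F_res: "cmod (F f) \<le> (C / (cmod z - s) + D / cmod (z - 1)) * wnorm M V f" if "f \<in> wspace M V" for f
    using E.res_bound[OF that x z(1)] V by (simp add: norm_F divide_le_eq)
  have F_bdd: "cmod (F f) \<le> C / (cmod z - s) + D / cmod (z - 1)" if f: "f \<in> wball M V" for f
  proof -
    have "0 \<le> C / (cmod z - s) + D / cmod (z - 1)" using E.C_nonneg E.D_nonneg z by simp
    then show ?thesis using F_res[OF P.wballD(1)[OF f]] P.wballD(2)[OF f] by (meson mult_left_le order_trans)
  qed
  have F_inverse: "cmod (F (\<lambda>x. z * f x - TP f x)) \<le> wnorm M V f" if f: "f \<in> wspace M V" for f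
    using P.wnorm_bound[OF f x] V by (simp add: norm_F E.res_left_inverse[OF f z] divide_le_eq)
  have zu: "(\<lambda>x. z * u x - TP u x) \<in> wspace M V"
    by (intro P.wspace_diff P.wspace_cmult E.T_maps u)
  have "cmod (F (\<lambda>x. z * u x - TP u x)) \<le> (4 * (B + 1) / (r ^ n1 * (1 - r))
      + 4 * B * (H * B + inverse (1 - r)) / r ^ (n1 + n2)) * wnorm M V (\<lambda>x. z * u x - TP u x)"
    by (rule functional_estimate[OF F F_bdd F_inverse R_maps R_inverse R_bound H rz r B1 n1 n2 \<epsilon> zu])
  then show "cmod (u x) \<le> (4 * (B + 1) / (r ^ n1 * (1 - r))
      + 4 * B * (H * B + inverse (1 - r)) / r ^ (n1 + n2)) * wnorm M V (\<lambda>x. z * u x - TP u x) * V x"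
    using V by (simp add: norm_F E.res_left_inverse[OF u z] divide_le_eq)
qed

end

text \<open>
Since \<open>N\<close> is invariant under \<open>Q\<close>, each replacement of \<open>Q\<close> by \<open>P\<close> changes the integral of a bounded
function by at most \<open>\<Delta>\<close> times the integral of \<open>V\<close>, and \<open>j\<close> steps of \<open>P\<close> bring the function close to
the constant \<open>p\<close>.
\<close>

lemma stationary_distance:
  fixes p :: complex
  assumes Q: "invariant_kernel M V Q N" and P: "weighted_kernel M V P"
    and f: "f \<in> wspace M one_weight" "\<And>x. x \<in> space M \<Longrightarrow> cmod (f x) \<le> 1"
    and close: "\<And>g x. g \<in> wspace M one_weight \<Longrightarrow> x \<in> space M \<Longrightarrow>
      cmod (kernel_oper M Q g x - kernel_oper M P g x) \<le> \<Delta> * wnorm M one_weight g * V x"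
    and \<Delta>: "0 \<le> \<Delta>"
    and mixing: "\<And>x. x \<in> space M \<Longrightarrow> cmod ((kernel_oper M P ^^ j) f x - p) \<le> e * V x"
  shows "cmod ((LINT x|N. f x) - measure N (space M) * p) \<le> (e + real j * \<Delta>) * (LINT x|N. V x)"
proof -
  interpret Q: invariant_kernel M V Q N by (rule Q)
  interpret P: weighted_kernel M V P by (rule P)
  let ?TP = "kernel_oper M P" and ?TQ = "kernel_oper M Q"
  note int = Q.wspace_integrable(2)[OF Q.N_sets Q.N_weight]
  have maps1: "(?TP ^^ i) f \<in> wspace M one_weight" for i
    by (rule bounded_between_maps[OF P.one.kernel_power_bounded f(1)])
  note maps = Q.one_wspace_imp_wspace[OF maps1]
  have drift: "cmod ((LINT x|N. (?TP ^^ i) f x) - (LINT x|N. f x)) \<le> real i * \<Delta> * (LINT x|N. V x)" for i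
  proof (induction i)
    case (Suc i)
    let ?g = "(?TP ^^ i) f"
    have d: "(\<lambda>x. ?TQ ?g x - ?TP ?g x) \<in> wspace M V"
      by (intro Q.wspace_diff bounded_between_maps[OF Q.kernel_oper_bounded]
          bounded_between_maps[OF P.kernel_oper_bounded] maps)
    have "wnorm M one_weight ?g \<le> 1"
      using P.kernel_contraction[OF f(1) _ f(2)] by (intro Q.one.wnorm_leI) auto
    then have "\<Delta> * wnorm M one_weight ?g * V x \<le> \<Delta> * 1 * V x" if "x \<in> space M" for x
      using \<Delta> Q.weight_pos[OF that] by (intro mult_right_mono mult_left_mono) auto
    then have "cmod (?TQ ?g x - ?TP ?g x) \<le> \<Delta> * V x" if "x \<in> space M" for x
      using close[OF maps1[of i] that] that by force
    then have "cmod (LINT x|N. ?TQ ?g x - ?TP ?g x) \<le> \<Delta> * (LINT x|N. V x)"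
      using Q.integral_weight_bound[OF Q.N_sets Q.N_finite Q.N_weight d, of \<Delta> 0] by simp
    also have "(LINT x|N. ?TQ ?g x - ?TP ?g x) = (LINT x|N. ?g x) - (LINT x|N. ?TP ?g x)"
      using int bounded_between_maps[OF Q.kernel_oper_bounded maps[of i]]
        bounded_between_maps[OF P.kernel_oper_bounded maps[of i]] Q.integral_kernel_oper[OF maps1[of i]]
      by simp
    finally have step: "cmod ((LINT x|N. ?TP ?g x) - (LINT x|N. ?g x)) \<le> \<Delta> * (LINT x|N. V x)"
      by (simp add: norm_minus_commute)
    have "cmod ((LINT x|N. ?TP ?g x) - (LINT x|N. f x))
        \<le> cmod ((LINT x|N. ?TP ?g x) - (LINT x|N. ?g x)) + cmod ((LINT x|N. ?g x) - (LINT x|N. f x))"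
      using norm_triangle_ineq[of "(LINT x|N. ?TP ?g x) - (LINT x|N. ?g x)" "(LINT x|N. ?g x) - (LINT x|N. f x)"]
      by simp
    then show ?case using step Suc by (simp add: algebra_simps)
  qed simp
  define g where "g = (\<lambda>x. if x \<in> space M then p else 0)"
  have "(\<lambda>x. p) \<in> borel_measurable M" by simp
  then have "g \<in> borel_measurable M"
    by (rule measurable_cong[THEN iffD1, rotated]) (simp add: g_def)
  then have "g \<in> wspace M one_weight"
    by (rule Q.one.wspaceI[where C = "cmod p"]) (auto simp: g_def)
  then have g: "g \<in> wspace M V" by (rule Q.one_wspace_imp_wspace)
  have "(LINT x|N. g x) = (LINT x|N. p)"
    by (intro Bochner_Integration.integral_cong) (auto simp: g_def Q.N_space)
  then have "(LINT x|N. (?TP ^^ j) f x - g x) = (LINT x|N. (?TP ^^ j) f x) - measure N (space M) * p"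
    using int[OF maps[of j]] int[OF g] by (simp add: Q.N_space scaleR_conv_of_real)
  moreover have "cmod (LINT x|N. (?TP ^^ j) f x - g x) \<le> e * (LINT x|N. V x)"
    using Q.integral_weight_bound[OF Q.N_sets Q.N_finite Q.N_weight Q.wspace_diff[OF maps[of j] g], of e 0]
      mixing by (simp add: g_def)
  ultimately have "cmod ((LINT x|N. (?TP ^^ j) f x) - measure N (space M) * p) \<le> e * (LINT x|N. V x)" by simp
  then have "cmod ((LINT x|N. f x) - measure N (space M) * p)
      \<le> real j * \<Delta> * (LINT x|N. V x) + e * (LINT x|N. V x)"
    using drift[of j] norm_triangle_ineq[of "(LINT x|N. f x) - (LINT x|N. (?TP ^^ j) f x)"
        "(LINT x|N. (?TP ^^ j) f x) - measure N (space M) * p"]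
    by (simp add: norm_minus_commute)
  then show ?thesis by (simp add: algebra_simps)
qed

theorem theorem4p1:
  fixes M :: "'a measure"
    and V :: "'a \<Rightarrow> real"
    and P :: "'a \<Rightarrow> 'a measure"
    and \<pi> :: "'a measure"
    and Q :: "nat \<Rightarrow> 'a \<Rightarrow> 'a measure"
    and \<mu> :: "nat \<Rightarrow> 'a measure"
    and \<phi> :: "nat \<Rightarrow> 'a \<Rightarrow> real"
    and \<rho> \<delta> L \<alpha> A B \<theta> \<rho>\<^sub>k r H \<epsilon> c :: real
    and k :: nat
    and n\<^sub>1 n\<^sub>2 :: int
    and \<Delta> :: "nat \<Rightarrow> real"
  assumes setting: "approx_setting M V P \<pi> Q \<mu> \<phi>"
    and P_ergodic: "geom_ergodic M V P \<pi> (\<lambda>_. 1) \<rho>"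
    and \<Delta>_def: "\<Delta> = (\<lambda>n. opnorm M one_weight V (oper_diff (kernel_oper M (Q n)) (kernel_oper M P)))"
    and \<Delta>_lim: "\<Delta> \<longlonglongrightarrow> 0"
    and \<delta>: "0 < \<delta>" "\<delta> < 1"
    and L: "0 < L"
    and P_drift: "drift M V P \<delta> L"
    and Q_drift: "\<And>n. n \<ge> 1 \<Longrightarrow> drift M V (Q n) \<delta> L"
    and \<alpha>_def: "\<alpha> = max (ess_spectral_radius M V (kernel_oper M P)) \<delta>"
    and B_def: "B = L / (1 - \<alpha>)"
    and A_def: "A = 1 + L / (1 - \<delta>)"
    and \<theta>: "0 < \<theta>" "\<theta> < min ((1 - \<alpha>) / 3) ((1 - \<rho>) / 3)"
    and k: "k \<ge> 1"
    and Qk_ergodic: "geom_ergodic M V (Q k) (\<mu> k) (\<phi> k) \<rho>\<^sub>k"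
    and \<rho>\<^sub>k: "\<rho>\<^sub>k < 1 - 2 * \<theta>"
    and r: "max \<alpha> \<rho>\<^sub>k + \<theta> < r" "r < 1 - \<theta>"
    and H_def: "H = (SUP z \<in> - spectral_nbhd M V r \<theta> (kernel_oper M (Q k)).
                       opnorm M V V (resolvent M V (kernel_oper M (Q k)) z))"
    and n\<^sub>1_def: "n\<^sub>1 = \<lfloor>ln 2 / ln (r / \<alpha>)\<rfloor> + 1"
    and n\<^sub>2_def: "n\<^sub>2 = \<lfloor>ln (8 * B * (B + 3) * (r powi (- n\<^sub>1)) * H) / ln (r / \<alpha>)\<rfloor> + 1"
    and \<epsilon>_def: "\<epsilon> = (r powi (n\<^sub>1 + n\<^sub>2)) / (8 * B * (H * B + inverse (1 - r)))"
    and c_def: "c = 4 * (B + 1) / ((r powi n\<^sub>1) * (1 - r)) + 1 / (2 * \<epsilon>)"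
    and close: "opnorm M one_weight V (oper_diff (kernel_oper M P) (kernel_oper M (Q k))) \<le> \<epsilon>"
  shows "(\<forall>n. opnorm M V V (oper_diff (kernel_oper M P ^^ n) (rank_one M \<pi> (\<lambda>_. 1)))
                \<le> c * r ^ (n + 1)) \<and>
         (\<forall>n\<ge>1. tv_dist M (\<mu> n) \<pi>
                \<le> \<bar>1 - measure (\<mu> n) (space M)\<bar>
                  + L / (1 - \<delta>) * (2 * c + A / ln (inverse r) * \<bar>ln (\<Delta> n)\<bar>) * \<Delta> n)"
proof -
  interpret S: approx_setting M V P \<pi> Q \<mu> \<phi> by (rule setting)
  have W: "weight_space M V"
    using S.V_measurable S.V_ge_1 S.V_eq_1 by unfold_locales auto
  interpret W: weight_space M V by (rule W)
  have \<alpha>: "\<delta> \<le> \<alpha>" "0 < \<alpha>" "\<alpha> < 1"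
    using \<delta> \<theta> by (auto simp: \<alpha>_def)
  have r0: "0 < r" "r < 1" "\<alpha> < r" "\<rho>\<^sub>k + \<theta> < r" using r \<alpha> \<theta> by auto
  have P_sub: "P \<in> M \<rightarrow>\<^sub>M subprob_algebra M" by (rule measurable_prob_algebraD[OF S.P_kernel])
  have P_prob: "prob_space (P x)" "sets (P x) = sets M" if "x \<in> space M" for x
    using measurable_space[OF S.P_kernel that] by (auto simp: space_prob_algebra)
  have kernels: "weighted_kernel M V P" "weighted_kernel M V (Q n)" if "n \<ge> 1" for n
    using W P_sub S.P_V_bounded S.Q_kernel[OF that] S.Q_V_bounded[OF that]
    by (simp_all add: weighted_kernel_def weighted_kernel_axioms_def)
  note kernel_P = kernels(1)[OF k]
  interpret P: weighted_kernel M V P by (rule kernel_P)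
  interpret Q: weighted_kernel M V "Q k" by (rule kernels(2)[OF k])
  interpret pi: prob_space \<pi> by (rule S.pi_prob)
  interpret PI: invariant_kernel M V P \<pi>
    using kernel_P S.pi_invariant pi.finite_measure_axioms S.pi_V
    by (simp add: invariant_kernel_def invariant_kernel_axioms_def)
  have QI: "invariant_kernel M V (Q n) (\<mu> n)" if "n \<ge> 1" for n
    using kernels(2)[OF that] S.mu_invariant[OF that] S.mu_finite[OF that] S.mu_V[OF that]
    by (simp add: invariant_kernel_def invariant_kernel_axioms_def)
  interpret QI: invariant_kernel M V "Q k" "\<mu> k" by (rule QI[OF k])

  have B_eq: "B = L / (1 - \<alpha>)" by (rule B_def)
  \<comment> \<open>The drift condition at a point where \<open>V = 1\<close> forces \<open>1 \<le> \<delta> + L\<close>.\<close>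
  have B1: "1 \<le> B"
  proof -
    obtain x where x: "x \<in> space M" "V x = 1" using S.V_eq_1 by blast
    have "ennreal 1 = (\<integral>\<^sup>+y. ennreal 1 \<partial>P x)"
      using prob_space.emeasure_space_1[OF P_prob(1)[OF x(1)]] by simp
    also have "\<dots> \<le> (\<integral>\<^sup>+y. ennreal (V y) \<partial>P x)"
      using W.weight_ge_1 by (intro nn_integral_mono ennreal_leI)
        (simp add: sets_eq_imp_space_eq[OF P_prob(2)[OF x(1)]])
    also have "\<dots> \<le> ennreal (\<delta> * V x + L)" using P_drift x(1) by (auto simp: drift_def)
    finally have "1 \<le> \<delta> + L" using x \<delta> L by (subst (asm) ennreal_le_iff) auto
    then show ?thesis using \<alpha> by (simp add: B_def le_divide_eq)
  qed

  obtain Ck Dk where "ergodic_oper M V (kernel_oper M (Q k)) (\<lambda>f. LINT y|\<mu> k. f y)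
      (\<lambda>x. if x \<in> space M then complex_of_real (\<phi> k x) else 0) Dk Ck \<rho>\<^sub>k"
    by (rule QI.ergodic_operI[OF S.phi_measurable[OF k] S.phi_bounded[OF k] S.phi_eigen[OF k] S.mu_phi[OF k] Qk_ergodic])
  then interpret EQ: ergodic_oper M V "kernel_oper M (Q k)" "\<lambda>f. LINT y|\<mu> k. f y"
    "\<lambda>x. if x \<in> space M then complex_of_real (\<phi> k x) else 0" Dk Ck \<rho>\<^sub>k .
  obtain C D where EP: "ergodic_oper M V (kernel_oper M P) (\<lambda>f. LINT y|\<pi>. f y)
      (\<lambda>x. if x \<in> space M then complex_of_real 1 else 0) D C \<rho>"
  proof (rule PI.ergodic_operI[OF _ _ _ _ P_ergodic])
    show "(LINT y|P x. 1) = (1::real)" if "x \<in> space M" for x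
      using prob_space.prob_space[OF P_prob(1)[OF that]] by simp
    show "(LINT x|\<pi>. 1) = (1::real)" using pi.prob_space by simp
    show "bounded ((\<lambda>x. 1 :: real) ` space M)" by (auto simp: bounded_iff intro!: exI[of _ 1])
  qed auto
  interpret EP: ergodic_oper M V "kernel_oper M P" "\<lambda>f. LINT y|\<pi>. f y"
    "\<lambda>x. if x \<in> space M then complex_of_real 1 else 0" D C \<rho> by (rule EP)

  have H: "r < cmod z \<Longrightarrow> \<theta> < cmod (z - 1) \<Longrightarrow> f \<in> wspace M V \<Longrightarrow> x \<in> space M \<Longrightarrow>
      cmod (EQ.res z f x) \<le> H * wnorm M V f * V x" "1 / (2 * \<theta>) \<le> H" for z f x
    using EQ.resolvent_sup[OF \<theta>(1) r0(4) r(2)] unfolding H_def by auto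
  have H1: "1 \<le> H"
  proof -
    have "1 \<le> 1 / (2 * \<theta>)" using \<theta> \<alpha> by (simp add: field_simps)
    then show ?thesis using H(2) by linarith
  qed

  define m1 m2 where "m1 = nat n\<^sub>1" and "m2 = nat n\<^sub>2"
  have ratio: "1 < r / \<alpha>" using r0 \<alpha> by simp
  have inv_ratio: "(\<alpha> / r) ^ n * (r / \<alpha>) ^ n = 1" for n
    using \<alpha> r0 by (simp flip: power_mult_distrib)
  have n1: "0 < n\<^sub>1" "2 \<le> (r / \<alpha>) ^ m1"
    using le_floor_power[OF ratio, of 2] by (auto simp: n\<^sub>1_def m1_def)
  have powi1: "r powi (- n\<^sub>1) = inverse (r ^ m1)" "r powi n\<^sub>1 = r ^ m1"
    using n1(1) by (simp_all add: m1_def power_int_def power_inverse)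
  have 1: "(\<alpha> / r) ^ m1 \<le> 1 / 2"
  proof -
    have "(\<alpha> / r) ^ m1 * 2 \<le> (\<alpha> / r) ^ m1 * (r / \<alpha>) ^ m1" using n1(2) \<alpha> r0 by (intro mult_left_mono) auto
    then show ?thesis by (simp add: inv_ratio)
  qed
  define X where "X = 8 * B * (B + 3) * (r powi (- n\<^sub>1)) * H"
  have X1: "1 \<le> X"
  proof -
    have "1 \<le> inverse (r ^ m1)" using r0 by (simp add: one_le_inverse power_le_one)
    then have "1 * 1 * 1 * 1 \<le> (8 * B) * (B + 3) * inverse (r ^ m1) * H"
      using B1 H1 r0 by (intro mult_mono mult_nonneg_nonneg) auto
    then show ?thesis by (simp add: X_def powi1)
  qed
  have n2: "0 < n\<^sub>2" "X \<le> (r / \<alpha>) ^ m2"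
    using le_floor_power[OF ratio X1] by (auto simp: n\<^sub>2_def m2_def X_def)
  have 2: "8 * B * (B + 3) * H * (\<alpha> / r) ^ m2 \<le> r ^ m1"
  proof -
    have "X * (\<alpha> / r) ^ m2 \<le> (r / \<alpha>) ^ m2 * (\<alpha> / r) ^ m2" using n2(2) \<alpha> r0 by (intro mult_right_mono) auto
    then have "X * (\<alpha> / r) ^ m2 \<le> 1" by (simp add: inv_ratio mult.commute)
    then show ?thesis using r0 by (simp add: X_def powi1 field_simps)
  qed
  have powi2: "r powi (n\<^sub>1 + n\<^sub>2) = r ^ (m1 + m2)"
    using n1(1) n2(1) by (simp add: m1_def m2_def power_int_def nat_add_distrib)
  define Y where "Y = H * B + inverse (1 - r)"
  have Y: "0 < Y" using H1 B1 r0 by (auto simp: Y_def intro!: add_pos_pos mult_pos_pos)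
  have \<epsilon>: "\<epsilon> = r ^ (m1 + m2) / (8 * B * Y)" by (simp add: \<epsilon>_def powi2 Y_def)
  have \<epsilon>0: "0 < \<epsilon>" using Y B1 r0 by (simp add: \<epsilon>)
  have c: "c = 4 * (B + 1) / (r ^ m1 * (1 - r)) + 4 * B * Y / r ^ (m1 + m2)"
    using Y B1 r0 by (simp add: c_def \<epsilon> powi1)
  have c0: "0 \<le> c" using Y B1 r0 by (simp add: c)

  have diff_bounded: "bounded_between M one_weight V (oper_diff (kernel_oper M K) (kernel_oper M K'))"
    if "weighted_kernel M V K" "weighted_kernel M V K'" for K K'
  proof -
    interpret K: weighted_kernel M V K by fact
    interpret K': weighted_kernel M V K' by fact
    have "bounded_between M one_weight one_weight (oper_diff (kernel_oper M K) (kernel_oper M K'))"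
      by (intro bounded_between_diff K.one.kernel_oper_bounded K'.one.kernel_oper_bounded W.one.weight_space_axioms)
    then show ?thesis by (rule W.bounded_between_one_imp)
  qed
  have close': "cmod (kernel_oper M K f x - kernel_oper M K' f x)
      \<le> opnorm M one_weight V (oper_diff (kernel_oper M K) (kernel_oper M K')) * wnorm M one_weight f * V x"
    if "weighted_kernel M V K" "weighted_kernel M V K'" "f \<in> wspace M one_weight" "x \<in> space M" for K K' f x
    using opnorm_bound[OF diff_bounded[OF that(1,2)] W.one.weight_space_axioms W that(3,4)]
    by (simp add: oper_diff_def)

  have perturbed: "perturbed_kernel M V P (Q k) \<alpha> L \<epsilon>"
  proof (intro perturbed_kernel.intro perturbed_kernel_axioms.intro drift_kernel.intro drift_kernel_axioms.intro)
    fix f x assume f: "f \<in> wspace M one_weight" and x: "x \<in> space M"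
    have "cmod (kernel_oper M P f x - kernel_oper M (Q k) f x)
        \<le> opnorm M one_weight V (oper_diff (kernel_oper M P) (kernel_oper M (Q k))) * wnorm M one_weight f * V x"
      by (rule close'[OF kernel_P kernels(2)[OF k] f x])
    also have "\<dots> \<le> \<epsilon> * wnorm M one_weight f * V x"
      using close W.one.wnorm_nonneg[OF f] W.weight_pos[OF x] by (intro mult_right_mono) auto
    finally show "cmod (kernel_oper M P f x - kernel_oper M (Q k) f x) \<le> \<epsilon> * wnorm M one_weight f * V x" .
  qed (use kernel_P kernels(2)[OF k] k \<alpha> L \<epsilon>0 drift_mono[OF W P_drift] drift_mono[OF W Q_drift[OF k]] in auto)
  interpret perturbed_kernel M V P "Q k" \<alpha> L \<epsilon> by (rule perturbed)

  interpret RB: resolvent_bounded_oper M V "kernel_oper M P" "\<lambda>f. LINT y|\<pi>. f y"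
    "\<lambda>x. if x \<in> space M then complex_of_real 1 else 0" D r \<theta> c \<rho>
  proof unfold_locales
    show "\<rho> < 1 - \<theta>" "0 < \<rho>" using \<theta> P_ergodic by (auto simp: geom_ergodic_def)
    show "\<exists>C\<ge>0. \<forall>f\<in>wspace M V. \<forall>x\<in>space M. \<forall>n.
        cmod (EP.dev f n x) \<le> C * \<rho> ^ n * wnorm M V f * V x"
      using EP.convergence EP.C_nonneg by blast
  next
    fix C s z u
    assume E: "ergodic_oper M V (kernel_oper M P) (\<lambda>f. LINT y|\<pi>. f y)
        (\<lambda>x. if x \<in> space M then complex_of_real 1 else 0) D C s"
      and z: "s < cmod z" "r < cmod z" "\<theta> < cmod (z - 1)" and u: "u \<in> wspace M V"
    have z1: "z \<noteq> 1" "\<rho>\<^sub>k < cmod z" using z r0 \<theta> by auto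
    show "wnorm M V u \<le> c * wnorm M V (\<lambda>x. z * u x - kernel_oper M P u x)"
      unfolding c Y_def B_eq
    proof (rule resolvent_estimate[OF E z(1) z1(1) EQ.res_wspace[OF _ z1(2)] EQ.res_right_inverse[OF _ z1(2,1)]
          H(1)[OF z(2,3)] _ less_imp_le[OF z(2)] r0(1,2) _ 1 _ _ u])
      show "0 < H" using H1 by simp
    qed (use B1 2 \<epsilon> in \<open>simp_all add: B_eq Y_def\<close>)
  qed (use r0 r \<theta> c0 in auto)

  have dev: "(kernel_oper M P ^^ n) f x - (LINT y|\<pi>. f y) = EP.dev f n x" if "x \<in> space M" for f n x
    using that by (simp add: EP.dev_def)
  have part_a: "cmod ((kernel_oper M P ^^ n) f x - (LINT y|\<pi>. f y)) \<le> c * r ^ (n + 1) * V x"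
    if f: "f \<in> wball M V" and x: "x \<in> space M" for f n x
  proof -
    have "cmod (EP.dev f n x) \<le> c * r ^ (n + 1) * wnorm M V f * V x"
      by (rule RB.dev_bound[OF W.wballD(1)[OF f] x])
    also have "\<dots> \<le> c * r ^ (n + 1) * 1 * V x"
      using W.wballD(2)[OF f] c0 r0 W.weight_pos[OF x] by (intro mult_right_mono mult_left_mono) auto
    finally show ?thesis by (simp add: dev[OF x])
  qed
  have "opnorm M V V (oper_diff (kernel_oper M P ^^ n) (rank_one M \<pi> (\<lambda>_. 1))) \<le> c * r ^ (n + 1)" for n
    using part_a by (intro opnorm_leI W) (auto simp: oper_diff_def rank_one_def)
  moreover have "tv_dist M (\<mu> n) \<pi> \<le> \<bar>1 - measure (\<mu> n) (space M)\<bar>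
      + L / (1 - \<delta>) * (2 * c + A / ln (inverse r) * \<bar>ln (\<Delta> n)\<bar>) * \<Delta> n" if n: "n \<ge> 1" for n
  proof -
    interpret N: invariant_kernel M V "Q n" "\<mu> n" by (rule QI[OF n])
    interpret mu: finite_measure "\<mu> n" by (rule S.mu_finite[OF n])
    \<comment> \<open>\<open>\<mu> n\<close> need not be a probability measure: it is compared with \<open>m\<close> times \<open>\<pi>\<close>, and the total mass \<open>m\<close> is corrected at the end.\<close>
    define m where "m = measure (\<mu> n) (space M)"
    define E where "E = L / (1 - \<delta>) * (2 * c + A / ln (inverse r) * \<bar>ln (\<Delta> n)\<bar>) * \<Delta> n"
    have m: "0 < m"
    proof (rule ccontr)
      assume "\<not> 0 < m"
      then have "emeasure (\<mu> n) (space (\<mu> n)) = 0"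
        by (simp add: m_def N.N_space mu.emeasure_eq_measure zero_less_measure_iff)
      then have "AE x in \<mu> n. \<phi> n x = 0" by (intro AE_I[of _ _ "space (\<mu> n)"]) auto
      then have "(LINT x|\<mu> n. \<phi> n x) = 0" by (rule integral_eq_zero_AE)
      then show False using S.mu_phi[OF n] by simp
    qed
    have \<Delta>0: "0 \<le> \<Delta> n"
      using W.opnorm_one_nonneg[OF diff_bounded[OF kernels(2)[OF n] kernel_P]] by (simp add: \<Delta>_def)
    have weight: "(LINT x|\<mu> n. V x) \<le> L / (1 - \<delta>) * m"
      unfolding m_def by (rule N.invariant_weight_bound[OF Q_drift[OF n] \<delta> L])
    have V0: "0 \<le> (LINT x|\<mu> n. V x)"
      using W.weight_pos by (intro integral_nonneg_AE AE_I2) (simp add: N.N_space less_imp_le)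
    have "cmod ((LINT x|\<mu> n. f x) - (LINT x|\<pi>. f x)) \<le> \<bar>1 - m\<bar> + E" if f: "f \<in> wball M one_weight" for f
    proof -
      note f1 = W.one.wballD(1)[OF f]
      have f_le: "cmod (f x) \<le> 1" if "x \<in> space M" for x using W.one.wball_bound[OF f that] .
      have fV: "f \<in> wball M V"
        using f_le W.weight_ge_1 by (intro W.wballI W.one_wspace_imp_wspace f1) (meson order_trans)
      let ?d = "cmod ((LINT x|\<mu> n. f x) - m * (LINT x|\<pi>. f x))"
      have "?d / m \<le> L / (1 - \<delta>) * (c * r ^ (j + 1) + real j * \<Delta> n)" for j
      proof -
        have "?d \<le> (c * r ^ (j + 1) + real j * \<Delta> n) * (LINT x|\<mu> n. V x)"
          unfolding m_def
          by (rule stationary_distance[OF QI[OF n] kernel_P f1 f_le])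
             (use close'[OF kernels(2)[OF n] kernel_P] \<Delta>0 part_a[OF fV] in \<open>auto simp: \<Delta>_def\<close>)
        also have "\<dots> \<le> (c * r ^ (j + 1) + real j * \<Delta> n) * (L / (1 - \<delta>) * m)"
          using weight c0 r0 \<Delta>0 by (intro mult_left_mono) auto
        finally show ?thesis using m by (simp add: divide_le_eq mult_ac)
      qed
      then have d: "?d / m \<le> E"
        unfolding E_def using L \<delta> c0 r0 \<Delta>0 A_def by (intro optimal_iteration_bound) auto
      have "cmod (LINT x|\<mu> n. f x) \<le> m"
        using W.one.integral_weight_bound[OF N.N_sets S.mu_finite[OF n] _ f1, of 0 1] f_le mu.emeasure_finite
        by (simp add: m_def less_top[symmetric])
      then have "\<bar>m - 1\<bar> / m * cmod (LINT x|\<mu> n. f x) \<le> \<bar>m - 1\<bar> / m * m"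
        using m by (intro mult_left_mono) auto
      then have mass: "\<bar>m - 1\<bar> / m * cmod (LINT x|\<mu> n. f x) \<le> \<bar>1 - m\<bar>" using m by (simp add: abs_minus_commute)
      have "(LINT x|\<mu> n. f x) - (LINT x|\<pi>. f x)
          = of_real ((m - 1) / m) * (LINT x|\<mu> n. f x) + of_real (inverse m) * ((LINT x|\<mu> n. f x) - m * (LINT x|\<pi>. f x))"
        using m by (simp add: field_simps)
      also have "cmod \<dots> \<le> \<bar>m - 1\<bar> / m * cmod (LINT x|\<mu> n. f x) + ?d / m"
        using m by (intro order_trans[OF norm_triangle_ineq]) (simp add: norm_mult norm_divide norm_inverse divide_inverse abs_mult mult.commute del: of_real_diff of_real_divide of_real_mult of_real_inverse)
      finally show ?thesis using d mass by linarith
    qed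
    then show ?thesis
      unfolding tv_dist_def E_def[symmetric] m_def[symmetric] using W.one.wball_zero by (intro cSUP_least) auto
  qed
  ultimately show ?thesis by blast
qed

end
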